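(* Let $\epsilon\in(0,2)$ and let $\mathcal{L}^2=L^2(-\pi,\pi)$. Let $L$ be the operator in $\mathcal{L}^2$ given by $(Ly)(x)=\epsilon\,(\sin(x)\,y'(x))'+y'(x)$, with domain consisting of all absolutely continuous $2\pi$-periodic functions $y$ (i.e. $y(-\pi)=y(\pi)$) for which $\sin(x)y'(x)$ is locally absolutely continuous and $(Ly)(x)\in\mathcal{L}^2$. Let $L_0$ be the restriction of $L$ to the set of all smooth $2\pi$-periodic functions, and $\bar{L}_0$ its closure. Then $L=\bar{L}_0$. Moreover, let $J$ be the operator on $\mathcal{L}^2$ defined by $(Jf)(x)=f(\pi-x)$ (with functions regarded as $2\pi$-periodic); then $L=JL^{*}J$, i.e. $L$ is $J$-self-adjoint in the Krein space $(\mathcal{L}^2,[\cdot,\cdot])$ with indefinite inner product $[f,g]=\langle Jf,g\rangle$.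
   Context: $L^*$ denotes the Hilbert-space adjoint of $L$ in $L^2(-\pi,\pi)$. An operator $T$ is called $J$-self-adjoint if $T=JT^*J$, where $J$ is a self-adjoint involution (fundamental symmetry) defining the Krein space. *)

theory Defs
  imports "HOL-Analysis.Analysis"
begin

text \<open>Elements of L2(-pi,pi) are represented by functions real => complex that are
  Borel measurable on [-pi,pi] with square-integrable modulus there.  Operators are
  represented by their graphs (sets of pairs of functions); all graphs below are
  closed under almost-everywhere equality on [-pi,pi].\<close>

definition L2 :: "(real \<Rightarrow> complex) \<Rightarrow> bool" where
  "L2 f \<longleftrightarrow> set_borel_measurable lborel {-pi..pi} f \<and>
            set_integrable lborel {-pi..pi} (\<lambda>x. (cmod (f x))\<^sup>2)"

definition L2_inner :: "(real \<Rightarrow> complex) \<Rightarrow> (real \<Rightarrow> complex) \<Rightarrow> complex" where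
  "L2_inner f g = (LINT x:{-pi..pi}|lborel. f x * cnj (g x))"

definition L2_norm :: "(real \<Rightarrow> complex) \<Rightarrow> real" where
  "L2_norm f = sqrt (LINT x:{-pi..pi}|lborel. (cmod (f x))\<^sup>2)"

definition abs_cont_on :: "real set \<Rightarrow> (real \<Rightarrow> complex) \<Rightarrow> bool" where
  "abs_cont_on S f \<longleftrightarrow>
     (\<forall>e>0. \<exists>d>0. \<forall>(n::nat) (a::nat \<Rightarrow> real) b.
        (\<forall>k<n. a k \<le> b k \<and> {a k..b k} \<subseteq> S) \<and>
        disjoint_family_on (\<lambda>k. {a k<..<b k}) {..<n} \<and>
        (\<Sum>k<n. b k - a k) < d
        \<longrightarrow> (\<Sum>k<n. cmod (f (b k) - f (a k))) < e)"

definition loc_abs_cont :: "(real \<Rightarrow> complex) \<Rightarrow> bool" where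
  "loc_abs_cont f \<longleftrightarrow> (\<forall>a b. -pi < a \<and> b < pi \<longrightarrow> abs_cont_on {a..b} f)"

definition smooth_fun :: "(real \<Rightarrow> complex) \<Rightarrow> bool" where
  "smooth_fun f \<longleftrightarrow> (\<exists>D :: nat \<Rightarrow> real \<Rightarrow> complex. D 0 = f \<and>
        (\<forall>n x. (D n has_vector_derivative D (Suc n) x) (at x)))"

definition periodic_2pi :: "(real \<Rightarrow> complex) \<Rightarrow> bool" where
  "periodic_2pi f \<longleftrightarrow> (\<forall>x. f (x + 2 * pi) = f x)"

definition Lgraph :: "real \<Rightarrow> ((real \<Rightarrow> complex) \<times> (real \<Rightarrow> complex)) set" where
  "Lgraph eps = {(y, f). L2 y \<and> L2 f \<and>
     (\<exists>u u' p p'. abs_cont_on {-pi..pi} u \<and> u (-pi) = u pi \<and> loc_abs_cont p \<and>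
        (AE x in lborel. x \<in> {-pi..pi} \<longrightarrow>
            y x = u x \<and> (u has_vector_derivative u' x) (at x) \<and>
            p x = complex_of_real (sin x) * u' x \<and>
            (p has_vector_derivative p' x) (at x) \<and>
            f x = complex_of_real eps * p' x + u' x))}"

definition L0graph :: "real \<Rightarrow> ((real \<Rightarrow> complex) \<times> (real \<Rightarrow> complex)) set" where
  "L0graph eps = {(y, f) \<in> Lgraph eps. \<exists>\<phi>. smooth_fun \<phi> \<and> periodic_2pi \<phi> \<and>
        (AE x in lborel. x \<in> {-pi..pi} \<longrightarrow> y x = \<phi> x)}"

definition graph_closure ::
  "((real \<Rightarrow> complex) \<times> (real \<Rightarrow> complex)) set \<Rightarrow> ((real \<Rightarrow> complex) \<times> (real \<Rightarrow> complex)) set" where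
  "graph_closure G = {(y, f). L2 y \<and> L2 f \<and>
     (\<exists>s :: nat \<Rightarrow> (real \<Rightarrow> complex) \<times> (real \<Rightarrow> complex). (\<forall>n. s n \<in> G) \<and>
        (\<lambda>n. L2_norm (\<lambda>x. fst (s n) x - y x)) \<longlonglongrightarrow> 0 \<and>
        (\<lambda>n. L2_norm (\<lambda>x. snd (s n) x - f x)) \<longlonglongrightarrow> 0)}"

definition adjoint_graph ::
  "((real \<Rightarrow> complex) \<times> (real \<Rightarrow> complex)) set \<Rightarrow> ((real \<Rightarrow> complex) \<times> (real \<Rightarrow> complex)) set" where
  "adjoint_graph G = {(g, h). L2 g \<and> L2 h \<and>
     (\<forall>(y, f) \<in> G. L2_inner f g = L2_inner y h)}"

text \<open>2pi-periodic extension of the restriction to [-pi,pi), and J f(x) = f(pi - x).\<close>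
definition per_ext :: "(real \<Rightarrow> complex) \<Rightarrow> real \<Rightarrow> complex" where
  "per_ext f x = f (x - 2 * pi * of_int \<lfloor>(x + pi) / (2 * pi)\<rfloor>)"

definition Jop :: "(real \<Rightarrow> complex) \<Rightarrow> real \<Rightarrow> complex" where
  "Jop f x = per_ext f (pi - x)"

text \<open>Graph of J T J for an operator T given by its graph (J is an involution).\<close>
definition J_conj_graph ::
  "((real \<Rightarrow> complex) \<times> (real \<Rightarrow> complex)) set \<Rightarrow> ((real \<Rightarrow> complex) \<times> (real \<Rightarrow> complex)) set" where
  "J_conj_graph T = {(u, v). (Jop u, Jop v) \<in> T}"

end

theory Submission
  imports Defs
begin

text \<open>
  Write \<open>p = sin * y'\<close>, so that \<open>L y = f\<close> becomes \<open>eps * p' + p / sin = f\<close>. On each half period the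
  only admissible solution is \<open>T p = (1 / eps) * integral of T f from 0\<close> with \<open>T = |tan (x / 2)| powr (1 / eps)\<close>.
  Integrating \<open>(|p|^2 / sin)'\<close> shows, for \<open>eps < 2\<close>, that \<open>y' = p / sin\<close> and \<open>p'\<close> are square
  integrable and that \<open>p\<close> vanishes at \<open>- pi, 0, pi\<close>. Hence \<open>L\<close> maps onto the functions of mean zero, with
  the constants as kernel.

  Every trigonometric polynomial is \<open>(sin * v)' + a + b * sin\<close> with \<open>v\<close> a trigonometric polynomial, so the
  functions \<open>(sin * v)'\<close> are dense among the possible \<open>p'\<close>. By Hardy's inequality an approximation of
  \<open>p'\<close> also approximates \<open>y' = p / sin\<close>, and therefore trigonometric polynomials form a core of \<open>L\<close>.

  On trigonometric polynomials, integration by parts gives \<open><L y, J u> = <y, J L u>\<close>; this passes to the closure,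
  so \<open>L\<close> is contained in \<open>J L* J\<close>, and so is the closure of \<open>L_0\<close> because adjoints are closed.
  Conversely, if \<open>(u, v)\<close> lies in \<open>J L* J\<close>, then \<open>v\<close> has mean zero and \<open>L z = v\<close> for some \<open>z\<close>;
  \<open>J (u - z)\<close> is orthogonal to the range of \<open>L\<close>, so \<open>u - z\<close> is constant.
\<close>

subsection \<open>Square-integrable functions on a measure space\<close>

text \<open>The threshold 2 can be read off the homogeneous solution \<open>1 / T\<close> on a half
  period. At 0 it blows up like \<open>x powr (- 1 / eps)\<close>, so continuity of \<open>p\<close>
  there excludes it. At pi nothing is assumed about \<open>p\<close>; there \<open>1 / T\<close>
  decays like \<open>(pi - x) powr (1 / eps)\<close>, and its quotient by \<open>sin\<close> is
  square integrable exactly when \<open>eps < 2\<close>. The decay of \<open>p\<close> at pi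
  therefore has to come out of the energy integral. For the core, closeness of \<open>p'\<close>
  controls \<open>p / sin\<close> only if the error in \<open>p\<close> vanishes at every zero of
  \<open>sin\<close>. Approximants \<open>(sin * v)'\<close> have this property built in, and the
  same \<open>v\<close> then approximates \<open>y'\<close>. The involution \<open>J\<close> enters
  because integration by parts reverses the sign of the term \<open>y'\<close>, while the reflection
  \<open>x -> pi - x\<close> preserves \<open>sin\<close> and reverses the derivative, which undoes
  this sign. Absolute continuity is given by its epsilon-delta definition, so its fundamental
  theorem of calculus has to be derived for the gauge integral.\<close>

definition sq_int :: "'a measure \<Rightarrow> ('a \<Rightarrow> complex) \<Rightarrow> bool" where
  "sq_int M f \<longleftrightarrow> f \<in> borel_measurable M \<and> integrable M (\<lambda>x. (cmod (f x))\<^sup>2)"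

definition sqn :: "'a measure \<Rightarrow> ('a \<Rightarrow> complex) \<Rightarrow> real" where
  "sqn M f = sqrt (LINT x|M. (cmod (f x))\<^sup>2)"

lemma sq_int_meas: "sq_int M f \<Longrightarrow> f \<in> borel_measurable M"
  by (simp add: sq_int_def)

lemma sqn_nonneg [simp]: "0 \<le> sqn M f"
  by (simp add: sqn_def)

lemma sqn_power2: "(sqn M f)\<^sup>2 = (LINT x|M. (cmod (f x))\<^sup>2)"
  by (simp add: sqn_def)

lemma sq_int_bound:
  assumes "sq_int M f" "g \<in> borel_measurable M" "AE x in M. cmod (g x) \<le> C * cmod (f x)"
  shows "sq_int M g"
  unfolding sq_int_def
proof
  show "integrable M (\<lambda>x. (cmod (g x))\<^sup>2)"
  proof (rule Bochner_Integration.integrable_bound)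
    show "integrable M (\<lambda>x. C\<^sup>2 * (cmod (f x))\<^sup>2)"
      using assms(1) by (simp add: sq_int_def)
    show "AE x in M. norm ((cmod (g x))\<^sup>2) \<le> norm (C\<^sup>2 * (cmod (f x))\<^sup>2)"
      using assms(3)
    proof eventually_elim
      case (elim x)
      then have "(cmod (g x))\<^sup>2 \<le> (C * cmod (f x))\<^sup>2" by (intro power_mono) auto
      then show ?case by (simp add: power_mult_distrib)
    qed
  qed (use assms in measurable)
qed (use assms in simp)

lemma sq_int_cong_AE:
  assumes "sq_int M f" "g \<in> borel_measurable M" "AE x in M. g x = f x"
  shows "sq_int M g"
  by (rule sq_int_bound[OF assms(1,2), of 1]) (use assms(3) in \<open>auto elim: eventually_mono\<close>)

lemma sq_int_cmult: "sq_int M f \<Longrightarrow> sq_int M (\<lambda>x. c * f x)"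
  by (rule sq_int_bound[of M f _ "cmod c"]) (auto simp: norm_mult sq_int_def)

lemma sq_int_uminus: "sq_int M f \<Longrightarrow> sq_int M (\<lambda>x. - f x)"
  using sq_int_cmult[of M f "-1"] by simp

lemma sq_int_divide: "sq_int M f \<Longrightarrow> sq_int M (\<lambda>x. f x / c)"
  using sq_int_cmult[of M f "inverse c"] by (simp add: field_simps)

lemma sq_int_cnj: "sq_int M f \<Longrightarrow> sq_int M (\<lambda>x. cnj (f x))"
  by (rule sq_int_bound[of M f _ 1])
     (auto simp: sq_int_def intro!: borel_measurable_continuous_on[of cnj] continuous_intros)

lemma sq_int_add:
  assumes "sq_int M f" "sq_int M g"
  shows "sq_int M (\<lambda>x. f x + g x)"
  unfolding sq_int_def
proof
  note [measurable] = sq_int_meas[OF assms(1)] sq_int_meas[OF assms(2)]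
  show "(\<lambda>x. f x + g x) \<in> borel_measurable M" by measurable
  show "integrable M (\<lambda>x. (cmod (f x + g x))\<^sup>2)"
  proof (rule Bochner_Integration.integrable_bound)
    show "integrable M (\<lambda>x. 2 * (cmod (f x))\<^sup>2 + 2 * (cmod (g x))\<^sup>2)"
      using assms by (simp add: sq_int_def)
    have "(cmod (u + v))\<^sup>2 \<le> 2 * (cmod u)\<^sup>2 + 2 * (cmod v)\<^sup>2" for u v :: complex
    proof -
      have "(cmod (u + v))\<^sup>2 \<le> (cmod u + cmod v)\<^sup>2"
        by (intro power_mono norm_triangle_ineq) auto
      also have "\<dots> \<le> 2 * (cmod u)\<^sup>2 + 2 * (cmod v)\<^sup>2"
        using sum_squares_bound[of "cmod u" "cmod v"] by (simp add: power2_sum)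
      finally show ?thesis .
    qed
    then show "AE x in M. norm ((cmod (f x + g x))\<^sup>2) \<le> norm (2 * (cmod (f x))\<^sup>2 + 2 * (cmod (g x))\<^sup>2)"
      by simp
  qed measurable
qed

lemma sq_int_diff: "sq_int M f \<Longrightarrow> sq_int M g \<Longrightarrow> sq_int M (\<lambda>x. f x - g x)"
  using sq_int_add[of M f "\<lambda>x. - g x"] sq_int_uminus[of M g] by simp

lemma integrable_prod_cmod:
  assumes "sq_int M f" "sq_int M g"
  shows "integrable M (\<lambda>x. cmod (f x) * cmod (g x))"
proof (rule Bochner_Integration.integrable_bound)
  note [measurable] = sq_int_meas[OF assms(1)] sq_int_meas[OF assms(2)]
  show "integrable M (\<lambda>x. (cmod (f x))\<^sup>2 + (cmod (g x))\<^sup>2)"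
    using assms by (simp add: sq_int_def)
  have "a * b \<le> a\<^sup>2 + b\<^sup>2" if "0 \<le> a" "0 \<le> b" for a b :: real
    using sum_squares_bound[of a b] mult_nonneg_nonneg[OF that] by simp
  then show "AE x in M. norm (cmod (f x) * cmod (g x)) \<le> norm ((cmod (f x))\<^sup>2 + (cmod (g x))\<^sup>2)"
    by (simp add: abs_mult)
  show "(\<lambda>x. cmod (f x) * cmod (g x)) \<in> borel_measurable M" by measurable
qed

lemma integrable_sq_mult:
  assumes "sq_int M f" "sq_int M g"
  shows "integrable M (\<lambda>x. f x * g x)"
  using integrable_prod_cmod[OF assms]
  by (rule Bochner_Integration.integrable_bound)
     (use sq_int_meas[OF assms(1)] sq_int_meas[OF assms(2)] in \<open>auto simp: norm_mult\<close>)

lemma cauchy_schwarz_sq: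
  assumes "sq_int M f" "sq_int M g"
  shows "(LINT x|M. cmod (f x) * cmod (g x)) \<le> sqn M f * sqn M g"
proof -
  note [measurable] = sq_int_meas[OF assms(1)] sq_int_meas[OF assms(2)]
  have "(\<integral>\<^sup>+x. ennreal (cmod (f x)) * ennreal (cmod (g x)) \<partial>M)\<^sup>2
      \<le> (\<integral>\<^sup>+x. (ennreal (cmod (f x)))\<^sup>2 \<partial>M) * (\<integral>\<^sup>+x. (ennreal (cmod (g x)))\<^sup>2 \<partial>M)"
    by (rule Cauchy_Schwarz_nn_integral) measurable
  also have "(\<integral>\<^sup>+x. (ennreal (cmod (f x)))\<^sup>2 \<partial>M) = ennreal (LINT x|M. (cmod (f x))\<^sup>2)"
    using assms by (subst nn_integral_eq_integral[symmetric]) (auto simp: sq_int_def ennreal_power)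
  also have "(\<integral>\<^sup>+x. (ennreal (cmod (g x)))\<^sup>2 \<partial>M) = ennreal (LINT x|M. (cmod (g x))\<^sup>2)"
    using assms by (subst nn_integral_eq_integral[symmetric]) (auto simp: sq_int_def ennreal_power)
  also have "(\<integral>\<^sup>+x. ennreal (cmod (f x)) * ennreal (cmod (g x)) \<partial>M) = ennreal (LINT x|M. cmod (f x) * cmod (g x))"
    using integrable_prod_cmod[OF assms]
    by (subst nn_integral_eq_integral[symmetric]) (auto simp: ennreal_mult)
  finally have "(LINT x|M. cmod (f x) * cmod (g x))\<^sup>2 \<le> (LINT x|M. (cmod (f x))\<^sup>2) * (LINT x|M. (cmod (g x))\<^sup>2)"
    by (simp add: ennreal_power flip: ennreal_mult)
  then have "(LINT x|M. cmod (f x) * cmod (g x))\<^sup>2 \<le> (sqn M f * sqn M g)\<^sup>2"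
    by (simp add: power_mult_distrib sqn_power2)
  then show ?thesis
    by (rule power2_le_imp_le) simp
qed

lemma cauchy_schwarz_mult:
  assumes "sq_int M f" "sq_int M g"
  shows "cmod (LINT x|M. f x * g x) \<le> sqn M f * sqn M g"
proof -
  have "cmod (LINT x|M. f x * g x) \<le> (LINT x|M. cmod (f x) * cmod (g x))"
    using integral_norm_bound[of M "\<lambda>x. f x * g x"] by (simp add: norm_mult)
  then show ?thesis using cauchy_schwarz_sq[OF assms] by simp
qed

lemma sqn_add:
  assumes "sq_int M f" "sq_int M g"
  shows "sqn M (\<lambda>x. f x + g x) \<le> sqn M f + sqn M g"
proof (rule power2_le_imp_le)
  note [measurable] = sq_int_meas[OF assms(1)] sq_int_meas[OF assms(2)]
  have i: "integrable M (\<lambda>x. (cmod (f x))\<^sup>2)" "integrable M (\<lambda>x. (cmod (g x))\<^sup>2)"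
    using assms by (auto simp: sq_int_def)
  note i2 = integrable_prod_cmod[OF assms]
  have "(sqn M (\<lambda>x. f x + g x))\<^sup>2 \<le> (LINT x|M. (cmod (f x))\<^sup>2 + (cmod (g x))\<^sup>2 + 2 * (cmod (f x) * cmod (g x)))"
    unfolding sqn_power2
  proof (rule integral_mono)
    show "integrable M (\<lambda>x. (cmod (f x + g x))\<^sup>2)"
      using sq_int_add[OF assms] by (simp add: sq_int_def)
    show "integrable M (\<lambda>x. (cmod (f x))\<^sup>2 + (cmod (g x))\<^sup>2 + 2 * (cmod (f x) * cmod (g x)))"
      using i i2 by simp
    fix x
    have "(cmod (f x + g x))\<^sup>2 \<le> (cmod (f x) + cmod (g x))\<^sup>2"
      by (intro power_mono norm_triangle_ineq) auto
    then show "(cmod (f x + g x))\<^sup>2 \<le> (cmod (f x))\<^sup>2 + (cmod (g x))\<^sup>2 + 2 * (cmod (f x) * cmod (g x))"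
      by (simp add: power2_sum)
  qed
  also have "\<dots> = (sqn M f)\<^sup>2 + (sqn M g)\<^sup>2 + 2 * (LINT x|M. cmod (f x) * cmod (g x))"
    using i i2 by (simp add: sqn_power2)
  also have "\<dots> \<le> (sqn M f + sqn M g)\<^sup>2"
    using cauchy_schwarz_sq[OF assms] by (simp add: power2_sum)
  finally show "(sqn M (\<lambda>x. f x + g x))\<^sup>2 \<le> (sqn M f + sqn M g)\<^sup>2" .
qed simp

lemma sqn_cmult: "sqn M (\<lambda>x. c * f x) = cmod c * sqn M f"
  by (simp add: sqn_def norm_mult power_mult_distrib real_sqrt_mult)

lemma sqn_cong_AE:
  assumes "f \<in> borel_measurable M" "g \<in> borel_measurable M" "AE x in M. f x = g x"
  shows "sqn M f = sqn M g"
proof -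
  have "(LINT x|M. (cmod (f x))\<^sup>2) = (LINT x|M. (cmod (g x))\<^sup>2)"
    by (rule integral_cong_AE) (use assms in \<open>auto elim: eventually_mono\<close>)
  then show ?thesis by (simp add: sqn_def)
qed

lemma sqn_mono:
  assumes "sq_int M g" "f \<in> borel_measurable M" "AE x in M. cmod (f x) \<le> C * cmod (g x)" "0 \<le> C"
  shows "sqn M f \<le> C * sqn M g"
proof (rule power2_le_imp_le)
  have "(sqn M f)\<^sup>2 \<le> (LINT x|M. C\<^sup>2 * (cmod (g x))\<^sup>2)"
    unfolding sqn_power2
  proof (rule integral_mono_AE)
    show "integrable M (\<lambda>x. (cmod (f x))\<^sup>2)"
      using sq_int_bound[OF assms(1,2,3)] by (simp add: sq_int_def)
    show "integrable M (\<lambda>x. C\<^sup>2 * (cmod (g x))\<^sup>2)" using assms(1) by (simp add: sq_int_def)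
    show "AE x in M. (cmod (f x))\<^sup>2 \<le> C\<^sup>2 * (cmod (g x))\<^sup>2"
      using assms(3) by eventually_elim (metis norm_ge_zero power_mono power_mult_distrib)
  qed
  then show "(sqn M f)\<^sup>2 \<le> (C * sqn M g)\<^sup>2" by (simp add: sqn_power2 power_mult_distrib)
qed (use assms in simp)

lemma (in finite_measure) sq_int_bounded:
  assumes "f \<in> borel_measurable M" "AE x in M. cmod (f x) \<le> B"
  shows "sq_int M f"
  by (rule sq_int_bound[of M "\<lambda>_. 1" _ B])
     (use assms in \<open>auto simp: sq_int_def\<close>)

lemma (in finite_measure) sq_int_integrable:
  assumes "sq_int M f" shows "integrable M f"
  using integrable_sq_mult[OF assms sq_int_bounded[of "\<lambda>_. 1" 1]] by simp

lemma (in finite_measure) integral_cmod_le_sqn: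
  assumes "sq_int M f" shows "(LINT x|M. cmod (f x)) \<le> sqrt (measure M (space M)) * sqn M f"
  using cauchy_schwarz_sq[OF assms sq_int_bounded[of "\<lambda>_. 1" 1]]
  by (simp add: sqn_def mult.commute)

lemma (in finite_measure) sqn_le_bound:
  assumes "f \<in> borel_measurable M" "AE x in M. cmod (f x) \<le> B" "0 \<le> B"
  shows "sqn M f \<le> B * sqrt (measure M (space M))"
proof -
  have "sqn M f \<le> B * sqn M (\<lambda>_. 1)"
    by (rule sqn_mono) (use assms in \<open>auto simp: sq_int_def\<close>)
  then show ?thesis by (simp add: sqn_def)
qed

lemma sqn_eq_0_AE:
  assumes "sq_int M f" "sqn M f = 0" shows "AE x in M. f x = 0"
proof -
  have "(LINT x|M. (cmod (f x))\<^sup>2) = 0" using assms(2) by (simp add: sqn_def)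
  then show ?thesis
    using assms(1) by (subst (asm) integral_nonneg_eq_0_iff_AE) (auto simp: sq_int_def)
qed

text \<open>Telescoping through \<open>f * cnj (G n)\<close> and applying Cauchy-Schwarz to both
  pieces; the norm of \<open>G n\<close> is at most \<open>sqn M g\<close> plus an error tending to
  0. Symmetry relations pass from the core to the operator, and from sequences to their limits,
  through this.\<close>

lemma tendsto_inner_sq:
  assumes "\<And>n. sq_int M (F n)" "\<And>n. sq_int M (G n)" "sq_int M f" "sq_int M g"
    and F: "(\<lambda>n. sqn M (\<lambda>x. F n x - f x)) \<longlonglongrightarrow> 0"
    and G: "(\<lambda>n. sqn M (\<lambda>x. G n x - g x)) \<longlonglongrightarrow> 0"
  shows "(\<lambda>n. LINT x|M. F n x * cnj (G n x)) \<longlonglongrightarrow> (LINT x|M. f x * cnj (g x))"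
proof -
  let ?a = "\<lambda>n. sqn M (\<lambda>x. F n x - f x)" and ?b = "\<lambda>n. sqn M (\<lambda>x. G n x - g x)"
  have bnd: "norm ((LINT x|M. F n x * cnj (G n x)) - (LINT x|M. f x * cnj (g x)))
      \<le> ?a n * (sqn M g + ?b n) + sqn M f * ?b n" for n
  proof -
    have s: "sq_int M (\<lambda>x. F n x - f x)" "sq_int M (\<lambda>x. G n x - g x)"
      using sq_int_diff[OF assms(1,3)] sq_int_diff[OF assms(2,4)] by blast+
    have s': "sq_int M (\<lambda>x. cnj (G n x))" "sq_int M (\<lambda>x. cnj (G n x - g x))" "sq_int M (\<lambda>x. cnj (g x))"
      using sq_int_cnj[OF assms(2)] sq_int_cnj[OF s(2)] sq_int_cnj[OF assms(4)] by blast+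
    have cn: "sqn M (\<lambda>x. cnj (h x)) = sqn M h" for h by (simp add: sqn_def)
    have "(LINT x|M. F n x * cnj (G n x)) - (LINT x|M. f x * cnj (g x))
        = (LINT x|M. (F n x - f x) * cnj (G n x)) + (LINT x|M. f x * cnj (G n x - g x))"
      using integrable_sq_mult[OF s(1) s'(1)] integrable_sq_mult[OF assms(3) s'(2)]
        integrable_sq_mult[OF assms(1) s'(1), of n] integrable_sq_mult[OF assms(3) s'(3)]
      by (subst Bochner_Integration.integral_add[symmetric], simp, simp, 
          subst Bochner_Integration.integral_diff[symmetric], simp, simp) (simp add: algebra_simps)
    also have "norm \<dots> \<le> ?a n * sqn M (G n) + sqn M f * ?b n"
      using cauchy_schwarz_mult[OF s(1) s'(1)] cauchy_schwarz_mult[OF assms(3) s'(2)]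
      unfolding cn by (intro order.trans[OF norm_triangle_ineq] add_mono)
    also have "sqn M (G n) \<le> sqn M g + ?b n"
      using sqn_add[OF assms(4) s(2)] by simp
    finally show ?thesis by (simp add: mult_left_mono)
  qed
  have "(\<lambda>n. ?a n * (sqn M g + ?b n) + sqn M f * ?b n) \<longlonglongrightarrow> 0"
    using tendsto_add[OF tendsto_mult[OF F tendsto_add[OF tendsto_const[of "sqn M g"] G]] tendsto_mult[OF tendsto_const[of "sqn M f"] G]]
    by simp
  with always_eventually[OF allI[OF bnd]]
  have "(\<lambda>n. (LINT x|M. F n x * cnj (G n x)) - (LINT x|M. f x * cnj (g x))) \<longlonglongrightarrow> 0"
    by (rule Lim_null_comparison)
  then show ?thesis by (simp add: LIM_zero_iff)
qed

subsection \<open>Compact intervals and absolute continuity\<close>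

text \<open>Restricting the measure, instead of inserting indicators, lets the general
  square-integrability lemmas apply verbatim on every subinterval; \<open>L2\<close> itself is the
  case \<open>lb (-pi) pi\<close>.\<close>

abbreviation lb :: "real \<Rightarrow> real \<Rightarrow> real measure" where
  "lb a b \<equiv> restrict_space lborel {a..b}"

lemma finite_measure_lb: "finite_measure (lb a b)"
  by (rule finite_measureI) (simp add: emeasure_restrict_space space_restrict_space emeasure_lborel_Icc_eq)

lemma measure_lb_space: "a \<le> b \<Longrightarrow> measure (lb a b) (space (lb a b)) = b - a"
  by (simp add: measure_def emeasure_restrict_space space_restrict_space)

lemma measure_lb: "a \<le> b \<Longrightarrow> measure (lb a b) {a..b} = b - a"
  by (simp add: measure_def emeasure_restrict_space)

lemma AE_lb_iff: "(AE x in lb a b. P x) \<longleftrightarrow> (AE x in lborel. x \<in> {a..b} \<longrightarrow> P x)"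
  by (rule AE_restrict_space_iff) simp

lemma integrable_lb_iff:
  fixes f :: "real \<Rightarrow> 'b::{banach, second_countable_topology}"
  shows "integrable (lb a b) f \<longleftrightarrow> set_integrable lborel {a..b} f"
  by (simp add: integrable_restrict_space set_integrable_def)

lemma integral_lb_eq:
  fixes f :: "real \<Rightarrow> 'b::{banach, second_countable_topology}"
  shows "(LINT x|lb a b. f x) = (LINT x:{a..b}|lborel. f x)"
  by (simp add: integral_restrict_space set_lebesgue_integral_def)

lemma measurable_lb_iff:
  fixes f :: "real \<Rightarrow> complex"
  shows "f \<in> borel_measurable (lb a b) \<longleftrightarrow> set_borel_measurable lborel {a..b} f"
  by (simp add: borel_measurable_restrict_space_iff set_borel_measurable_def)

lemma L2_iff_sq_int: "L2 f \<longleftrightarrow> sq_int (lb (-pi) pi) f"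
  by (simp add: L2_def sq_int_def measurable_lb_iff integrable_lb_iff)

lemma L2_norm_eq_sqn: "L2_norm f = sqn (lb (-pi) pi) f"
  by (simp add: L2_norm_def sqn_def integral_lb_eq)

lemma L2_inner_eq: "L2_inner f g = (LINT x|lb (-pi) pi. f x * cnj (g x))"
  by (simp add: L2_inner_def integral_lb_eq)

lemma has_integral_lb:
  fixes f :: "real \<Rightarrow> 'b::euclidean_space"
  assumes "integrable (lb a b) f"
  shows "(f has_integral (LINT x|lb a b. f x)) {a..b}"
  using assms set_borel_integral_eq_integral[of "{a..b}" f]
  by (simp add: integrable_lb_iff integral_lb_eq has_integral_iff)

lemma integral_lb:
  fixes f :: "real \<Rightarrow> 'b::euclidean_space"
  assumes "integrable (lb a b) f"
  shows "integral {a..b} f = (LINT x|lb a b. f x)"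
  using has_integral_lb[OF assms] by (rule integral_unique)

lemma restrict_lb: "a \<le> c \<Longrightarrow> d \<le> b \<Longrightarrow> restrict_space (lb a b) {c..d} = lb c d"
  by (simp add: restrict_restrict_space Int_absorb1)

lemma measurable_lb_mono:
  assumes "f \<in> borel_measurable (lb a b)" "a \<le> c" "d \<le> b"
  shows "f \<in> borel_measurable (lb c d)"
  using measurable_restrict_space1[OF assms(1), of "{c..d}"] unfolding restrict_lb[OF assms(2,3)] .

lemma integrable_lb_mono:
  fixes f :: "real \<Rightarrow> 'b::{banach, second_countable_topology}"
  assumes "integrable (lb a b) f" "a \<le> c" "d \<le> b"
  shows "integrable (lb c d) f"
  unfolding integrable_lb_iff
  by (rule set_integrable_subset[OF assms(1)[unfolded integrable_lb_iff]]) (use assms in auto)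

lemma integral_lb_mono:
  fixes f :: "real \<Rightarrow> real"
  assumes "integrable (lb a b) f" "a \<le> c" "d \<le> b" "\<And>x. 0 \<le> f x"
  shows "(LINT x|lb c d. f x) \<le> (LINT x|lb a b. f x)"
proof -
  have "(LINT x|lb c d. f x) \<le> (LINT x:{a..b}|lborel. f x)"
    unfolding integral_lb_eq set_lebesgue_integral_def
    by (rule integral_mono)
       (use integrable_lb_mono[OF assms(1-3)] assms in
         \<open>auto simp: integrable_lb_iff set_integrable_def indicator_def\<close>)
  then show ?thesis by (simp add: integral_lb_eq)
qed

lemma sq_int_lb_mono:
  assumes "sq_int (lb a b) f" "a \<le> c" "d \<le> b"
  shows "sq_int (lb c d) f"
  using assms(1) measurable_lb_mono[OF _ assms(2,3), of f]
    integrable_lb_mono[OF _ assms(2,3), of "\<lambda>x. (cmod (f x))\<^sup>2"]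
  unfolding sq_int_def by blast

lemma sqn_lb_mono: "sq_int (lb a b) f \<Longrightarrow> a \<le> c \<Longrightarrow> d \<le> b \<Longrightarrow> sqn (lb c d) f \<le> sqn (lb a b) f"
  unfolding sqn_def real_sqrt_le_iff by (rule integral_lb_mono) (auto simp: sq_int_def)

lemma sq_int_lb_integrable: "sq_int (lb a b) f \<Longrightarrow> integrable (lb a b) f"
  by (rule finite_measure.sq_int_integrable[OF finite_measure_lb])

lemma sq_int_integrable_on:
  assumes "sq_int (lb a b) f" "a \<le> c" "d \<le> b"
  shows "f integrable_on {c..d}"
  using has_integral_lb[OF sq_int_lb_integrable[OF sq_int_lb_mono[OF assms]]]
  by (rule has_integral_integrable)

lemma integral_cmod_lb_le:
  assumes "sq_int (lb a b) f" "a \<le> b"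
  shows "(LINT x|lb a b. cmod (f x)) \<le> sqrt (b - a) * sqn (lb a b) f"
  using finite_measure.integral_cmod_le_sqn[OF finite_measure_lb assms(1)] assms(2)
  by (simp add: measure_lb)

lemma norm_integral_sq_le:
  assumes "sq_int (lb a b) f" "a \<le> c" "c \<le> d" "d \<le> b"
  shows "cmod (integral {c..d} f) \<le> sqrt (d - c) * sqn (lb a b) f"
proof -
  note s = sq_int_lb_mono[OF assms(1,2,4)]
  have "cmod (integral {c..d} f) \<le> (LINT x|lb c d. cmod (f x))"
    unfolding integral_lb[OF sq_int_lb_integrable[OF s]] by (rule integral_norm_bound)
  also have "\<dots> \<le> sqrt (d - c) * sqn (lb c d) f"
    by (rule integral_cmod_lb_le[OF s assms(3)])
  also have "\<dots> \<le> sqrt (d - c) * sqn (lb a b) f"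
    using sqn_lb_mono[OF assms(1,2,4)] assms(3) by (intro mult_left_mono) auto
  finally show ?thesis .
qed

lemma sq_int_continuous: "continuous_on {a..b} f \<Longrightarrow> sq_int (lb a b) f"
proof -
  assume c: "continuous_on {a..b} f"
  have "compact (f ` {a..b})" by (intro compact_continuous_image c) auto
  then obtain B where "\<And>x. x \<in> {a..b} \<Longrightarrow> cmod (f x) \<le> B"
    by (meson bounded_iff compact_imp_bounded imageI)
  moreover have "f \<in> borel_measurable (lb a b)"
    using borel_measurable_continuous_on_restrict[OF c] by (simp add: measurable_def space_restrict_space sets_restrict_space)
  ultimately show ?thesis
    by (intro finite_measure.sq_int_bounded[OF finite_measure_lb, of _ _ _ B]) (auto simp: AE_lb_iff)
qed

text \<open>The graph conditions are almost-everywhere statements in \<open>lborel\<close>, while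
  gauge integration works with negligible sets; the two notions meet in the completion.\<close>

lemma AE_lborel_iff_negligible: "(AE x in lborel. P x) \<longleftrightarrow> negligible {x::real. \<not> P x}"
proof
  assume "AE x in lborel. P x"
  then obtain N where "{x. \<not> P x} \<subseteq> N" "N \<in> null_sets lborel"
    by (auto simp: eventually_ae_filter)
  then show "negligible {x. \<not> P x}"
    using negligible_iff_null_sets negligible_subset null_sets_completionI by blast
next
  assume "negligible {x. \<not> P x}"
  then have "AE x in lebesgue. P x"
    by (intro AE_I'[of "{x. \<not> P x}"]) (auto simp: negligible_iff_null_sets)
  then show "AE x in lborel. P x" by (simp add: AE_completion_iff)
qed

section \<open>Indefinite integrals and the fundamental theorem of calculus for absolutely
  continuous functions\<close>

lemma integral_lb_sub:
  fixes g :: "real \<Rightarrow> 'b::{banach, second_countable_topology}"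
  assumes "integrable (lb A B) g" "A \<le> a" "b \<le> B"
  shows "(LINT x|lb a b. g x) = (LINT x|lb A B. indicator {a<..<b} x *\<^sub>R g x)"
proof -
  have "(LINT x|lb a b. g x) = (LINT x|lborel. indicator {a..b} x *\<^sub>R g x)"
    by (simp add: integral_restrict_space)
  also have "\<dots> = (LINT x|lborel. indicator {A..B} x *\<^sub>R (indicator {a<..<b} x *\<^sub>R g x))"
  proof (rule integral_cong_AE)
    show "(\<lambda>x. indicator {a..b} x *\<^sub>R g x) \<in> borel_measurable lborel"
      using integrable_lb_mono[OF assms] by (simp add: integrable_restrict_space)
    have gm: "(\<lambda>x. indicator {A..B} x *\<^sub>R g x) \<in> borel_measurable lborel"
      using assms(1) by (simp add: integrable_restrict_space)
    have "indicator {a<..<b} \<in> borel_measurable lborel" by simp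
    from borel_measurable_scaleR[OF this gm]
    show "(\<lambda>x. indicator {A..B} x *\<^sub>R (indicator {a<..<b} x *\<^sub>R g x)) \<in> borel_measurable lborel"
      by (simp only: scaleR_left_commute)
    show "AE x in lborel. indicator {a..b} x *\<^sub>R g x = indicator {A..B} x *\<^sub>R (indicator {a<..<b} x *\<^sub>R g x)"
      using AE_lborel_singleton[of a] AE_lborel_singleton[of b]
      by eventually_elim (use assms in \<open>auto simp: indicator_def\<close>)
  qed
  finally show ?thesis by (simp add: integral_restrict_space)
qed

text \<open>Cauchy-Schwarz against the indicator of the union of the intervals bounds the sum of
  increments by the square root of the total length times the norm of \<open>q\<close>. Square
  integrability thus yields the explicit modulus \<open>(e / s)^2\<close>. The union is taken over
  open intervals, since only these are assumed disjoint; the endpoints are null sets.\<close>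

lemma abs_cont_indefinite_integral:
  assumes q: "sq_int (lb A B) q"
    and F: "\<And>x y. A \<le> x \<Longrightarrow> x \<le> y \<Longrightarrow> y \<le> B \<Longrightarrow> F y - F x = integral {x..y} q"
  shows "abs_cont_on {A..B} F"
  unfolding abs_cont_on_def
proof (intro allI impI)
  fix e :: real assume e: "0 < e"
  let ?M = "lb A B"
  \<comment> \<open>The \<open>+ 1\<close> keeps the divisor positive even for \<open>q = 0\<close>
    and makes the final inequality strict.\<close>
  define s where "s = sqn ?M q + 1"
  have s: "s > 0" using sqn_nonneg[of ?M q] by (simp add: s_def del: sqn_nonneg)
  have key: "\<forall>(n::nat) (a::nat \<Rightarrow> real) b. (\<forall>k<n. a k \<le> b k \<and> {a k..b k} \<subseteq> {A..B}) \<and>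
           disjoint_family_on (\<lambda>k. {a k<..<b k}) {..<n} \<and> (\<Sum>k<n. b k - a k) < (e / s)\<^sup>2 \<longrightarrow>
           (\<Sum>k<n. cmod (F (b k) - F (a k))) < e"
  proof (intro allI impI)
    fix n :: nat and a b :: "nat \<Rightarrow> real"
    assume H: "(\<forall>k<n. a k \<le> b k \<and> {a k..b k} \<subseteq> {A..B}) \<and>
           disjoint_family_on (\<lambda>k. {a k<..<b k}) {..<n} \<and> (\<Sum>k<n. b k - a k) < (e / s)\<^sup>2"
    then have ab: "a k \<le> b k" "A \<le> a k" "b k \<le> B" if "k < n" for k using that by fastforce+
    define E where "E = (\<Union>k<n. {a k<..<b k})"
    have Es: "E \<in> sets lborel" by (auto simp: E_def)
    have qi: "integrable ?M (\<lambda>x. cmod (q x))"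
      using sq_int_lb_integrable[OF q] by simp
    have le: "cmod (F (b k) - F (a k)) \<le> (LINT x|?M. indicator {a k<..<b k} x *\<^sub>R cmod (q x))" if "k < n" for k
    proof -
      note k = ab[OF that]
      have "F (b k) - F (a k) = (LINT x|lb (a k) (b k). q x)"
        using F[OF k(2,1,3)] integral_lb[OF sq_int_lb_integrable[OF sq_int_lb_mono[OF q k(2,3)]]] by simp
      also have "cmod \<dots> \<le> (LINT x|lb (a k) (b k). cmod (q x))" by (rule integral_norm_bound)
      finally show ?thesis using integral_lb_sub[OF qi k(2,3)] by simp
    qed
    have ind: "(\<Sum>k<n. indicator {a k<..<b k} x) = (indicator E x :: real)" for x
      unfolding E_def using H by (intro indicator_UN_disjoint[symmetric]) auto
    have int: "integrable ?M (\<lambda>x. indicator {a k<..<b k} x *\<^sub>R cmod (q x))" if "k < n" for k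
    proof (rule integrable_mult_indicator[OF _ qi])
      have "{a k<..<b k} \<subseteq> {A..B}" using ab[OF that] by auto
      then show "{a k<..<b k} \<in> sets ?M" by (subst sets_restrict_space_iff) auto
    qed
    have "(\<Sum>k<n. cmod (F (b k) - F (a k))) \<le> (\<Sum>k<n. LINT x|?M. indicator {a k<..<b k} x *\<^sub>R cmod (q x))"
      using le by (intro sum_mono) auto
    also have "\<dots> = (LINT x|?M. (\<Sum>k<n. indicator {a k<..<b k} x *\<^sub>R cmod (q x)))"
      using int by (intro Bochner_Integration.integral_sum[symmetric]) auto
    also have "\<dots> = (LINT x|?M. cmod (indicator E x) * cmod (q x))"
      by (intro Bochner_Integration.integral_cong refl)
         (simp add: ind flip: sum_distrib_right, simp add: indicator_def)
    also have "\<dots> \<le> sqn ?M (indicator E) * sqn ?M q"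
    proof (rule cauchy_schwarz_sq[OF _ q])
      have "indicator E \<in> borel_measurable ?M"
        by (rule measurable_restrict_space1, rule borel_measurable_indicator, rule Es)
      then show "sq_int ?M (indicator E)"
        by (rule finite_measure.sq_int_bounded[OF finite_measure_lb, of _ _ _ 1]) (simp add: indicator_def)
    qed
    finally have 1: "(\<Sum>k<n. cmod (F (b k) - F (a k))) \<le> sqn ?M (indicator E) * sqn ?M q" .
    have 2: "sqn ?M (indicator E) \<le> e / s"
    proof -
      have sub: "E \<subseteq> {A..B}" unfolding E_def using ab by fastforce
      have "(LINT x|?M. (cmod (indicator E x))\<^sup>2) = (LINT x|?M. indicator E x)"
        by (intro Bochner_Integration.integral_cong) (auto simp: indicator_def)
      also have "\<dots> = measure lborel E"
        using Es sub by (simp add: measure_restrict_space space_restrict_space Int_absorb2 Int_absorb1)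
      also have "\<dots> = (\<Sum>k<n. measure lborel {a k<..<b k})"
        unfolding E_def
      proof (rule measure_finite_Union)
        show "disjoint_family_on (\<lambda>k. {a k<..<b k}) {..<n}" using H by blast
        show "emeasure lborel {a k<..<b k} \<noteq> \<infinity>" if "k \<in> {..<n}" for k
          using emeasure_lborel_Ioo[OF ab(1)] that by simp
      qed auto
      also have "\<dots> = (\<Sum>k<n. b k - a k)" using ab by (intro sum.cong) auto
      finally have "(LINT x|?M. (cmod (indicator E x))\<^sup>2) \<le> (e / s)\<^sup>2" using H by linarith
      then show ?thesis unfolding sqn_def using e s by (intro real_le_lsqrt) auto
    qed
    have "e * sqn ?M q < e * s" using e by (simp add: s_def)
    then have 3: "e / s * sqn ?M q < e" using s by (simp add: divide_simps)
    show "(\<Sum>k<n. cmod (F (b k) - F (a k))) < e"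
      using 1 mult_right_mono[OF 2 sqn_nonneg[of ?M q]] 3 by linarith
  qed
  have d0: "0 < (e / s)\<^sup>2" using e s by simp
  show "\<exists>d>0. \<forall>(n::nat) (a::nat \<Rightarrow> real) b. (\<forall>k<n. a k \<le> b k \<and> {a k..b k} \<subseteq> {A..B}) \<and>
           disjoint_family_on (\<lambda>k. {a k<..<b k}) {..<n} \<and> (\<Sum>k<n. b k - a k) < d \<longrightarrow>
           (\<Sum>k<n. cmod (F (b k) - F (a k))) < e"
    by (rule exI, rule conjI, rule d0, rule key)
qed

text \<open>\<open>integrable_ccontinuous_explicit\<close> yields convergence of averages over
  \<open>{x..x + h}\<close> only, that is, right derivatives. Applied also to \<open>g (- x)\<close>
  it covers increments to the left, so the exceptional set consists of \<open>N1\<close>, the mirror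
  image of \<open>N2\<close> and the two endpoints.\<close>

lemma AE_indefinite_integral_deriv:
  fixes f :: "real \<Rightarrow> complex"
  assumes f: "f integrable_on {a..b}"
  shows "AE x in lborel. x \<in> {a..b} \<longrightarrow> ((\<lambda>x. integral {a..x} f) has_vector_derivative f x) (at x)"
proof -
  \<comment> \<open>Extension by zero makes the function integrable on every interval, as the
    averaging theorem demands.\<close>
  define g where "g = (\<lambda>x. if x \<in> {a..b} then f x else 0)"
  have gU: "g integrable_on UNIV"
    unfolding g_def using f integrable_restrict_UNIV by blast
  have g: "g integrable_on cbox c d" for c d
    by (rule integrable_on_subcbox[OF gU]) simp
  have g': "(\<lambda>x. g (- x)) integrable_on cbox c d" for c d
    using g[of "-d" "-c"] Henstock_Kurzweil_Integration.integrable_reflect_real[where f=g and a="-d" and b="-c"] by simp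
  obtain N1 where N1: "negligible N1"
    "\<And>x e. x \<notin> N1 \<Longrightarrow> 0 < e \<Longrightarrow> \<exists>d>0. \<forall>h. 0 < h \<and> h < d \<longrightarrow>
       cmod (integral (cbox x (x + h *\<^sub>R One)) g /\<^sub>R h ^ DIM(real) - g x) < e"
    by (rule integrable_ccontinuous_explicit[OF g]) (rule that, assumption+)
  obtain N2 where N2: "negligible N2"
    "\<And>x e. x \<notin> N2 \<Longrightarrow> 0 < e \<Longrightarrow> \<exists>d>0. \<forall>h. 0 < h \<and> h < d \<longrightarrow>
       cmod (integral (cbox x (x + h *\<^sub>R One)) (\<lambda>x. g (- x)) /\<^sub>R h ^ DIM(real) - g (- x)) < e"
    by (rule integrable_ccontinuous_explicit[OF g']) (rule that, assumption+)
  have der: "((\<lambda>x. integral {a..x} f) has_vector_derivative f x) (at x)"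
    if x: "a < x" "x < b" and xN: "x \<notin> N1" "- x \<notin> N2" for x
    unfolding has_vector_derivative_def has_derivative_at_alt
  proof (intro conjI allI impI)
    show "bounded_linear (\<lambda>h. h *\<^sub>R f x)" by (rule bounded_linear_scaleR_left)
    fix e :: real assume e: "0 < e"
    obtain d1 where d1: "d1 > 0" "\<And>h. 0 < h \<Longrightarrow> h < d1 \<Longrightarrow> cmod (integral {x..x + h} g /\<^sub>R h - g x) < e"
      using N1(2)[OF xN(1) e] by (auto simp: cbox_interval)
    obtain d2 where d2: "d2 > 0" "\<And>h. 0 < h \<Longrightarrow> h < d2 \<Longrightarrow> cmod (integral {-x..-x + h} (\<lambda>x. g (-x)) /\<^sub>R h - g x) < e"
      using N2(2)[OF xN(2) e] by (auto simp: cbox_interval)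
    have gx: "g x = f x" using x by (simp add: g_def)
    have gi: "integral {c..d} g = integral {c..d} f" if "a \<le> c" "d \<le> b" for c d
      using that by (intro integral_cong) (auto simp: g_def)
    have sc: "cmod (u - h *\<^sub>R v) \<le> e * h" if "cmod (u /\<^sub>R h - v) < e" "h > 0" for u v :: complex and h
    proof -
      have "u - h *\<^sub>R v = h *\<^sub>R (u /\<^sub>R h - v)" using that(2) by (simp add: scaleR_diff_right)
      then have "cmod (u - h *\<^sub>R v) = h * cmod (u /\<^sub>R h - v)" using that(2) by simp
      then show ?thesis using that by (simp add: mult.commute mult_right_mono)
    qed
    let ?d = "min (min d1 d2) (min (x - a) (b - x))"
    show "\<exists>d>0. \<forall>y. norm (y - x) < d \<longrightarrow>
        cmod (integral {a..y} f - integral {a..x} f - (y - x) *\<^sub>R f x) \<le> e * norm (y - x)"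
    proof (intro exI[of _ ?d] conjI allI impI)
      show "0 < ?d" using d1(1) d2(1) x by simp
      fix y assume y: "norm (y - x) < ?d"
      consider "y = x" | "x < y" | "y < x" by linarith
      then show "cmod (integral {a..y} f - integral {a..x} f - (y - x) *\<^sub>R f x) \<le> e * norm (y - x)"
      proof cases
        case 2
        have "integral {a..x} f + integral {x..y} f = integral {a..y} f"
          by (rule Henstock_Kurzweil_Integration.integral_combine) (use f x y 2 in \<open>auto intro: integrable_subinterval_real\<close>)
        then have "integral {a..y} f - integral {a..x} f = integral {x..x + (y - x)} g"
          using gi[of x y] x y 2 by (simp add: algebra_simps)
        then show ?thesis using sc[OF d1(2)[of "y - x"]] 2 y gx by simp
      next
        case 3
        have "integral {a..y} f + integral {y..x} f = integral {a..x} f"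
          by (rule Henstock_Kurzweil_Integration.integral_combine) (use f x y 3 in \<open>auto intro: integrable_subinterval_real\<close>)
        moreover have "integral {-x..-x + (x - y)} (\<lambda>x. g (-x)) = integral {y..x} g"
          using Henstock_Kurzweil_Integration.integral_reflect_real[where f=g and a=y and b=x] by simp
        ultimately have *: "integral {a..x} f - integral {a..y} f = integral {-x..-x + (x - y)} (\<lambda>x. g (-x))"
          using gi[of y x] x y 3 by (simp add: algebra_simps)
        have "cmod (integral {a..x} f - integral {a..y} f - (x - y) *\<^sub>R f x) \<le> e * (x - y)"
          unfolding * using sc[OF d2(2)[of "x - y"]] 3 y gx by simp
        moreover have "integral {a..y} f - integral {a..x} f - (y - x) *\<^sub>R f x
           = - (integral {a..x} f - integral {a..y} f - (x - y) *\<^sub>R f x)"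
          by (simp add: algebra_simps)
        ultimately show ?thesis using 3 by (simp only: norm_minus_cancel) simp
      qed simp
    qed
  qed
  have "negligible (uminus ` N2)"
    using N2(1) by (intro negligible_differentiable_image_negligible) (auto intro!: derivative_intros differentiable_on_minus)
  then have neg: "negligible (N1 \<union> uminus ` N2 \<union> {a, b})" using N1(1) by simp
  show ?thesis
    unfolding AE_lborel_iff_negligible
  proof (rule negligible_subset[OF neg], rule subsetI)
    fix x assume "x \<in> {x. \<not> (x \<in> {a..b} \<longrightarrow> ((\<lambda>x. integral {a..x} f) has_vector_derivative f x) (at x))}"
    then show "x \<in> N1 \<union> uminus ` N2 \<union> {a, b}"
      using der[of x] by (force simp: image_iff)
  qed
qed


text \<open>A direct gauge argument in which integrability of \<open>f\<close> is part of the
  conclusion. At tags outside the null set \<open>N\<close> the derivative gives the straddle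
  estimate with slack \<open>c\<close>. Tags inside \<open>N\<close> are confined by the gauge to an
  open set of measure below the \<open>d\<close> of absolute continuity, which bounds the increments
  belonging to them by \<open>e / 2\<close>.\<close>

lemma abs_cont_has_integral:
  fixes F f :: "real \<Rightarrow> complex"
  assumes ab: "a \<le> b" and ac: "abs_cont_on {a..b} F"
    and der: "AE x in lborel. x \<in> {a..b} \<longrightarrow> (F has_vector_derivative f x) (at x)"
  shows "(f has_integral F b - F a) {a..b}"
proof -
  define N where "N = {x. \<not> (x \<in> {a..b} \<longrightarrow> (F has_vector_derivative f x) (at x))}"
  have negN: "negligible N" using der by (simp add: N_def AE_lborel_iff_negligible)
  \<comment> \<open>Killing the values on \<open>N\<close> removes the corresponding terms from the
    Riemann sum, so that only the increments of \<open>F\<close> are left there.\<close>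
  define f0 where "f0 = (\<lambda>x. if x \<in> N then 0 else f x)"
  have "(f0 has_integral F b - F a) (cbox a b)"
    unfolding has_integral
  proof (intro allI impI)
    fix e :: real assume e: "0 < e"
    have "e / 2 > 0" using e by simp
    from ac[unfolded abs_cont_on_def, rule_format, OF this]
    obtain d where d: "d > 0" and acd': "\<forall>(n::nat) (u::nat \<Rightarrow> real) v.
        (\<forall>k<n. u k \<le> v k \<and> {u k..v k} \<subseteq> {a..b}) \<and>
        disjoint_family_on (\<lambda>k. {u k<..<v k}) {..<n} \<and>
        (\<Sum>k<n. v k - u k) < d \<longrightarrow> (\<Sum>k<n. cmod (F (v k) - F (u k))) < e / 2"
      by (elim exE conjE) (rule that)
    note acd = acd'[rule_format, OF conjI[OF _ conjI]]
    have "N \<in> sets lebesgue" using negN by (simp add: negligible_imp_sets)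
    then obtain U where U: "open U" "N \<subseteq> U" "emeasure lebesgue (U - N) < ennreal d"
      using sets_lebesgue_outer_open[OF _ d] by metis
    have "emeasure lebesgue U = emeasure lebesgue (U - N)"
      using negN U(1) by (subst emeasure_Diff_null_set) (auto simp: negligible_iff_null_sets)
    then have Ud: "emeasure lborel U < ennreal d"
      using U(1,3) by (simp add: emeasure_completion)
    \<comment> \<open>The slacks add up to \<open>c * (b - a)\<close>, which is at most
      \<open>e / 4\<close>; the \<open>+ 1\<close> covers \<open>a = b\<close>.\<close>
    define c where "c = e / (4 * (b - a + 1))"
    have c: "c > 0" using e ab by (simp add: c_def)
    have "\<exists>r>0. (x \<in> N \<longrightarrow> ball x r \<subseteq> U) \<and>
        (x \<in> {a..b} - N \<longrightarrow> (\<forall>y. \<bar>y - x\<bar> < r \<longrightarrow> cmod (F y - F x - (y - x) *\<^sub>R f x) \<le> c * \<bar>y - x\<bar>))" for x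
    proof (cases "x \<in> N")
      case True
      then show ?thesis using U open_contains_ball by (metis DiffD2 subsetD)
    next
      case False
      then show ?thesis
      proof (cases "x \<in> {a..b}")
        case True
        then have "(F has_vector_derivative f x) (at x)" using False by (simp add: N_def)
        then show ?thesis
          unfolding has_vector_derivative_def has_derivative_at_alt using c False by auto
      qed (use False zero_less_one in blast)
    qed
    then obtain r where r: "\<And>x. r x > 0" "\<And>x. x \<in> N \<Longrightarrow> ball x (r x) \<subseteq> U"
      "\<And>x y. x \<in> {a..b} - N \<Longrightarrow> \<bar>y - x\<bar> < r x \<Longrightarrow> cmod (F y - F x - (y - x) *\<^sub>R f x) \<le> c * \<bar>y - x\<bar>"
      by metis
    show "\<exists>\<gamma>. gauge \<gamma> \<and> (\<forall>D. D tagged_division_of (cbox a b) \<and> \<gamma> fine D \<longrightarrow>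
        cmod ((\<Sum>(x, K)\<in>D. measure lborel K *\<^sub>R f0 x) - (F b - F a)) < e)"
    proof (intro exI[of _ "\<lambda>x. ball x (r x)"] conjI allI impI)
      show "gauge (\<lambda>x. ball x (r x))" by (rule gauge_ball_dependent) (use r in auto)
      fix D assume "D tagged_division_of (cbox a b) \<and> (\<lambda>x. ball x (r x)) fine D"
      then have D: "D tagged_division_of {a..b}" and fine: "\<And>x K. (x, K) \<in> D \<Longrightarrow> K \<subseteq> ball x (r x)"
        by (auto simp: fine_def)
      have fin: "finite D" using D by blast
      have K: "\<exists>u v. K = {u..v} \<and> u \<le> x \<and> x \<le> v \<and> Inf K = u \<and> Sup K = v \<and> a \<le> u \<and> v \<le> b"
        if xK: "(x, K) \<in> D" for x K
      proof -
        obtain u v where uv: "K = {u..v}"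
          using tagged_division_ofD(4)[OF D xK] by (auto simp: cbox_interval)
        have "x \<in> K" "K \<subseteq> {a..b}" using tagged_division_ofD(2,3)[OF D xK] by auto
        with uv show ?thesis by auto
      qed
      define DN where "DN = {(x, K) \<in> D. x \<in> N}"
      have DN: "DN \<subseteq> D" "finite DN" using fin by (auto simp: DN_def intro: finite_subset)
      let ?g = "\<lambda>(x, K). F (Sup K) - F (Inf K)"
      have "(\<Sum>z\<in>DN. cmod (?g z)) < e / 2"
      proof -
        \<comment> \<open>\<open>abs_cont_on\<close> speaks of families indexed by an initial
          segment of the naturals, hence the enumeration of the tagged intervals in
          \<open>DN\<close>.\<close>
        obtain h where h: "bij_betw h {0..<card DN} DN"
          using ex_bij_betw_nat_finite[OF DN(2)] by auto
        let ?u = "\<lambda>k. Inf (snd (h k))" and ?v = "\<lambda>k. Sup (snd (h k))"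
        have hD: "h k \<in> DN" if "k < card DN" for k using h that by (auto simp: bij_betw_def)
        have hK: "snd (h k) = {?u k..?v k} \<and> ?u k \<le> ?v k \<and> a \<le> ?u k \<and> ?v k \<le> b" if "k < card DN" for k
          using K[of "fst (h k)" "snd (h k)"] hD[OF that] DN(1) by fastforce
        have disj: "disjoint_family_on (\<lambda>k. {?u k<..<?v k}) {..<card DN}"
          unfolding disjoint_family_on_def
        proof (intro ballI impI)
          fix i j assume ij: "i \<in> {..<card DN}" "j \<in> {..<card DN}" "i \<noteq> j"
          have ne: "h i \<noteq> h j"
            using h ij by (auto simp: bij_betw_def inj_on_def)
          have "(fst (h i), snd (h i)) \<in> D" "(fst (h j), snd (h j)) \<in> D"
            using hD ij DN(1) by auto
          then have "interior (snd (h i)) \<inter> interior (snd (h j)) = {}"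
            using tagged_division_ofD(5)[OF D] ne by (metis prod.collapse)
          then show "{?u i<..<?v i} \<inter> {?u j<..<?v j} = {}"
            using hK[of i] hK[of j] ij by (metis interior_atLeastAtMost_real lessThan_iff)
        qed
        have sub: "(\<Union>k<card DN. {?u k<..<?v k}) \<subseteq> U"
        proof (rule UN_least)
          fix k assume "k \<in> {..<card DN}"
          then have k: "k < card DN" by simp
          have 1: "fst (h k) \<in> N" "(fst (h k), snd (h k)) \<in> D" using hD[OF k] by (auto simp: DN_def)
          have "{?u k<..<?v k} \<subseteq> snd (h k)" using hK[OF k] by (metis greaterThanLessThan_subseteq_atLeastAtMost_iff order_refl)
          also have "\<dots> \<subseteq> U" using fine[OF 1(2)] r(2)[OF 1(1)] by blast
          finally show "{?u k<..<?v k} \<subseteq> U" .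
        qed
        have "ennreal (\<Sum>k<card DN. ?v k - ?u k) = (\<Sum>k<card DN. ennreal (?v k - ?u k))"
          using hK by (intro sum_ennreal[symmetric]) auto
        also have "\<dots> = (\<Sum>k<card DN. emeasure lborel {?u k<..<?v k})"
          using hK by (intro sum.cong) auto
        also have "\<dots> = emeasure lborel (\<Union>k<card DN. {?u k<..<?v k})"
          using disj by (intro sum_emeasure) auto
        also have "\<dots> \<le> emeasure lborel U" using U(1) sub by (intro emeasure_mono) auto
        finally have "ennreal (\<Sum>k<card DN. ?v k - ?u k) < ennreal d"
          using Ud by (rule le_less_trans)
        then have lt: "(\<Sum>k<card DN. ?v k - ?u k) < d"
          using ennreal_leI[of d "\<Sum>k<card DN. ?v k - ?u k"] by (meson leD leI)
        have hS: "?u k \<le> ?v k \<and> {?u k..?v k} \<subseteq> {a..b}" if "k < card DN" for k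
          unfolding atLeastatMost_subset_iff using hK[OF that] by blast
        have "(\<Sum>k<card DN. cmod (F (?v k) - F (?u k))) < e / 2"
          using hS disj lt by (intro acd) blast+
        also have "(\<Sum>k<card DN. cmod (F (?v k) - F (?u k))) = (\<Sum>k\<in>{0..<card DN}. cmod (?g (h k)))"
          by (simp add: case_prod_unfold lessThan_atLeast0)
        also have "\<dots> = (\<Sum>z\<in>DN. cmod (?g z))"
          by (rule sum.reindex_bij_betw[OF h])
        finally show ?thesis .
      qed
      moreover have "cmod (\<Sum>z\<in>D - DN. (case z of (x, K) \<Rightarrow> measure lborel K *\<^sub>R f0 x) - ?g z) \<le> e / 4"
      proof -
        have "cmod (\<Sum>z\<in>D - DN. (case z of (x, K) \<Rightarrow> measure lborel K *\<^sub>R f0 x) - ?g z)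
            \<le> (\<Sum>z\<in>D - DN. c * measure lborel (snd z))"
        proof (rule sum_norm_le)
          fix z assume z: "z \<in> D - DN"
          obtain x K where zx: "z = (x, K)" by (cases z)
          then have xK: "(x, K) \<in> D" "x \<notin> N" using z by (auto simp: DN_def)
          obtain u v where uv: "K = {u..v}" "u \<le> x" "x \<le> v" "Inf K = u" "Sup K = v" "a \<le> u" "v \<le> b"
            using K[OF xK(1)] by blast
          have x: "x \<in> {a..b} - N" using uv xK by auto
          have uvr: "\<bar>u - x\<bar> < r x" "\<bar>v - x\<bar> < r x"
          proof -
            have "u \<in> ball x (r x)" "v \<in> ball x (r x)" using subsetD[OF fine[OF xK(1)]] uv by (auto simp del: mem_ball)
            then show "\<bar>u - x\<bar> < r x" "\<bar>v - x\<bar> < r x"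
              by (simp_all add: dist_real_def abs_minus_commute)
          qed
          have "measure lborel K *\<^sub>R f0 x - (F v - F u)
              = (F u - F x - (u - x) *\<^sub>R f x) - (F v - F x - (v - x) *\<^sub>R f x)"
            using uv xK by (simp add: f0_def algebra_simps)
          also have "cmod \<dots> \<le> c * \<bar>u - x\<bar> + c * \<bar>v - x\<bar>"
            by (rule order.trans[OF norm_triangle_ineq4 add_mono[OF r(3)[OF x uvr(1)] r(3)[OF x uvr(2)]]])
          also have "\<dots> = c * measure lborel K" using uv by (simp add: algebra_simps)
          finally show "cmod ((case z of (x, K) \<Rightarrow> measure lborel K *\<^sub>R f0 x) - ?g z) \<le> c * measure lborel (snd z)"
            using uv by (simp add: zx)
        qed
        also have "\<dots> \<le> (\<Sum>z\<in>D. c * measure lborel (snd z))"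
          using c fin by (intro sum_mono2) auto
        also have "\<dots> = c * (\<Sum>(x, K)\<in>D. measure lborel K)"
          by (simp add: sum_distrib_left case_prod_unfold)
        also have "(\<Sum>(x, K)\<in>D. measure lborel K) = measure lborel (cbox a b)"
          using additive_content_tagged_division D by (metis box_real(2))
        also have "c * measure lborel (cbox a b) \<le> e / 4"
          using ab e by (simp add: c_def field_simps)
        finally show ?thesis .
      qed
      moreover have eq: "(\<Sum>(x, K)\<in>D. measure lborel K *\<^sub>R f0 x) - (F b - F a)
          = (\<Sum>z\<in>D - DN. (case z of (x, K) \<Rightarrow> measure lborel K *\<^sub>R f0 x) - ?g z) - (\<Sum>z\<in>DN. ?g z)"
      proof -
        have "(\<Sum>(x, K)\<in>D. measure lborel K *\<^sub>R f0 x) - (F b - F a)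
          = (\<Sum>z\<in>D. (case z of (x, K) \<Rightarrow> measure lborel K *\<^sub>R f0 x) - ?g z)"
          using additive_tagged_division_1[OF ab D, of F] by (simp add: sum_subtractf case_prod_unfold)
        also have "\<dots> = (\<Sum>z\<in>D - DN. (case z of (x, K) \<Rightarrow> measure lborel K *\<^sub>R f0 x) - ?g z)
            + (\<Sum>z\<in>DN. (case z of (x, K) \<Rightarrow> measure lborel K *\<^sub>R f0 x) - ?g z)"
          by (rule sum.subset_diff[OF DN(1) fin])
        also have "(\<Sum>z\<in>DN. (case z of (x, K) \<Rightarrow> measure lborel K *\<^sub>R f0 x) - ?g z) = (\<Sum>z\<in>DN. - ?g z)"
          by (intro sum.cong) (auto simp: DN_def f0_def)
        finally show ?thesis by (simp add: sum_negf)
      qed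
      moreover have "cmod (\<Sum>z\<in>DN. ?g z) \<le> (\<Sum>z\<in>DN. cmod (?g z))" by (rule norm_sum)
      ultimately show "cmod ((\<Sum>(x, K)\<in>D. measure lborel K *\<^sub>R f0 x) - (F b - F a)) < e"
        unfolding eq using norm_triangle_ineq4[of "\<Sum>z\<in>D - DN. (case z of (x, K) \<Rightarrow> measure lborel K *\<^sub>R f0 x) - ?g z" "\<Sum>z\<in>DN. ?g z"] e
        by linarith
    qed
  qed
  then have "(f has_integral F b - F a) (cbox a b)"
    by (rule has_integral_spike[OF negN, rotated]) (auto simp: f0_def)
  then show ?thesis by simp
qed

subsection \<open>The first-order equation on a half period\<close>

definition interval_family :: "real set \<Rightarrow> real \<Rightarrow> nat \<Rightarrow> (nat \<Rightarrow> real) \<Rightarrow> (nat \<Rightarrow> real) \<Rightarrow> bool" where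
  "interval_family S d n a b \<longleftrightarrow> (\<forall>k<n. a k \<le> b k \<and> {a k..b k} \<subseteq> S) \<and>
     disjoint_family_on (\<lambda>k. {a k<..<b k}) {..<n} \<and> (\<Sum>k<n. b k - a k) < d"

lemma interval_family_mono:
  "interval_family S d n a b \<Longrightarrow> S \<subseteq> T \<Longrightarrow> d \<le> d' \<Longrightarrow> interval_family T d' n a b"
  unfolding interval_family_def by (meson order_less_le_trans subset_trans)

lemma abs_cont_on_iff:
  "abs_cont_on S F \<longleftrightarrow> (\<forall>e>0. \<exists>d>0. \<forall>n a b. interval_family S d n a b \<longrightarrow> (\<Sum>k<n. cmod (F (b k) - F (a k))) < e)"
  unfolding abs_cont_on_def interval_family_def by (rule refl)

lemma abs_cont_on_subset:
  "abs_cont_on S F \<Longrightarrow> T \<subseteq> S \<Longrightarrow> abs_cont_on T F"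
  unfolding abs_cont_on_iff using interval_family_mono[OF _ _ order_refl] by meson

text \<open>Transfer principle behind products, conjugates and congruence: it suffices to dominate
  increments by those of absolutely continuous functions. Two dominating functions are provided
  because the increment of a product involves both factors.\<close>

lemma abs_cont_on_bound:
  assumes ac: "abs_cont_on S F" "abs_cont_on S G" and C: "0 < C"
    and le: "\<And>x y. x \<le> y \<Longrightarrow> {x..y} \<subseteq> S \<Longrightarrow> cmod (H y - H x) \<le> C * (cmod (F y - F x) + cmod (G y - G x))"
  shows "abs_cont_on S H"
  unfolding abs_cont_on_iff
proof (intro allI impI)
  fix e :: real assume e: "0 < e"
  then have e': "0 < e / (2 * C)" using C by simp
  obtain d1 where d1: "0 < d1" "\<And>n u v. interval_family S d1 n u v \<Longrightarrow> (\<Sum>k<n. cmod (F (v k) - F (u k))) < e / (2 * C)"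
    using ac(1) e' unfolding abs_cont_on_iff by blast
  obtain d2 where d2: "0 < d2" "\<And>n u v. interval_family S d2 n u v \<Longrightarrow> (\<Sum>k<n. cmod (G (v k) - G (u k))) < e / (2 * C)"
    using ac(2) e' unfolding abs_cont_on_iff by blast
  have "(\<Sum>k<n. cmod (H (b k) - H (a k))) < e" if H: "interval_family S (min d1 d2) n a b" for n a b
  proof -
    have 1: "(\<Sum>k<n. cmod (F (b k) - F (a k))) < e / (2 * C)"
      by (rule d1(2)[OF interval_family_mono[OF H]]) auto
    have 2: "(\<Sum>k<n. cmod (G (b k) - G (a k))) < e / (2 * C)"
      by (rule d2(2)[OF interval_family_mono[OF H]]) auto
    have "(\<Sum>k<n. cmod (H (b k) - H (a k))) \<le> (\<Sum>k<n. C * (cmod (F (b k) - F (a k)) + cmod (G (b k) - G (a k))))"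
      using H by (intro sum_mono le) (auto simp: interval_family_def)
    also have "\<dots> = C * ((\<Sum>k<n. cmod (F (b k) - F (a k))) + (\<Sum>k<n. cmod (G (b k) - G (a k))))"
      by (simp only: sum_distrib_left[symmetric] sum.distrib)
    also have "\<dots> < C * (e / (2 * C) + e / (2 * C))"
      using 1 2 C by (intro mult_strict_left_mono add_strict_mono) auto
    also have "\<dots> = e" using C by (simp add: field_simps)
    finally show ?thesis .
  qed
  moreover have "0 < min d1 d2" using d1(1) d2(1) by simp
  ultimately show "\<exists>d>0. \<forall>n a b. interval_family S d n a b \<longrightarrow> (\<Sum>k<n. cmod (H (b k) - H (a k))) < e"
    by blast
qed

lemma abs_cont_on_dist:
  assumes "abs_cont_on {a..b} F" "0 < e"
  obtains d where "0 < d" "\<And>x y. x \<in> {a..b} \<Longrightarrow> y \<in> {a..b} \<Longrightarrow> \<bar>y - x\<bar> < d \<Longrightarrow> cmod (F y - F x) < e"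
proof -
  obtain d where d: "0 < d" "\<And>n u v. interval_family {a..b} d n u v \<Longrightarrow> (\<Sum>k<n. cmod (F (v k) - F (u k))) < e"
    using assms unfolding abs_cont_on_iff by blast
  have 1: "cmod (F y - F x) < e" if "x \<in> {a..b}" "y \<in> {a..b}" "\<bar>y - x\<bar> < d" "x \<le> y" for x y
    using d(2)[of 1 "\<lambda>_. x" "\<lambda>_. y"] that by (simp add: interval_family_def disjoint_family_on_def)
  show thesis
  proof (rule that[OF d(1)])
    fix x y assume xy: "x \<in> {a..b}" "y \<in> {a..b}" "\<bar>y - x\<bar> < d"
    show "cmod (F y - F x) < e"
    proof (cases "x \<le> y")
      case False
      then show ?thesis using 1[OF xy(2,1)] xy(3) by (simp add: abs_minus_commute norm_minus_commute)
    qed (use 1[OF xy] in simp)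
  qed
qed

lemma abs_cont_on_continuous:
  assumes "abs_cont_on {a..b} F" shows "continuous_on {a..b} F"
  unfolding continuous_on_iff
proof (intro ballI allI impI)
  fix x e assume x: "x \<in> {a..b}" and e: "(0::real) < e"
  obtain d where d: "0 < d" "\<And>x y. x \<in> {a..b} \<Longrightarrow> y \<in> {a..b} \<Longrightarrow> \<bar>y - x\<bar> < d \<Longrightarrow> cmod (F y - F x) < e"
    using abs_cont_on_dist[OF assms e] by blast
  show "\<exists>d>0. \<forall>x'\<in>{a..b}. dist x' x < d \<longrightarrow> dist (F x') (F x) < e"
    using d x by (auto simp: dist_real_def dist_norm)
qed

lemma continuous_on_cbound:
  fixes F :: "real \<Rightarrow> complex"
  assumes "continuous_on {a..b} F"
  obtains M where "0 < M" "\<And>x. x \<in> {a..b} \<Longrightarrow> cmod (F x) \<le> M"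
proof -
  have "compact (F ` {a..b})" by (intro compact_continuous_image assms) auto
  then have "bounded (F ` {a..b})" by (rule compact_imp_bounded)
  then show thesis using that unfolding bounded_pos by blast
qed

lemma abs_cont_on_mult:
  assumes "abs_cont_on {a..b} F" "abs_cont_on {a..b} G"
  shows "abs_cont_on {a..b} (\<lambda>x. F x * G x)"
proof -
  obtain M1 where M1: "0 < M1" "\<And>x. x \<in> {a..b} \<Longrightarrow> cmod (F x) \<le> M1"
    using continuous_on_cbound[OF abs_cont_on_continuous[OF assms(1)]] by blast
  obtain M2 where M2: "0 < M2" "\<And>x. x \<in> {a..b} \<Longrightarrow> cmod (G x) \<le> M2"
    using continuous_on_cbound[OF abs_cont_on_continuous[OF assms(2)]] by blast
  show ?thesis
  proof (rule abs_cont_on_bound[OF assms, of "M1 + M2"])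
    show "0 < M1 + M2" using M1 M2 by simp
    fix x y assume "x \<le> y" "{x..y} \<subseteq> {a..b}"
    then have xy: "x \<in> {a..b}" "y \<in> {a..b}" by auto
    have "F y * G y - F x * G x = F y * (G y - G x) + (F y - F x) * G x" by (simp add: algebra_simps)
    also have "cmod \<dots> \<le> cmod (F y) * cmod (G y - G x) + cmod (F y - F x) * cmod (G x)"
      by (rule order.trans[OF norm_triangle_ineq]) (simp add: norm_mult)
    also have "\<dots> \<le> (M1 + M2) * cmod (G y - G x) + cmod (F y - F x) * (M1 + M2)"
      using M1 M2 xy by (intro add_mono mult_right_mono mult_left_mono) (auto intro: add_increasing2 add_increasing less_imp_le)
    finally show "cmod (F y * G y - F x * G x) \<le> (M1 + M2) * (cmod (F y - F x) + cmod (G y - G x))"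
      by (simp add: algebra_simps)
  qed
qed

lemma abs_cont_on_cnj:
  assumes "abs_cont_on S F" shows "abs_cont_on S (\<lambda>x. cnj (F x))"
proof (rule abs_cont_on_bound[OF assms assms, of 1])
  fix x y
  have "cmod (cnj (F y) - cnj (F x)) = cmod (F y - F x)"
    by (metis complex_cnj_diff complex_mod_cnj)
  then show "cmod (cnj (F y) - cnj (F x)) \<le> 1 * (cmod (F y - F x) + cmod (F y - F x))" by simp
qed simp

lemma abs_cont_on_C1:
  assumes "\<And>x. x \<in> {a..b} \<Longrightarrow> (F has_vector_derivative F' x) (at x)" "continuous_on {a..b} F'"
  shows "abs_cont_on {a..b} F"
proof (rule abs_cont_indefinite_integral[OF sq_int_continuous[OF assms(2)]])
  fix x y assume xy: "a \<le> x" "x \<le> y" "y \<le> b"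
  have "(F' has_integral F y - F x) {x..y}"
    by (rule fundamental_theorem_of_calculus[OF xy(2)])
       (use assms(1) xy in \<open>auto intro: has_vector_derivative_at_within\<close>)
  then show "F y - F x = integral {x..y} F'" by (simp add: integral_unique)
qed

lemma abs_cont_on_of_real:
  assumes "\<And>x. x \<in> {a..b} \<Longrightarrow> (F has_real_derivative F' x) (at x)" "continuous_on {a..b} F'"
  shows "abs_cont_on {a..b} (\<lambda>x. complex_of_real (F x))"
  by (rule abs_cont_on_C1[of _ _ _ "\<lambda>x. complex_of_real (F' x)"])
     (use assms in \<open>auto intro!: has_vector_derivative_of_real continuous_on_of_real\<close>)

section \<open>The integrating factor and the bound at 0\<close>

lemma half_le_sin: assumes "0 \<le> x" "x \<le> (1::real)" shows "x / 2 \<le> sin x"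
proof -
  have "(\<lambda>x. sin x - x / 2) 0 \<le> (\<lambda>x. sin x - x / 2) x"
  proof (rule DERIV_nonneg_imp_nondecreasing[OF assms(1)])
    fix y assume y: "0 \<le> y" "y \<le> x"
    \<comment> \<open>On \<open>{0..1}\<close> the cosine is at least
      \<open>cos (pi / 3) = 1 / 2\<close>; this is the origin of the constant.\<close>
    have "1 < pi / 3" using pi_gt3 by simp
    then have "cos (pi / 3) \<le> cos y" using y assms(2) by (intro cos_monotone_0_pi_le) auto
    then have "0 \<le> cos y - 1 / 2" by (simp add: cos_60)
    moreover have "((\<lambda>x. sin x - x / 2) has_real_derivative cos y - 1 / 2) (at y)"
      by (auto intro!: derivative_eq_intros)
    ultimately show "\<exists>d. ((\<lambda>x. sin x - x / 2) has_real_derivative d) (at y) \<and> 0 \<le> d" by blast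
  qed
  then show ?thesis by simp
qed

text \<open>The integrating factor of \<open>e p' + p / sin = f\<close> on the half period: \<open>(wt e * p)' = wt e * f / e\<close>.\<close>

definition wt :: "real \<Rightarrow> real \<Rightarrow> real" where
  "wt e x = tan (x / 2) powr (1 / e)"

lemma wt_pos: "0 < x \<Longrightarrow> x < pi \<Longrightarrow> 0 < wt e x"
  using tan_gt_zero[of "x / 2"] by (simp add: wt_def)

lemma wt_nonneg: "0 \<le> wt e x"
  by (simp add: wt_def)

text \<open>\<open>tan (pi / 2)\<close> is 0 by the convention for division by zero, so monotonicity
  genuinely stops before pi.\<close>

lemma wt_mono: assumes "0 < e" "0 \<le> x" "x \<le> y" "y < pi" shows "wt e x \<le> wt e y"
proof -
  have "0 \<le> tan (x / 2)"
    using tan_gt_zero[of "x / 2"] assms by (cases "x = 0") auto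
  moreover have "tan (x / 2) \<le> tan (y / 2)"
    using assms tan_monotone'[of "x / 2" "y / 2"] by (cases "x = y") auto
  ultimately show ?thesis unfolding wt_def using assms by (intro powr_mono2) auto
qed

text \<open>\<open>1 / sin\<close> is the logarithmic derivative of \<open>tan (x / 2)\<close>.
  Hence \<open>e * (wt e)' = wt e / sin\<close>, and in the derivative of \<open>wt e * p\<close>
  the two terms containing \<open>p / sin\<close> cancel.\<close>

lemma wt_has_derivative:
  assumes "0 < x" "x < pi"
  shows "(wt e has_real_derivative wt e x / (e * sin x)) (at x)"
proof -
  have c: "0 < cos (x / 2)" and s: "0 < sin (x / 2)"
    using assms by (auto intro!: cos_gt_zero_pi sin_gt_zero)
  have t: "0 < tan (x / 2)" using c s by (simp add: tan_def)
  have d: "((\<lambda>x. tan (x / 2)) has_real_derivative inverse ((cos (x / 2))\<^sup>2) / 2) (at x)"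
    using c by (auto intro!: derivative_eq_intros simp: field_simps)
  have "((\<lambda>x. tan (x / 2) powr (1 / e)) has_real_derivative
      (1 / e) * tan (x / 2) powr (1 / e - of_nat 1) * (inverse ((cos (x / 2))\<^sup>2) / 2)) (at x)"
    by (rule DERIV_fun_powr[OF d t])
  moreover have "(1 / e) * tan (x / 2) powr (1 / e - of_nat 1) * (inverse ((cos (x / 2))\<^sup>2) / 2) = wt e x / (e * sin x)"
  proof -
    have sx: "sin x = 2 * sin (x / 2) * cos (x / 2)" using sin_double[of "x / 2"] by simp
    have "tan (x / 2) powr (1 / e - of_nat 1) = wt e x / tan (x / 2)"
      using t by (simp add: wt_def powr_diff)
    then show ?thesis using c s by (cases "e = 0") (auto simp: sx tan_def power2_eq_square field_simps)
  qed
  ultimately show ?thesis unfolding wt_def by (simp add: fun_eq_iff)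
qed

lemma wt_continuous: "0 < a \<Longrightarrow> b < pi \<Longrightarrow> continuous_on {a..b} (wt e)"
  by (rule DERIV_continuous_on[where D="\<lambda>x. wt e x / (e * sin x)"])
     (auto intro: DERIV_subset[OF wt_has_derivative])

text \<open>Supplies a left endpoint at which the weight is small enough to make the boundary term
  negligible, given that \<open>p\<close> is merely bounded near 0.\<close>

lemma wt_small: assumes "0 < e" "0 < d" "0 < a"
  obtains s where "0 < s" "s < a" "wt e s < d"
proof -
  have "((\<lambda>x::real. tan (x / 2)) \<longlongrightarrow> tan (0 / 2)) (at_right 0)"
    by (intro tendsto_intros) auto
  moreover have "eventually (\<lambda>x. x \<in> {0<..<pi}) (at_right (0::real))"
    by (rule eventually_at_right_real) simp
  then have "eventually (\<lambda>x. 0 \<le> tan (x / 2)) (at_right (0::real))"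
    by (rule eventually_mono) (use tan_gt_zero in \<open>auto intro!: less_imp_le\<close>)
  ultimately have "((\<lambda>x. wt e x) \<longlongrightarrow> 0) (at_right 0)"
    unfolding wt_def using assms(1) by (intro tendsto_zero_powrI[where b="1/e"]) auto
  then have "eventually (\<lambda>x. wt e x < d) (at_right 0)" using assms(2) by (rule order_tendstoD)
  moreover have "eventually (\<lambda>x. x \<in> {0<..<a}) (at_right (0::real))"
    by (rule eventually_at_right_real) (rule assms(3))
  ultimately have "eventually (\<lambda>x. x \<in> {0<..<a} \<and> wt e x < d) (at_right (0::real))"
    by (rule eventually_conj[rotated])
  then obtain s where "s \<in> {0<..<a} \<and> wt e s < d"
    using eventually_happens'[OF trivial_limit_at_right_real] by blast
  then show thesis using that by auto
qed

text \<open>Here \<open>p\<close> plays the role of \<open>sin * y'\<close>. Boundedness at \<open>0\<close> selects the solution without a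
  homogeneous part \<open>1 / wt e\<close>.\<close>

definition half_sol :: "real \<Rightarrow> (real \<Rightarrow> complex) \<Rightarrow> (real \<Rightarrow> complex) \<Rightarrow> bool" where
  "half_sol e f p \<longleftrightarrow> (\<forall>a b. 0 < a \<longrightarrow> b < pi \<longrightarrow> abs_cont_on {a..b} p) \<and>
     (AE x in lborel. x \<in> {0<..<pi} \<longrightarrow>
        (p has_vector_derivative (f x - p x / complex_of_real (sin x)) / complex_of_real e) (at x)) \<and>
     (\<exists>B. \<forall>x\<in>{0<..<1}. cmod (p x) \<le> B)"

text \<open>Integrate \<open>(wt e * p)'\<close> over \<open>{s..a}\<close> and let \<open>s\<close>
  tend to 0: the term at \<open>s\<close> disappears, since the weight tends to 0 and
  \<open>p\<close> is bounded. As \<open>wt e\<close> increases, it can be replaced by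
  \<open>wt e a\<close> under the integral and then divided out. Cauchy-Schwarz gives the factor
  \<open>sqrt a\<close>, which forces \<open>p\<close> to tend to 0 at 0.\<close>

lemma half_sol_bound:
  assumes e: "0 < e" and p: "half_sol e f p" and f: "sq_int (lb 0 pi) f" and a: "0 < a" "a < pi"
  shows "cmod (p a) \<le> sqrt a * sqn (lb 0 pi) f / e"
proof -
  let ?S = "sqn (lb 0 pi) f"
  obtain B where "\<forall>x\<in>{0<..<1}. cmod (p x) \<le> B"
    using p unfolding half_sol_def by blast
  then have B: "\<And>x. 0 < x \<Longrightarrow> x < 1 \<Longrightarrow> cmod (p x) \<le> B" by simp
  have B0: "0 \<le> B" using order.trans[OF norm_ge_zero B[of "1/2"]] by simp
  have main: "wt e a * cmod (p a) \<le> wt e s * B + wt e a / e * (sqrt a * ?S)" if s: "0 < s" "s < a" "s < 1" for s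
  proof -
    let ?F = "\<lambda>x. complex_of_real (wt e x) * p x"
    let ?g = "\<lambda>x. complex_of_real (wt e x / e) * f x"
    have "abs_cont_on {s..a} (\<lambda>x. complex_of_real (wt e x))"
    proof (rule abs_cont_on_of_real)
      show "(wt e has_real_derivative wt e x / (e * sin x)) (at x)" if "x \<in> {s..a}" for x
        using wt_has_derivative[of x e] that s a by auto
      show "continuous_on {s..a} (\<lambda>x. wt e x / (e * sin x))"
      proof (intro continuous_intros wt_continuous)
        show "\<forall>x\<in>{s..a}. e * sin x \<noteq> 0"
        proof
          fix x assume "x \<in> {s..a}"
          then show "e * sin x \<noteq> 0" using sin_gt_zero[of x] s a e by auto
        qed
      qed (use s a in auto)
    qed
    moreover have "abs_cont_on {s..a} p" using p s a by (simp add: half_sol_def)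
    ultimately have ac: "abs_cont_on {s..a} ?F" by (rule abs_cont_on_mult)
    have "AE x in lborel. x \<in> {0<..<pi} \<longrightarrow>
        (p has_vector_derivative (f x - p x / complex_of_real (sin x)) / complex_of_real e) (at x)"
      using p by (simp add: half_sol_def)
    then have "AE x in lborel. x \<in> {s..a} \<longrightarrow> (?F has_vector_derivative ?g x) (at x)"
    proof eventually_elim
      case (elim x)
      show ?case
      proof
        assume x: "x \<in> {s..a}"
        then have x': "0 < x" "x < pi" using s a by auto
        have sx: "sin x > 0" using x' by (intro sin_gt_zero)
        have "(?F has_vector_derivative (complex_of_real (wt e x) * ((f x - p x / complex_of_real (sin x)) / complex_of_real e)
           + complex_of_real (wt e x / (e * sin x)) * p x)) (at x)"
          using elim x' by (intro has_vector_derivative_mult has_vector_derivative_of_real wt_has_derivative) auto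
        moreover have "complex_of_real (wt e x) * ((f x - p x / complex_of_real (sin x)) / complex_of_real e)
           + complex_of_real (wt e x / (e * sin x)) * p x = ?g x"
          using sx e by (simp add: field_simps)
        ultimately show "(?F has_vector_derivative ?g x) (at x)" by simp
      qed
    qed
    then have hi: "(?g has_integral ?F a - ?F s) {s..a}"
      using s by (intro abs_cont_has_integral[OF _ ac]) auto
    note fs = sq_int_lb_mono[OF f, of s a]
    have nf: "((\<lambda>x. wt e a / e * cmod (f x)) has_integral wt e a / e * (LINT x|lb s a. cmod (f x))) {s..a}"
      by (intro has_integral_mult_right has_integral_lb integrable_norm sq_int_lb_integrable fs) (use s a in auto)
    have "cmod (?F a - ?F s) \<le> wt e a / e * (LINT x|lb s a. cmod (f x))"
    proof -
      have "cmod (integral {s..a} ?g) \<le> integral {s..a} (\<lambda>x. wt e a / e * cmod (f x))"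
      proof (rule Henstock_Kurzweil_Integration.integral_norm_bound_integral)
        fix x assume "x \<in> {s..a}"
        then have "wt e x \<le> wt e a" using s a e by (intro wt_mono) auto
        then have "wt e x / e \<le> wt e a / e" using e by (simp add: divide_right_mono)
        then show "cmod (?g x) \<le> wt e a / e * cmod (f x)"
          using mult_right_mono[OF _ norm_ge_zero[of "f x"], of "wt e x / e" "wt e a / e"] e wt_nonneg[of e x]
          by (simp add: norm_mult norm_divide)
      qed (use hi nf in blast)+
      then show ?thesis unfolding integral_unique[OF hi] integral_unique[OF nf] .
    qed
    also have "\<dots> \<le> wt e a / e * (sqrt a * ?S)"
    proof (rule mult_left_mono)
      have "(LINT x|lb s a. cmod (f x)) \<le> sqrt (a - s) * sqn (lb s a) f"
        by (rule integral_cmod_lb_le[OF fs]) (use s a in auto)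
      also have "\<dots> \<le> sqrt a * ?S"
        using sqn_lb_mono[OF f, of s a] s a by (intro mult_mono) auto
      finally show "(LINT x|lb s a. cmod (f x)) \<le> sqrt a * ?S" .
      show "0 \<le> wt e a / e" using e by (simp add: wt_nonneg)
    qed
    finally have "cmod (?F a) \<le> cmod (?F s) + wt e a / e * (sqrt a * ?S)"
      using norm_triangle_ineq2[of "?F a" "?F s"] by linarith
    moreover have "cmod (?F s) \<le> wt e s * B"
      using B[of s] s wt_nonneg[of e s] by (simp add: norm_mult mult_left_mono)
    ultimately show ?thesis using wt_nonneg[of e a] by (simp add: norm_mult)
  qed
  have "wt e a * cmod (p a) \<le> wt e a / e * (sqrt a * ?S) + d" if d: "0 < d" for d
  proof -
    have "0 < d / (B + 1)" using d B0 by simp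
    from wt_small[OF e this, of "min a 1"] obtain s where s: "0 < s" "s < min a 1" "wt e s < d / (B + 1)"
      using a by auto
    have "wt e s * B \<le> d / (B + 1) * B" using s(3) B0 by (intro mult_right_mono) auto
    also have "\<dots> \<le> d" using B0 d by (simp add: field_simps)
    finally show ?thesis using main[of s] s by simp
  qed
  then have "wt e a * cmod (p a) \<le> wt e a / e * (sqrt a * ?S)" by (rule field_le_epsilon)
  then have "wt e a * cmod (p a) \<le> wt e a * (sqrt a * ?S / e)" by simp
  then show ?thesis using wt_pos[OF a, of e] by (metis mult_le_cancel_left_pos)
qed

text \<open>The fundamental theorem applied to \<open>m * |p|^2\<close>, written as the real part of
  a product of absolutely continuous factors. The multiplier is left open: \<open>1 / sin\<close>
  gives the energy estimate and \<open>cos / sin\<close> gives Hardy's inequality.\<close>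

lemma energy_identity:
  assumes ab: "a \<le> b" and p: "abs_cont_on {a..b} p"
    and p': "AE x in lborel. x \<in> {a..b} \<longrightarrow> (p has_vector_derivative p' x) (at x)"
    and m: "\<And>x. x \<in> {a..b} \<Longrightarrow> (m has_real_derivative m' x) (at x)" "continuous_on {a..b} m'"
  shows "((\<lambda>x. 2 * m x * Re (p' x * cnj (p x)) + m' x * (cmod (p x))\<^sup>2) has_integral
      m b * (cmod (p b))\<^sup>2 - m a * (cmod (p a))\<^sup>2) {a..b}"
proof -
  let ?F = "\<lambda>x. complex_of_real (m x) * (p x * cnj (p x))"
  let ?f = "\<lambda>x. complex_of_real (m x) * (p x * cnj (p' x) + p' x * cnj (p x)) + complex_of_real (m' x) * (p x * cnj (p x))"
  have "abs_cont_on {a..b} ?F"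
    by (intro abs_cont_on_mult abs_cont_on_cnj p abs_cont_on_of_real[OF m]) auto
  moreover have "AE x in lborel. x \<in> {a..b} \<longrightarrow> (?F has_vector_derivative ?f x) (at x)"
    using p'
  proof eventually_elim
    case (elim x)
    then show ?case using m(1)[of x]
      by (intro impI has_vector_derivative_mult has_vector_derivative_of_real has_vector_derivative_cnj) auto
  qed
  ultimately have "(?f has_integral ?F b - ?F a) {a..b}" by (intro abs_cont_has_integral[OF ab])
  from has_integral_linear[OF this bounded_linear_Re]
  have *: "((\<lambda>x. Re (?f x)) has_integral Re (?F b) - Re (?F a)) {a..b}" by (simp add: o_def)
  have f: "Re (?f x) = 2 * m x * Re (p' x * cnj (p x)) + m' x * (cmod (p x))\<^sup>2" for x
    unfolding cmod_power2 by (simp add: algebra_simps power2_eq_square)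
  have F: "Re (?F x) = m x * (cmod (p x))\<^sup>2" for x
    unfolding cmod_power2 by (simp add: algebra_simps power2_eq_square)
  show ?thesis using * unfolding f F .
qed


text \<open>Fatou's lemma on the exhausting intervals \<open>{A n..pi - A n}\<close>. Continuity is
  known only inside; the two endpoint values make \<open>w\<close> agree on \<open>{0..pi}\<close>
  with a Borel function extended by zero.\<close>

lemma sq_int_from_inner:
  assumes c: "continuous_on {0<..<pi} w" and 0: "w 0 = 0" "w pi = 0"
    and K: "\<And>a b. 0 < a \<Longrightarrow> a \<le> b \<Longrightarrow> b < pi \<Longrightarrow> integral {a..b} (\<lambda>x. (cmod (w x))\<^sup>2) \<le> K"
  shows "sq_int (lb 0 pi) w" "(sqn (lb 0 pi) w)\<^sup>2 \<le> K"
proof -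
  define v where "v = (\<lambda>x. indicator {0<..<pi} x *\<^sub>R w x)"
  have vm [measurable]: "v \<in> borel_measurable borel"
    unfolding v_def by (rule borel_measurable_continuous_on_indicator[OF _ c]) simp
  have v': "v x = w x" if "x \<in> {0..pi}" for x
    using that 0 by (cases "x = 0 \<or> x = pi") (auto simp: v_def)
  have "v \<in> borel_measurable (lb 0 pi)"
    by (rule measurable_restrict_space1) (use vm in simp)
  then have meas: "w \<in> borel_measurable (lb 0 pi)"
    by (rule measurable_cong[THEN iffD1, rotated]) (use v' in \<open>simp add: space_restrict_space\<close>)
  define A where "A = (\<lambda>n::nat. 1 / (real n + 1))"
  define g where "g = (\<lambda>n x. indicator {A n..pi - A n} x * (cmod (w x))\<^sup>2)"
  have Apos: "0 < A n" for n by (simp add: A_def)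
  have A0: "A \<longlonglongrightarrow> 0" unfolding A_def using LIMSEQ_inverse_real_of_nat by (simp add: inverse_eq_divide add.commute)
  have gv: "g n x = indicator {A n..pi - A n} x * (cmod (v x))\<^sup>2" for n x
    using Apos[of n] by (auto simp: g_def v_def indicator_def)
  have gm: "(\<lambda>x. ennreal (g n x)) \<in> borel_measurable lborel" for n
    unfolding gv by measurable
  have gi: "(\<integral>\<^sup>+x. ennreal (g n x) \<partial>lborel) \<le> ennreal K" for n
  proof (cases "A n \<le> pi - A n")
    case True
    have "continuous_on {A n..pi - A n} w"
      by (rule continuous_on_subset[OF c]) (use Apos[of n] in auto)
    then have ci: "continuous_on {A n..pi - A n} (\<lambda>x. (cmod (w x))\<^sup>2)" by (intro continuous_intros)
    then have ci': "set_integrable lborel {A n..pi - A n} (\<lambda>x. (cmod (w x))\<^sup>2)"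
      by (rule borel_integrable_atLeastAtMost')
    then have "integrable lborel (g n)" by (simp add: set_integrable_def g_def)
    then have "(\<integral>\<^sup>+x. ennreal (g n x) \<partial>lborel) = ennreal (LINT x|lborel. g n x)"
      by (rule nn_integral_eq_integral) (auto simp: g_def)
    also have "(LINT x|lborel. g n x) = integral {A n..pi - A n} (\<lambda>x. (cmod (w x))\<^sup>2)"
      using set_borel_integral_eq_integral(2)[OF ci'] by (simp add: set_lebesgue_integral_def g_def)
    also have "\<dots> \<le> K" using True Apos[of n] by (intro K) auto
    finally show ?thesis by (simp add: ennreal_leI)
  next
    case False
    then have "g n = (\<lambda>x. 0)" by (auto simp: g_def indicator_def)
    then show ?thesis by simp
  qed
  have lim: "liminf (\<lambda>n. ennreal (g n x)) = ennreal ((cmod (v x))\<^sup>2)" for x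
  proof (rule lim_imp_Liminf)
    show "(\<lambda>n. ennreal (g n x)) \<longlonglongrightarrow> ennreal ((cmod (v x))\<^sup>2)"
    proof (rule tendsto_eventually)
      show "\<forall>\<^sub>F n in sequentially. ennreal (g n x) = ennreal ((cmod (v x))\<^sup>2)"
      proof (cases "x \<in> {0<..<pi}")
        case True
        then have m: "0 < min x (pi - x)" by simp
        have "\<forall>\<^sub>F n in sequentially. A n < min x (pi - x)" by (rule order_tendstoD(2)[OF A0 m])
        then show ?thesis by eventually_elim (simp add: gv)
      qed (simp add: gv v_def)
    qed
  qed simp
  have "(\<integral>\<^sup>+x. ennreal ((cmod (v x))\<^sup>2) \<partial>lborel) \<le> liminf (\<lambda>n. \<integral>\<^sup>+x. ennreal (g n x) \<partial>lborel)"
    unfolding lim[symmetric] by (rule nn_integral_liminf[OF gm])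
  also have "\<dots> \<le> limsup (\<lambda>n. \<integral>\<^sup>+x. ennreal (g n x) \<partial>lborel)"
    by (rule Liminf_le_Limsup) simp
  also have "\<dots> \<le> ennreal K"
    by (rule Limsup_bounded) (use gi in simp)
  finally have nn: "(\<integral>\<^sup>+x. ennreal ((cmod (v x))\<^sup>2) \<partial>lborel) \<le> ennreal K" .
  have K0: "0 \<le> K" using K[of 1 1] pi_gt3 by simp
  have int: "integrable lborel (\<lambda>x. (cmod (v x))\<^sup>2)"
  proof (rule integrableI_bounded)
    show "(\<lambda>x. (cmod (v x))\<^sup>2) \<in> borel_measurable lborel" by measurable
    show "(\<integral>\<^sup>+x. ennreal (norm ((cmod (v x))\<^sup>2)) \<partial>lborel) < \<infinity>"
      using nn by (simp add: le_less_trans)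
  qed
  have ieq: "(\<lambda>x. indicator {0..pi} x *\<^sub>R (cmod (w x))\<^sup>2) = (\<lambda>x. (cmod (v x))\<^sup>2)"
  proof
    fix x
    show "indicator {0..pi} x *\<^sub>R (cmod (w x))\<^sup>2 = (cmod (v x))\<^sup>2"
    proof (cases "x \<in> {0..pi}")
      case True
      then show ?thesis using v'[OF True] by simp
    next
      case False
      then have "indicator {0<..<pi} x = (0::real)" "indicator {0..pi} x = (0::real)" by (auto simp: indicator_def)
      then show ?thesis by (simp add: v_def)
    qed
  qed
  have int': "integrable (lb 0 pi) (\<lambda>x. (cmod (w x))\<^sup>2)"
    unfolding integrable_lb_iff set_integrable_def ieq by (rule int)
  show "sq_int (lb 0 pi) w" using meas int' unfolding sq_int_def by blast
  have "ennreal (LINT x|lborel. (cmod (v x))\<^sup>2) \<le> ennreal K"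
    using nn nn_integral_eq_integral[OF int] by simp
  then have "(LINT x|lborel. (cmod (v x))\<^sup>2) \<le> K" using K0 by simp
  then show "(sqn (lb 0 pi) w)\<^sup>2 \<le> K"
    unfolding sqn_power2 integral_lb_eq set_lebesgue_integral_def ieq .
qed

lemma half_le_sin_pi: "pi - 1 \<le> x \<Longrightarrow> x \<le> pi \<Longrightarrow> (pi - x) / 2 \<le> sin x"
  using half_le_sin[of "pi - x"] by simp

text \<open>Young's inequality in the form that gives up half of a coercive term
  \<open>c * W^2\<close>.\<close>

lemma quadratic_absorb:
  fixes c F W :: real
  assumes "0 < c" shows "F * W \<le> F\<^sup>2 / (2 * c) + c / 2 * W\<^sup>2"
proof -
  have "0 \<le> (F - c * W)\<^sup>2 / (2 * c)" using assms by simp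
  also have "\<dots> = F\<^sup>2 / (2 * c) + c / 2 * W\<^sup>2 - F * W" using assms by (simp add: power2_eq_square field_simps)
  finally show ?thesis by simp
qed

lemma Re_of_real_mult: "Re (complex_of_real r * z) = r * Re z"
  by simp

lemma Re_mult_cnj_le: "Re (u * cnj v) \<le> cmod u * cmod v"
  using complex_Re_le_cmod[of "u * cnj v"] by (simp add: norm_mult)

text \<open>The multiplier \<open>1 / sin\<close> in the energy identity turns the equation into a coercive form because
  \<open>1 + (e / 2) * cos\<close> is bounded below by \<open>1 - e / 2\<close>. This is the only place where \<open>e < 2\<close> matters.
  The boundary term at \<open>b\<close> has the good sign and is kept: it forces \<open>p\<close> to vanish at \<open>pi\<close>.\<close>

lemma half_sol_energy:
  assumes e: "0 < e" "e < 2" and p: "half_sol e f p" and f: "sq_int (lb 0 pi) f"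
  defines "c \<equiv> 1 - e / 2"
  assumes a: "0 < a" "a \<le> 1" and ab: "a \<le> b" "b < pi"
  shows "c / 2 * integral {a..b} (\<lambda>x. (cmod (p x / complex_of_real (sin x)))\<^sup>2) + e / 2 * ((cmod (p b))\<^sup>2 / sin b)
     \<le> (1 / (2 * c) + 1 / e) * (sqn (lb 0 pi) f)\<^sup>2"
proof -
  let ?S = "sqn (lb 0 pi) f"
  let ?w = "\<lambda>x. p x / complex_of_real (sin x)"
  have c: "0 < c" using e by (simp add: c_def)
  have sx: "0 < sin x" if "x \<in> {a..b}" for x using that a ab by (intro sin_gt_zero) auto
  have ac: "abs_cont_on {a..b} p" using p a ab by (simp add: half_sol_def)
  have "continuous_on {a..b} ?w"
    using sx by (intro continuous_intros abs_cont_on_continuous[OF ac]) force+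
  then have cw: "continuous_on {a..b} (\<lambda>x. (cmod (?w x))\<^sup>2)" by (intro continuous_on_power continuous_on_norm)
  define p' where "p' = (\<lambda>x. (f x - ?w x) / complex_of_real e)"
  have dp: "AE x in lborel. x \<in> {a..b} \<longrightarrow> (p has_vector_derivative p' x) (at x)"
  proof -
    have "AE x in lborel. x \<in> {0<..<pi} \<longrightarrow> (p has_vector_derivative p' x) (at x)"
      using p unfolding half_sol_def p'_def by blast
    then show ?thesis by eventually_elim (use a ab in auto)
  qed
  have m: "((\<lambda>x. 1 / sin x) has_real_derivative - cos x / (sin x)\<^sup>2) (at x)" if "x \<in> {a..b}" for x
    using sx[OF that] by (auto intro!: derivative_eq_intros simp: power2_eq_square)
  have cm: "continuous_on {a..b} (\<lambda>x. - cos x / (sin x)\<^sup>2)"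
    using sx by (intro continuous_intros) force
  note en = energy_identity[OF ab(1) ac dp m cm]
  let ?g = "\<lambda>x. 2 * (1 / sin x) * Re (p' x * cnj (p x)) + - cos x / (sin x)\<^sup>2 * (cmod (p x))\<^sup>2"
  let ?I = "integral {a..b} (\<lambda>x. (cmod (?w x))\<^sup>2)"
  let ?F = "integral {a..b} (\<lambda>x. (cmod (f x))\<^sup>2)"
  have pt: "e / 2 * ?g x \<le> (cmod (f x))\<^sup>2 / (2 * c) - c / 2 * (cmod (?w x))\<^sup>2" if x: "x \<in> {a..b}" for x
  proof -
    have s: "sin x > 0" by (rule sx[OF x])
    have px: "p x = complex_of_real (sin x) * ?w x" using s by simp
    have 1: "2 * (1 / sin x) * Re (p' x * cnj (p x)) = (2 / e) * (Re (f x * cnj (?w x)) - (cmod (?w x))\<^sup>2)"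
    proof -
      have "p' x * cnj (p x) = complex_of_real (sin x / e) * (f x * cnj (?w x) - ?w x * cnj (?w x))"
        using s e by (simp add: p'_def field_simps)
      then have "Re (p' x * cnj (p x)) = sin x / e * (Re (f x * cnj (?w x)) - Re (?w x * cnj (?w x)))"
        by (simp only: Re_of_real_mult minus_complex.simps)
      also have "Re (?w x * cnj (?w x)) = (cmod (?w x))\<^sup>2"
        unfolding complex_mult_cnj cmod_power2 by (rule Re_complex_of_real)
      finally show ?thesis using s e by simp
    qed
    have 2: "- cos x / (sin x)\<^sup>2 * (cmod (p x))\<^sup>2 = - cos x * (cmod (?w x))\<^sup>2"
      using s by (simp add: norm_divide power_divide)
    \<comment> \<open>The equation replaces \<open>e * p'\<close> by \<open>f - w\<close>, and the
      derivative of \<open>1 / sin\<close> contributes the cosine; the factor \<open>e / 2\<close>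
      normalises the coefficient of the cross term to 1.\<close>
    have "e / 2 * ?g x = Re (f x * cnj (?w x)) - (1 + e / 2 * cos x) * (cmod (?w x))\<^sup>2"
    proof -
      have "e / 2 * (2 / e * (R - W) + - k * W) = R - (1 + e / 2 * k) * W" for R W k :: real
        using e by (simp add: field_simps)
      then show ?thesis unfolding 1 2 .
    qed
    also have "\<dots> \<le> cmod (f x) * cmod (?w x) - c * (cmod (?w x))\<^sup>2"
    proof (rule diff_mono[OF Re_mult_cnj_le mult_right_mono])
      have "- 1 \<le> cos x" by simp
      then have "e / 2 * (- 1) \<le> e / 2 * cos x" using e by (intro mult_left_mono) auto
      then show "c \<le> 1 + e / 2 * cos x" by (simp add: c_def)
    qed simp
    also have "\<dots> \<le> (cmod (f x))\<^sup>2 / (2 * c) - c / 2 * (cmod (?w x))\<^sup>2"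
      using quadratic_absorb[OF c, of "cmod (f x)" "cmod (?w x)"] by simp
    finally show ?thesis .
  qed
  have iF: "integrable (lb a b) (\<lambda>x. (cmod (f x))\<^sup>2)"
    using sq_int_lb_mono[OF f, of a b] a ab by (simp add: sq_int_def)
  have hF: "((\<lambda>x. (cmod (f x))\<^sup>2) has_integral ?F) {a..b}"
    using has_integral_lb[OF iF] integral_lb[OF iF] by simp
  have hW: "((\<lambda>x. (cmod (?w x))\<^sup>2) has_integral ?I) {a..b}"
    by (intro integrable_integral integrable_continuous_real cw)
  have "e / 2 * (1 / sin b * (cmod (p b))\<^sup>2 - 1 / sin a * (cmod (p a))\<^sup>2) \<le> ?F / (2 * c) - c / 2 * ?I"
  proof (rule has_integral_le[OF has_integral_mult_right[OF en] has_integral_diff[OF has_integral_divide[OF hF] has_integral_mult_right[OF hW]]])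
    fix x assume "x \<in> {a..b}"
    then show "e / 2 * ?g x \<le> (cmod (f x))\<^sup>2 / (2 * c) - c / 2 * (cmod (?w x))\<^sup>2" by (rule pt)
  qed
  moreover have "?F / (2 * c) \<le> ?S\<^sup>2 / (2 * c)"
  proof (rule divide_right_mono)
    have "?F \<le> (LINT x|lb 0 pi. (cmod (f x))\<^sup>2)"
      unfolding integral_lb[OF iF] using f a ab by (intro integral_lb_mono) (auto simp: sq_int_def)
    then show "?F \<le> ?S\<^sup>2" by (simp add: sqn_power2)
  qed (use c in simp)
  \<comment> \<open>The boundary term at \<open>a\<close> has the bad sign. By
    \<open>half_sol_bound\<close>, \<open>|p a|^2\<close> is at most \<open>a * ?S^2 / e^2\<close>,
    and \<open>a / 2 <= sin a\<close>, valid because \<open>a <= 1\<close>, cancels the factor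
    \<open>a\<close>. This is the origin of \<open>1 / e\<close> in the final constant.\<close>
  moreover have "e / 2 * (1 / sin a * (cmod (p a))\<^sup>2) \<le> ?S\<^sup>2 / e"
  proof -
    have sa: "a / 2 \<le> sin a" using half_le_sin[of a] a by simp
    have "(cmod (p a))\<^sup>2 \<le> (sqrt a * ?S / e)\<^sup>2"
      using half_sol_bound[OF e(1) p f a(1)] a ab by (intro power_mono) auto
    also have "\<dots> = a * ?S\<^sup>2 / e\<^sup>2" using a by (simp add: power_mult_distrib power_divide)
    finally have "1 / sin a * (cmod (p a))\<^sup>2 \<le> (2 / a) * (a * ?S\<^sup>2 / e\<^sup>2)"
      using sa a by (intro mult_mono) (auto simp: field_simps)
    also have "\<dots> = 2 * ?S\<^sup>2 / e\<^sup>2" using a by simp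
    finally have "e / 2 * (1 / sin a * (cmod (p a))\<^sup>2) \<le> e / 2 * (2 * ?S\<^sup>2 / e\<^sup>2)"
      using e by (intro mult_left_mono) auto
    also have "\<dots> = ?S\<^sup>2 / e" using e by (simp add: power2_eq_square)
    finally show ?thesis .
  qed
  ultimately show ?thesis by (simp add: algebra_simps)
qed

lemma le_zero_if_sqrt_bound:
  fixes r C :: real
  assumes "\<And>t. 0 < t \<Longrightarrow> t < 1 \<Longrightarrow> r \<le> sqrt t * C" shows "r \<le> 0"
proof (rule tendsto_lowerbound)
  have "((\<lambda>t. sqrt t * C) \<longlongrightarrow> sqrt 0 * C) (at_right 0)" by (intro tendsto_intros)
  then show "((\<lambda>t. sqrt t * C) \<longlongrightarrow> 0) (at_right 0)" by simp
  have "eventually (\<lambda>t. t \<in> {0<..<1}) (at_right (0::real))" by (rule eventually_at_right_real) simp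
  then show "\<forall>\<^sub>F t in at_right 0. r \<le> sqrt t * C" by eventually_elim (use assms in auto)
qed simp

text \<open>The bound \<open>K\<close> from \<open>half_sol_energy\<close> does not depend on the
  interval, so \<open>w\<close> is square integrable up to both ends, and then so is
  \<open>q\<close>. Near 0, \<open>half_sol_bound\<close> lets the fundamental theorem start at 0.
  Near pi, the retained boundary term gives \<open>|p x|^2 <= K * (2 / e) * sin x\<close>, whence
  the total integral of \<open>q\<close> is 0. \<open>half_sol\<close> does not see the values at 0
  and pi, so these are normalised by hypothesis.\<close>

lemma half_sol_regular:
  assumes e: "0 < e" "e < 2" and p: "half_sol e f p" and f: "sq_int (lb 0 pi) f" and p0: "p 0 = 0" "p pi = 0"
  defines "w \<equiv> \<lambda>x. p x / complex_of_real (sin x)"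
  defines "q \<equiv> \<lambda>x. (f x - w x) / complex_of_real e"
  shows "sq_int (lb 0 pi) w" "sq_int (lb 0 pi) q"
    "\<And>x. 0 \<le> x \<Longrightarrow> x \<le> pi \<Longrightarrow> p x = integral {0..x} q"
proof -
  let ?S = "sqn (lb 0 pi) f"
  define c where "c = 1 - e / 2"
  have c: "0 < c" using e by (simp add: c_def)
  define K where "K = (1 / (2 * c) + 1 / e) * ?S\<^sup>2"
  note en = half_sol_energy[OF e p f, folded c_def, folded K_def]
  have cp: "continuous_on {a..b} p" if "0 < a" "b < pi" for a b
    using p that by (intro abs_cont_on_continuous) (simp add: half_sol_def)
  have cp': "isCont p x" if "0 < x" "x < pi" for x
    using continuous_on_interior[OF cp[of "x / 2" "(x + pi) / 2"], of x] that by simp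
  have sx: "sin x > 0" if "0 < x" "x < pi" for x using that by (rule sin_gt_zero)
  have cw: "continuous_on {0<..<pi} w"
    unfolding w_def using cp' sx by (intro continuous_at_imp_continuous_on ballI continuous_intros) force+
  show w: "sq_int (lb 0 pi) w"
  proof (rule sq_int_from_inner(1)[OF cw])
    \<comment> \<open>Both quotients have denominator 0, hence value 0 by convention, as
      \<open>sq_int_from_inner\<close> requires.\<close>
    show "w 0 = 0" "w pi = 0" by (simp_all add: w_def)
    fix a b :: real assume ab: "0 < a" "a \<le> b" "b < pi"
    have *: "integral {a'..b} (\<lambda>x. (cmod (w x))\<^sup>2) \<le> K / (c / 2)" if "0 < a'" "a' \<le> 1" "a' \<le> b" for a'
    proof -
      have "0 \<le> e / 2 * ((cmod (p b))\<^sup>2 / sin b)" using sx[of b] ab e by simp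
      then have "c / 2 * integral {a'..b} (\<lambda>x. (cmod (w x))\<^sup>2) \<le> K"
        using en[OF that ab(3)] by (simp add: w_def)
      then show ?thesis using c by (simp add: field_simps)
    qed
    have ci: "continuous_on {min a 1..b} (\<lambda>x. (cmod (w x))\<^sup>2)"
      by (intro continuous_intros continuous_on_subset[OF cw]) (use ab in auto)
    \<comment> \<open>\<open>half_sol_energy\<close> asks for a left endpoint of at most 1; the
      integrand is nonnegative, so the interval may be enlarged.\<close>
    have "integral {a..b} (\<lambda>x. (cmod (w x))\<^sup>2) \<le> integral {min a 1..b} (\<lambda>x. (cmod (w x))\<^sup>2)"
      by (rule integral_subset_le)
         (auto intro!: integrable_continuous_real continuous_on_subset[OF ci] simp: ci)
    also have "\<dots> \<le> K / (c / 2)" using ab by (intro *) auto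
    finally show "integral {a..b} (\<lambda>x. (cmod (w x))\<^sup>2) \<le> K / (c / 2)" .
  qed
  show q: "sq_int (lb 0 pi) q" unfolding q_def by (intro sq_int_divide sq_int_diff f w)
  have dp: "AE x in lborel. x \<in> {0<..<pi} \<longrightarrow> (p has_vector_derivative q x) (at x)"
    using p unfolding half_sol_def q_def w_def by blast
  have ftc: "p x - p a = integral {a..x} q" if "0 < a" "a \<le> x" "x < pi" for a x
  proof -
    have ac: "abs_cont_on {a..x} p" using p that by (simp add: half_sol_def)
    have "AE x' in lborel. x' \<in> {a..x} \<longrightarrow> (p has_vector_derivative q x') (at x')"
      using dp by eventually_elim (use that in auto)
    then have "(q has_integral p x - p a) {a..x}" by (rule abs_cont_has_integral[OF that(2) ac])
    then show ?thesis by (simp add: integral_unique)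
  qed
  have comb: "integral {s..t} q + integral {t..u} q = integral {s..u} q" if "0 \<le> s" "s \<le> t" "t \<le> u" "u \<le> pi" for s t u
    by (rule Henstock_Kurzweil_Integration.integral_combine[OF that(2,3)]) (rule sq_int_integrable_on[OF q that(1,4)])
  have inner: "p x = integral {0..x} q" if x: "0 < x" "x < pi" for x
  proof -
    have "cmod (p x - integral {0..x} q) \<le> 0"
    proof (rule le_zero_if_sqrt_bound)
      fix t :: real assume t: "0 < t" "t < 1"
      define a where "a = x * t"
      have a: "0 < a" "a \<le> x" "sqrt a = sqrt x * sqrt t"
        using x t by (auto simp: a_def real_sqrt_mult mult_le_cancel_left2)
      have "p x - integral {0..x} q = p a - integral {0..a} q"
        using ftc[OF a(1,2) x(2)] comb[of 0 a x] a x by (simp add: algebra_simps)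
      also have "cmod \<dots> \<le> sqrt a * ?S / e + sqrt (a - 0) * sqn (lb 0 pi) q"
        by (rule order.trans[OF norm_triangle_ineq4 add_mono])
           (use half_sol_bound[OF e(1) p f a(1)] norm_integral_sq_le[OF q, of 0 a] a x in auto)
      also have "\<dots> = sqrt t * (sqrt x * (?S / e + sqn (lb 0 pi) q))"
        by (simp add: a(3) algebra_simps)
      finally show "cmod (p x - integral {0..x} q) \<le> sqrt t * (sqrt x * (?S / e + sqn (lb 0 pi) q))" .
    qed
    then show ?thesis by simp
  qed
  have outer: "integral {0..pi} q = 0"
  proof -
    have "cmod (integral {0..pi} q) \<le> 0"
    proof (rule le_zero_if_sqrt_bound)
      fix t :: real assume t: "0 < t" "t < 1"
      define x where "x = pi - t"
      have x: "0 < x" "x < pi" "1 \<le> x" using t pi_gt3 by (auto simp: x_def)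
      \<comment> \<open>The energy estimate on \<open>{1..x}\<close> with the nonnegative integral
        discarded, which leaves the boundary term at \<open>x\<close>.\<close>
      have 1: "e / 2 * ((cmod (p x))\<^sup>2 / sin x) \<le> K"
      proof -
        have nz: "\<forall>y\<in>{1..x}. complex_of_real (sin y) \<noteq> 0" 
        proof
          fix y assume "y \<in> {1..x}"
          then show "complex_of_real (sin y) \<noteq> 0" using sx[of y] x by simp
        qed
        have "continuous_on {1..x} (\<lambda>x. (cmod (p x / complex_of_real (sin x)))\<^sup>2)"
          by (intro continuous_intros cp nz) (use x in auto)
        then have "0 \<le> integral {1..x} (\<lambda>x. (cmod (p x / complex_of_real (sin x)))\<^sup>2)"
          by (intro Henstock_Kurzweil_Integration.integral_nonneg integrable_continuous_real) auto
        then have "0 \<le> c / 2 * integral {1..x} (\<lambda>x. (cmod (p x / complex_of_real (sin x)))\<^sup>2)"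
          using c by simp
        then show ?thesis using en[of 1 x] x by simp
      qed
      have "(cmod (p x))\<^sup>2 \<le> K * (2 / e) * sin x" using 1 sx[of x] x e by (simp add: field_simps)
      also have "\<dots> \<le> K * (2 / e) * t"
        using sin_x_le_x[of t] t c e by (intro mult_left_mono) (auto simp: x_def K_def)
      finally have "(cmod (p x))\<^sup>2 \<le> K * (2 / e) * t" .
      then have "cmod (p x) \<le> sqrt (K * (2 / e) * t)" by (rule real_le_rsqrt)
      then have px: "cmod (p x) \<le> sqrt t * sqrt (K * (2 / e))" by (simp add: real_sqrt_mult[symmetric] mult.commute)
      have "integral {0..pi} q = p x + integral {x..pi} q"
        using inner[OF x(1,2)] comb[of 0 x pi] x by simp
      also have "cmod \<dots> \<le> sqrt t * sqrt (K * (2 / e)) + sqrt (pi - x) * sqn (lb 0 pi) q"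
        by (rule order.trans[OF norm_triangle_ineq add_mono])
           (use px norm_integral_sq_le[OF q, of x pi] x in auto)
      also have "\<dots> = sqrt t * (sqrt (K * (2 / e)) + sqn (lb 0 pi) q)"
        by (simp add: x_def algebra_simps)
      finally show "cmod (integral {0..pi} q) \<le> sqrt t * (sqrt (K * (2 / e)) + sqn (lb 0 pi) q)" .
    qed
    then show ?thesis by simp
  qed
  fix x :: real assume "0 \<le> x" "x \<le> pi"
  then consider "x = 0" | "x = pi" | "0 < x" "x < pi" by linarith
  then show "p x = integral {0..x} q"
    by cases (use inner outer p0 in auto)
qed

text \<open>Hardy's inequality comes from the same identity with the multiplier \<open>cot\<close>, whose derivative is \<open>- 1 / sin\<^sup>2\<close>.\<close>

lemma hardy:
  assumes q: "sq_int (lb 0 pi) q" and q0: "integral {0..pi} q = 0"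
  defines "P \<equiv> \<lambda>x. integral {0..x} q"
  defines "w \<equiv> \<lambda>x. P x / complex_of_real (sin x)"
  shows "sq_int (lb 0 pi) w" "sqn (lb 0 pi) w \<le> 4 * sqn (lb 0 pi) q"
proof -
  let ?S = "sqn (lb 0 pi) q"
  have comb: "integral {s..t} q + integral {t..u} q = integral {s..u} q" if "0 \<le> s" "s \<le> t" "t \<le> u" "u \<le> pi" for s t u
    by (rule Henstock_Kurzweil_Integration.integral_combine[OF that(2,3)]) (rule sq_int_integrable_on[OF q that(1,4)])
  have acP: "abs_cont_on {0..pi} P"
  proof (rule abs_cont_indefinite_integral[OF q])
    show "P y - P x = integral {x..y} q" if "0 \<le> x" "x \<le> y" "y \<le> pi" for x y
      using comb[of 0 x y] that by (simp add: P_def algebra_simps)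
  qed
  have dP: "AE x in lborel. x \<in> {0..pi} \<longrightarrow> (P has_vector_derivative q x) (at x)"
    unfolding P_def by (rule AE_indefinite_integral_deriv) (rule sq_int_integrable_on[OF q], auto)
  have sx: "sin x > 0" if "0 < x" "x < pi" for x using that by (rule sin_gt_zero)
  have cw: "continuous_on {0<..<pi} w"
    unfolding w_def using sx
    by (intro continuous_intros continuous_on_subset[OF abs_cont_on_continuous[OF acP]]) force+
  have bl: "1 / sin x * (cmod (P x))\<^sup>2 \<le> 2 * ?S\<^sup>2" if x: "0 < x" "x \<le> 1" for x
  proof -
    have "cmod (P x) \<le> sqrt (x - 0) * ?S" unfolding P_def
      by (rule norm_integral_sq_le[OF q]) (use x pi_gt3 in auto)
    then have "(cmod (P x))\<^sup>2 \<le> (sqrt x * ?S)\<^sup>2" by (intro power_mono) auto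
    also have "\<dots> = x * ?S\<^sup>2" using x by (simp add: power_mult_distrib)
    finally have "1 / sin x * (cmod (P x))\<^sup>2 \<le> 2 / x * (x * ?S\<^sup>2)"
      using half_le_sin[of x] x by (intro mult_mono) (auto simp: field_simps)
    then show ?thesis using x by simp
  qed
  \<comment> \<open>Since the total integral vanishes, \<open>P\<close> can be measured from pi and
    obeys near pi the same bound as near 0.\<close>
  have br: "1 / sin x * (cmod (P x))\<^sup>2 \<le> 2 * ?S\<^sup>2" if x: "pi - 1 \<le> x" "x < pi" for x
  proof -
    have "P x = - integral {x..pi} q"
      using comb[of 0 x pi] q0 x pi_gt3 by (simp add: P_def eq_neg_iff_add_eq_0)
    then have "cmod (P x) \<le> sqrt (pi - x) * ?S"
      using norm_integral_sq_le[OF q, of x pi] x pi_gt3 by simp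
    then have "(cmod (P x))\<^sup>2 \<le> (sqrt (pi - x) * ?S)\<^sup>2" by (intro power_mono) auto
    also have "\<dots> = (pi - x) * ?S\<^sup>2" using x by (simp add: power_mult_distrib)
    finally have "1 / sin x * (cmod (P x))\<^sup>2 \<le> 2 / (pi - x) * ((pi - x) * ?S\<^sup>2)"
      using half_le_sin_pi[of x] x by (intro mult_mono) (auto simp: field_simps)
    then show ?thesis using x by simp
  qed
  \<comment> \<open>Half the integral of \<open>|w|^2\<close> is at most \<open>2 + 2 + 2\<close>
    times \<open>?S^2\<close>: one share from \<open>q\<close> and one from each boundary term. This
    gives the 12, and \<open>12 <= 16\<close> gives the factor 4 of the norm estimate.\<close>
  have key: "integral {a..b} (\<lambda>x. (cmod (w x))\<^sup>2) \<le> 12 * ?S\<^sup>2" if a: "0 < a" "a \<le> 1" and b: "pi - 1 \<le> b" "b < pi" for a b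
  proof -
    have ab: "a \<le> b" using a b pi_gt3 by linarith
    have sab: "sin x > 0" if "x \<in> {a..b}" for x using that a b by (intro sx) auto
    have ac: "abs_cont_on {a..b} P" by (rule abs_cont_on_subset[OF acP]) (use a b in auto)
    have dp: "AE x in lborel. x \<in> {a..b} \<longrightarrow> (P has_vector_derivative q x) (at x)"
      using dP by eventually_elim (use a b in auto)
    have m: "((\<lambda>x. cos x / sin x) has_real_derivative - (1 / (sin x)\<^sup>2)) (at x)" if "x \<in> {a..b}" for x
    proof -
      have "((\<lambda>x. cos x / sin x) has_real_derivative (- sin x * sin x - cos x * cos x) / (sin x * sin x)) (at x)"
        using sab[OF that] by (auto intro!: derivative_eq_intros)
      moreover have "- sin x * sin x - cos x * cos x = - 1"
        using sin_cos_squared_add3[of x] by linarith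
      ultimately show ?thesis by (simp add: power2_eq_square)
    qed
    have cm: "continuous_on {a..b} (\<lambda>x. - (1 / (sin x)\<^sup>2))"
      using sab by (intro continuous_intros) force
    note en = energy_identity[OF ab ac dp m cm]
    let ?I = "integral {a..b} (\<lambda>x. (cmod (w x))\<^sup>2)"
    let ?Q = "integral {a..b} (\<lambda>x. (cmod (q x))\<^sup>2)"
    let ?g = "\<lambda>x. 2 * (cos x / sin x) * Re (q x * cnj (P x)) + - (1 / (sin x)\<^sup>2) * (cmod (P x))\<^sup>2"
    have pt: "?g x \<le> 2 * (cmod (q x))\<^sup>2 - 1 / 2 * (cmod (w x))\<^sup>2" if "x \<in> {a..b}" for x
    proof -
      have s: "sin x > 0" by (rule sab[OF that])
      have "2 * (cos x / sin x) * Re (q x * cnj (P x)) \<le> \<bar>2 * (cos x / sin x) * Re (q x * cnj (P x))\<bar>" by (rule abs_ge_self)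
      also have "\<dots> = 2 * (\<bar>cos x\<bar> * (\<bar>Re (q x * cnj (P x))\<bar> / sin x))" using s by (simp add: abs_mult)
      also have "\<dots> \<le> 2 * (1 * (cmod (q x * cnj (P x)) / sin x))"
        using s by (intro mult_left_mono mult_mono divide_right_mono abs_Re_le_cmod) auto
      also have "\<dots> = 2 * cmod (q x) * cmod (w x)" using s by (simp add: w_def norm_mult norm_divide)
      \<comment> \<open>Young's inequality with the weight chosen such that half of the
        \<open>- |w|^2\<close> coming from the derivative of the cotangent survives.\<close>
      also have "\<dots> \<le> 2 * (cmod (q x))\<^sup>2 + 1 / 2 * (cmod (w x))\<^sup>2"
        using quadratic_absorb[of "1/2" "cmod (q x)" "cmod (w x)"] quadratic_absorb[of 1 "2 * cmod (q x)" "cmod (w x)"]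
        by (simp add: power2_eq_square)
      finally show ?thesis using s by (simp add: w_def norm_divide power_divide)
    qed
    have iF: "integrable (lb a b) (\<lambda>x. (cmod (q x))\<^sup>2)"
      using sq_int_lb_mono[OF q, of a b] a b by (simp add: sq_int_def)
    have hF: "((\<lambda>x. (cmod (q x))\<^sup>2) has_integral ?Q) {a..b}"
      using has_integral_lb[OF iF] integral_lb[OF iF] by simp
    have hW: "((\<lambda>x. (cmod (w x))\<^sup>2) has_integral ?I) {a..b}"
      by (intro integrable_integral integrable_continuous_real continuous_intros continuous_on_subset[OF cw]) (use a b in auto)
    have "cos b / sin b * (cmod (P b))\<^sup>2 - cos a / sin a * (cmod (P a))\<^sup>2 \<le> 2 * ?Q - 1 / 2 * ?I"
    proof (rule has_integral_le[OF en has_integral_diff[OF has_integral_mult_right[OF hF] has_integral_mult_right[OF hW]]])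
      fix x assume "x \<in> {a..b}"
      then show "?g x \<le> 2 * (cmod (q x))\<^sup>2 - 1 / 2 * (cmod (w x))\<^sup>2" by (rule pt)
    qed
    moreover have "cos a / sin a * (cmod (P a))\<^sup>2 \<le> 2 * ?S\<^sup>2"
    proof (rule order.trans[OF mult_right_mono bl[OF a]])
      show "cos a / sin a \<le> 1 / sin a" using sab[of a] ab by (simp add: divide_right_mono)
    qed simp
    moreover have "- (cos b / sin b * (cmod (P b))\<^sup>2) \<le> 2 * ?S\<^sup>2"
    proof -
      have "- cos b \<le> 1" using cos_ge_minus_one[of b] by linarith
      then have "- cos b / sin b \<le> 1 / sin b" using sab[of b] ab by (intro divide_right_mono) auto
      then have "- cos b / sin b * (cmod (P b))\<^sup>2 \<le> 1 / sin b * (cmod (P b))\<^sup>2" by (rule mult_right_mono) simp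
      then show ?thesis using br[OF b] by simp
    qed
    moreover have "?Q \<le> ?S\<^sup>2"
      unfolding integral_lb[OF iF] sqn_power2 using q a b by (intro integral_lb_mono) (auto simp: sq_int_def)
    ultimately show ?thesis by linarith
  qed
  have all: "integral {a..b} (\<lambda>x. (cmod (w x))\<^sup>2) \<le> 12 * ?S\<^sup>2" if ab: "0 < a" "a \<le> b" "b < pi" for a b
  proof -
    have ci: "continuous_on {min a 1..max b (pi - 1)} (\<lambda>x. (cmod (w x))\<^sup>2)"
      by (intro continuous_intros continuous_on_subset[OF cw]) (use ab in auto)
    have "integral {a..b} (\<lambda>x. (cmod (w x))\<^sup>2) \<le> integral {min a 1..max b (pi - 1)} (\<lambda>x. (cmod (w x))\<^sup>2)"
      by (rule integral_subset_le)
         (auto intro!: integrable_continuous_real continuous_on_subset[OF ci] simp: ci)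
    also have "\<dots> \<le> 12 * ?S\<^sup>2" using ab by (intro key) auto
    finally show ?thesis .
  qed
  have w0: "w 0 = 0" "w pi = 0" by (simp_all add: w_def)
  show "sq_int (lb 0 pi) w" by (rule sq_int_from_inner(1)[OF cw w0 all])
  have "(sqn (lb 0 pi) w)\<^sup>2 \<le> 12 * ?S\<^sup>2" by (rule sq_int_from_inner(2)[OF cw w0 all])
  also have "\<dots> \<le> (4 * ?S)\<^sup>2" by (simp add: power_mult_distrib)
  finally show "sqn (lb 0 pi) w \<le> 4 * ?S" by (rule power2_le_imp_le) simp
qed


section \<open>Existence of the bounded solution on a half period\<close>

lemma AE_lborel_half_open:
  assumes "\<And>b. b < pi \<Longrightarrow> AE x in lborel. x \<in> {0..b} \<longrightarrow> P x"
  shows "AE x in lborel. x \<in> {0<..<pi::real} \<longrightarrow> P x"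
proof -
  have "AE x in lborel. \<forall>n::nat. x \<in> {0..pi - 1 / (real n + 1)} \<longrightarrow> P x"
    unfolding AE_all_countable by (intro allI assms) simp
  then show ?thesis
  proof eventually_elim
    case (elim x)
    show ?case
    proof
      assume x: "x \<in> {0<..<pi}"
      then obtain n :: nat where "inverse (real (Suc n)) < pi - x"
        using reals_Archimedean[of "pi - x"] by auto
      then have "x \<in> {0..pi - 1 / (real n + 1)}" using x by (simp add: inverse_eq_divide add.commute)
      then show "P x" using elim by blast
    qed
  qed
qed

text \<open>Variation of constants. The weight is unbounded near pi, so \<open>h\<close> is shown to
  be square integrable on each \<open>{0..b}\<close> with \<open>b < pi\<close>; the differential
  equation is obtained on each of these and collected by \<open>AE_lborel_half_open\<close>. Nothing
  has to be estimated at pi, because \<open>half_sol\<close> asks for nothing there.\<close>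

lemma half_sol_exists:
  assumes e: "0 < e" and f: "sq_int (lb 0 pi) f"
  obtains p where "half_sol e f p" "p 0 = 0" "p pi = 0"
proof -
  let ?S = "sqn (lb 0 pi) f"
  define h where "h = (\<lambda>x. complex_of_real (wt e x) * f x)"
  define I where "I = (\<lambda>x. integral {0..x} h)"
  define p where "p = (\<lambda>x. if x = pi then 0 else complex_of_real (1 / (e * wt e x)) * I x)"
  have wm: "(\<lambda>x. complex_of_real (wt e x)) \<in> borel_measurable M" if "sets M = sets borel" for M :: "real measure"
    unfolding wt_def tan_def using that by (subst measurable_cong_sets[OF that refl]) measurable
  have h: "sq_int (lb 0 b) h" if b: "0 \<le> b" "b < pi" for b
  proof (rule sq_int_bound[OF sq_int_lb_mono[OF f], where C="wt e b"])
    have "(\<lambda>x. complex_of_real (wt e x)) \<in> borel_measurable (lb 0 b)"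
      by (rule measurable_restrict_space1) (rule wm, simp)
    moreover have "f \<in> borel_measurable (lb 0 b)"
      using sq_int_lb_mono[OF f, of 0 b] b by (simp add: sq_int_def)
    ultimately show "h \<in> borel_measurable (lb 0 b)" unfolding h_def by (rule borel_measurable_times)
    have "wt e x \<le> wt e b" if "x \<in> {0..b}" for x using that b e by (intro wt_mono) auto
    then show "AE x in lb 0 b. cmod (h x) \<le> wt e b * cmod (f x)"
      unfolding AE_lb_iff h_def by (auto simp: norm_mult wt_nonneg intro!: mult_right_mono)
  qed (use b in auto)
  have comb: "I y - I x = integral {x..y} h" if "0 \<le> x" "x \<le> y" "y < pi" for x y
  proof -
    have "I x + integral {x..y} h = I y" unfolding I_def
      by (rule Henstock_Kurzweil_Integration.integral_combine[OF that(1,2)]) (rule sq_int_integrable_on[OF h], use that in auto)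
    then show ?thesis by (simp add: algebra_simps)
  qed
  have acI: "abs_cont_on {0..b} I" if "0 \<le> b" "b < pi" for b
    by (rule abs_cont_indefinite_integral[OF h[OF that]]) (use comb that in auto)
  have sx: "0 < sin x" if "0 < x" "x < pi" for x using that by (rule sin_gt_zero)
  have dw: "((\<lambda>x. 1 / (e * wt e x)) has_real_derivative - (1 / (e\<^sup>2 * wt e x * sin x))) (at x)" if x: "0 < x" "x < pi" for x
  proof -
    have "((\<lambda>x. 1 / (e * wt e x)) has_real_derivative - (e * (wt e x / (e * sin x))) / (e * wt e x * (e * wt e x))) (at x)"
      using e wt_pos[OF x, of e] by (auto intro!: derivative_eq_intros wt_has_derivative x)
    moreover have "- (e * (wt e x / (e * sin x))) / (e * wt e x * (e * wt e x)) = - (1 / (e\<^sup>2 * wt e x * sin x))"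
      using e wt_pos[OF x, of e] sx[OF x] by (simp add: field_simps power2_eq_square)
    ultimately show ?thesis by simp
  qed
  have "abs_cont_on {a..b} p" if ab: "0 < a" "b < pi" for a b
  proof (cases "a \<le> b")
    case True
    have nz: "\<forall>x\<in>{a..b}. e\<^sup>2 * wt e x * sin x \<noteq> 0"
    proof
      fix x assume "x \<in> {a..b}"
      then have "0 < x" "x < pi" using ab by auto
      then show "e\<^sup>2 * wt e x * sin x \<noteq> 0" using e wt_pos[of x e] sx[of x] by simp
    qed
    have "abs_cont_on {a..b} (\<lambda>x. complex_of_real (1 / (e * wt e x)))"
    proof (rule abs_cont_on_of_real)
      show "continuous_on {a..b} (\<lambda>x. - (1 / (e\<^sup>2 * wt e x * sin x)))"
        by (intro continuous_intros nz wt_continuous ab)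
    qed (use dw ab in auto)
    moreover have "abs_cont_on {a..b} I"
      by (rule abs_cont_on_subset[OF acI[of b]]) (use ab True in auto)
    ultimately have acp: "abs_cont_on {a..b} (\<lambda>x. complex_of_real (1 / (e * wt e x)) * I x)" by (rule abs_cont_on_mult)
    show ?thesis
    proof (rule abs_cont_on_bound[OF acp acp, of 1])
      fix x y assume "x \<le> y" "{x..y} \<subseteq> {a..b}"
      then have "x \<noteq> pi" "y \<noteq> pi" using ab by auto
      then show "cmod (p y - p x) \<le> 1 * (cmod (complex_of_real (1 / (e * wt e y)) * I y - complex_of_real (1 / (e * wt e x)) * I x)
        + cmod (complex_of_real (1 / (e * wt e y)) * I y - complex_of_real (1 / (e * wt e x)) * I x))"
        by (simp add: p_def)
    qed simp
  next
    case False
    then show ?thesis by (intro abs_cont_on_C1[where F'="\<lambda>_. 0"]) auto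
  qed
  moreover have "AE x in lborel. x \<in> {0<..<pi} \<longrightarrow>
      (p has_vector_derivative (f x - p x / complex_of_real (sin x)) / complex_of_real e) (at x)"
  proof -
    have "AE x in lborel. x \<in> {0<..<pi} \<longrightarrow> (I has_vector_derivative h x) (at x)"
    proof (rule AE_lborel_half_open)
      fix b :: real assume b: "b < pi"
      show "AE x in lborel. x \<in> {0..b} \<longrightarrow> (I has_vector_derivative h x) (at x)"
      proof (cases "0 \<le> b")
        case True
        show ?thesis unfolding I_def
          by (rule AE_indefinite_integral_deriv) (rule sq_int_integrable_on[OF h[OF True b]], auto)
      qed simp
    qed
    then show ?thesis
    proof eventually_elim
      case (elim x)
      show ?case
      proof
        assume "x \<in> {0<..<pi}"
        then have x: "0 < x" "x < pi" by auto
        have wx: "0 < wt e x" by (rule wt_pos[OF x])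
        let ?p = "\<lambda>x. complex_of_real (1 / (e * wt e x)) * I x"
        have px: "p x = ?p x" using x by (simp add: p_def)
        have "(?p has_vector_derivative
           (complex_of_real (1 / (e * wt e x)) * h x + complex_of_real (- (1 / (e\<^sup>2 * wt e x * sin x))) * I x)) (at x)"
          using elim x by (intro has_vector_derivative_mult has_vector_derivative_of_real dw) auto
        moreover have "complex_of_real (1 / (e * wt e x)) * h x + complex_of_real (- (1 / (e\<^sup>2 * wt e x * sin x))) * I x
            = (f x - p x / complex_of_real (sin x)) / complex_of_real e"
          unfolding px h_def using wx e sx[OF x] by (simp add: field_simps power2_eq_square)
        ultimately have "(?p has_vector_derivative (f x - p x / complex_of_real (sin x)) / complex_of_real e) (at x)"
          by simp
        then show "(p has_vector_derivative (f x - p x / complex_of_real (sin x)) / complex_of_real e) (at x)"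
          by (rule has_vector_derivative_transform_within_open[of _ _ _ "{0<..<pi}"]) (use x in \<open>auto simp: p_def\<close>)
      qed
    qed
  qed
  \<comment> \<open>The increasing weight is pulled out of the integral at its right endpoint
    \<open>x\<close> and cancels against \<open>1 / wt e x\<close>.\<close>
  moreover have "\<exists>B. \<forall>x\<in>{0<..<1}. cmod (p x) \<le> B"
  proof (intro exI[of _ "?S / e"] ballI)
    fix x :: real assume "x \<in> {0<..<1}"
    then have x: "0 < x" "x < 1" "x < pi" using pi_gt3 by auto
    have wx: "0 < wt e x" using x by (intro wt_pos) auto
    note fs = sq_int_lb_mono[OF f, of 0 x]
    have nf: "((\<lambda>y. wt e x * cmod (f y)) has_integral wt e x * (LINT y|lb 0 x. cmod (f y))) {0..x}"
      by (intro has_integral_mult_right has_integral_lb integrable_norm sq_int_lb_integrable fs) (use x in auto)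
    have "cmod (I x) \<le> integral {0..x} (\<lambda>y. wt e x * cmod (f y))"
      unfolding I_def
    proof (rule Henstock_Kurzweil_Integration.integral_norm_bound_integral)
      show "h integrable_on {0..x}" by (rule sq_int_integrable_on[OF h[of x]]) (use x in auto)
      show "(\<lambda>y. wt e x * cmod (f y)) integrable_on {0..x}" using nf by (rule has_integral_integrable)
      fix y assume "y \<in> {0..x}"
      then have "wt e y \<le> wt e x" using x e by (intro wt_mono) auto
      then show "cmod (h y) \<le> wt e x * cmod (f y)"
        by (simp add: h_def norm_mult wt_nonneg mult_right_mono)
    qed
    also have "\<dots> = wt e x * (LINT y|lb 0 x. cmod (f y))" by (rule integral_unique[OF nf])
    also have "\<dots> \<le> wt e x * ?S"
    proof (rule mult_left_mono)
      have "(LINT y|lb 0 x. cmod (f y)) \<le> sqrt (x - 0) * sqn (lb 0 x) f"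
        by (rule integral_cmod_lb_le[OF fs]) (use x in auto)
      also have "\<dots> \<le> 1 * ?S"
        using sqn_lb_mono[OF f, of 0 x] x by (intro mult_mono) auto
      finally show "(LINT y|lb 0 x. cmod (f y)) \<le> ?S" by simp
    qed (rule wt_nonneg)
    finally show "cmod (p x) \<le> ?S / e"
      using wx e x by (simp add: p_def norm_mult norm_divide field_simps)
  qed
  ultimately have "half_sol e f p" unfolding half_sol_def by blast
  moreover have "p 0 = 0" by (simp add: p_def I_def)
  moreover have "p pi = 0" by (simp add: p_def)
  ultimately show thesis by (rule that)
qed

subsection \<open>The operator as a first-order system\<close>

lemma indicator_reflect: "indicator {a..b} (t - x) = (indicator {t - b..t - a} x :: real)" for t :: real
  by (auto simp: indicator_def)

lemma integrable_lb_reflect: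
  fixes f :: "real \<Rightarrow> 'b::{banach, second_countable_topology}"
  assumes "integrable (lb a b) f"
  shows "integrable (lb (t - b) (t - a)) (\<lambda>x. f (t - x))"
proof -
  have "integrable lborel (\<lambda>x. indicator {a..b} x *\<^sub>R f x)"
    using assms by (simp add: integrable_restrict_space)
  from lborel_integrable_real_affine[OF this, of "-1" t]
  have "integrable lborel (\<lambda>x. indicator {a..b} (t - x) *\<^sub>R f (t - x))" by simp
  then show ?thesis unfolding indicator_reflect by (simp add: integrable_restrict_space)
qed

lemma integral_lb_reflect:
  fixes f :: "real \<Rightarrow> 'b::{banach, second_countable_topology}"
  shows "(LINT x|lb (t - b) (t - a). f (t - x)) = (LINT x|lb a b. f x)"
proof -
  have "(LINT x|lborel. indicator {a..b} x *\<^sub>R f x) = (LINT x|lborel. indicator {a..b} (t - x) *\<^sub>R f (t - x))"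
    using lborel_integral_real_affine[of "-1" "\<lambda>x. indicator {a..b} x *\<^sub>R f x" t] by simp
  then show ?thesis unfolding indicator_reflect by (simp add: integral_restrict_space)
qed

lemma measurable_lb_reflect:
  fixes f :: "real \<Rightarrow> complex"
  assumes "f \<in> borel_measurable (lb a b)"
  shows "(\<lambda>x. f (t - x)) \<in> borel_measurable (lb (t - b) (t - a))"
proof -
  have m: "(\<lambda>x. indicator {a..b} x *\<^sub>R f x) \<in> borel_measurable borel"
    using assms by (simp add: borel_measurable_restrict_space_iff)
  have "(\<lambda>x. t - x) \<in> borel_measurable (borel :: real measure)" by measurable
  from measurable_compose[OF this m]
  have "(\<lambda>x. indicator {a..b} (t - x) *\<^sub>R f (t - x)) \<in> borel_measurable borel" .
  then show ?thesis unfolding indicator_reflect by (simp add: borel_measurable_restrict_space_iff)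
qed

lemma sq_int_reflect: "sq_int (lb a b) f \<Longrightarrow> sq_int (lb (t - b) (t - a)) (\<lambda>x. f (t - x))"
  unfolding sq_int_def
  using measurable_lb_reflect[of f a b t] integrable_lb_reflect[of a b "\<lambda>x. (cmod (f x))\<^sup>2" t] by blast

lemma sqn_reflect: "sqn (lb (t - b) (t - a)) (\<lambda>x. f (t - x)) = sqn (lb a b) f"
  unfolding sqn_def using integral_lb_reflect[of t b a "\<lambda>x. (cmod (f x))\<^sup>2"] by simp

lemma AE_lborel_reflect: fixes t :: real assumes "AE x in lborel. P x" shows "AE x in lborel. P (t - x)"
proof -
  have "lborel = distr lborel borel (\<lambda>x. t - x)"
    by (subst lborel_distr_plus[of t, symmetric], subst (2) lborel_distr_uminus[symmetric], subst distr_distr)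
       (auto simp: o_def)
  from this[symmetric] assms have "AE x in distr lborel borel (\<lambda>x. t - x). P x" by (simp only:)
  then show ?thesis by (rule AE_distrD[rotated]) simp
qed

lemma measurable_lb_glue:
  fixes f :: "real \<Rightarrow> complex"
  assumes "f \<in> borel_measurable (lb a c)" "f \<in> borel_measurable (lb c b)" "a \<le> c" "c \<le> b"
  shows "f \<in> borel_measurable (lb a b)"
proof -
  have m: "(\<lambda>x. indicator {a..c} x *\<^sub>R f x) \<in> borel_measurable borel" "(\<lambda>x. indicator {c..b} x *\<^sub>R f x) \<in> borel_measurable borel"
    using assms by (simp_all add: borel_measurable_restrict_space_iff)
  have "(\<lambda>x. if x \<le> c then indicator {a..c} x *\<^sub>R f x else indicator {c..b} x *\<^sub>R f x) \<in> borel_measurable borel"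
    by (rule measurable_If[OF m]) simp
  also have "(\<lambda>x. if x \<le> c then indicator {a..c} x *\<^sub>R f x else indicator {c..b} x *\<^sub>R f x) = (\<lambda>x. indicator {a..b} x *\<^sub>R f x)"
    using assms(3,4) by (auto simp: indicator_def fun_eq_iff)
  finally show ?thesis by (simp add: borel_measurable_restrict_space_iff)
qed

lemma integrable_lb_glue:
  fixes f :: "real \<Rightarrow> 'b::{banach, second_countable_topology}"
  assumes "integrable (lb a c) f" "integrable (lb c b) f" "a \<le> c" "c \<le> b"
  shows "integrable (lb a b) f"
proof -
  have "{a..b} = {a..c} \<union> {c..b}" using assms by auto
  then show ?thesis using assms(1,2) unfolding integrable_lb_iff by (simp add: set_integrable_Un)
qed

lemma sq_int_glue:
  assumes "sq_int (lb a c) f" "sq_int (lb c b) f" "a \<le> c" "c \<le> b"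
  shows "sq_int (lb a b) f"
  using assms(1,2) measurable_lb_glue[OF _ _ assms(3,4), of f]
    integrable_lb_glue[OF _ _ assms(3,4), of "\<lambda>x. (cmod (f x))\<^sup>2"]
  unfolding sq_int_def by blast

lemma integral_lb_split:
  fixes f :: "real \<Rightarrow> 'b::euclidean_space"
  assumes "integrable (lb a b) f" "a \<le> c" "c \<le> b"
  shows "(LINT x|lb a b. f x) = (LINT x|lb a c. f x) + (LINT x|lb c b. f x)"
proof -
  have 1: "integrable (lb a c) f" "integrable (lb c b) f"
    by (rule integrable_lb_mono[OF assms(1)], use assms in simp_all)+
  have "integral {a..c} f + integral {c..b} f = integral {a..b} f"
    by (rule Henstock_Kurzweil_Integration.integral_combine[OF assms(2,3)])
       (use has_integral_lb[OF assms(1)] in blast)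
  then show ?thesis by (simp add: integral_lb assms(1) 1)
qed

lemma sqn_split:
  assumes "sq_int (lb a b) f" "a \<le> c" "c \<le> b"
  shows "(sqn (lb a b) f)\<^sup>2 = (sqn (lb a c) f)\<^sup>2 + (sqn (lb c b) f)\<^sup>2"
  unfolding sqn_power2 using assms by (intro integral_lb_split) (auto simp: sq_int_def)

lemma sq_int_cong:
  "sq_int (lb a b) f \<Longrightarrow> (\<And>x. x \<in> {a..b} \<Longrightarrow> g x = f x) \<Longrightarrow> sq_int (lb a b) g"
proof -
  assume f: "sq_int (lb a b) f" and eq: "\<And>x. x \<in> {a..b} \<Longrightarrow> g x = f x"
  have "g \<in> borel_measurable (lb a b)"
    by (rule measurable_cong[THEN iffD2, OF _ sq_int_meas[OF f]]) (simp add: eq space_restrict_space)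
  then show ?thesis by (rule sq_int_cong_AE[OF f]) (simp add: AE_lb_iff eq)
qed

lemma sqn_lb_cong: "(\<And>x. x \<in> {a..b} \<Longrightarrow> g x = f x) \<Longrightarrow> sqn (lb a b) g = sqn (lb a b) f"
  unfolding sqn_def by (intro arg_cong[where f=sqrt] Bochner_Integration.integral_cong) (auto simp: space_restrict_space)

lemma AE_lb_not_eq: "AE x in lb a b. x \<noteq> c"
  unfolding AE_lb_iff by (rule AE_mp[OF AE_lborel_singleton[of c]]) simp

text \<open>Measurability is meant in the Borel sense, so agreement almost everywhere would not
  carry it over from \<open>f\<close> to \<open>g\<close>; agreement off a finite set does. This
  repairs conflicting values at points such as 0, where half periods are glued.\<close>

lemma sq_int_spike:
  assumes f: "sq_int (lb a b) f" and fin: "finite S" and eq: "\<And>x. x \<in> {a..b} \<Longrightarrow> x \<notin> S \<Longrightarrow> g x = f x"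
  shows "sq_int (lb a b) g"
proof (rule sq_int_cong_AE[OF f])
  have fS: "finite S" by (rule fin)
  have m: "(\<lambda>x. indicator {a..b} x *\<^sub>R f x) \<in> borel_measurable borel"
    using sq_int_meas[OF f] by (simp add: borel_measurable_restrict_space_iff)
  have "(\<lambda>x. if x \<in> S then indicator {a..b} x *\<^sub>R g x else indicator {a..b} x *\<^sub>R f x) \<in> borel_measurable borel"
    using fS
  proof (induction S)
    case empty
    then show ?case using m by simp
  next
    case (insert s S)
    have "(\<lambda>x. if x = s then indicator {a..b} s *\<^sub>R g s else (if x \<in> S then indicator {a..b} x *\<^sub>R g x else indicator {a..b} x *\<^sub>R f x)) \<in> borel_measurable borel"
      by (rule measurable_If[OF _ insert.IH]) auto
    also have "(\<lambda>x. if x = s then indicator {a..b} s *\<^sub>R g s else (if x \<in> S then indicator {a..b} x *\<^sub>R g x else indicator {a..b} x *\<^sub>R f x))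
      = (\<lambda>x. if x \<in> insert s S then indicator {a..b} x *\<^sub>R g x else indicator {a..b} x *\<^sub>R f x)" by auto
    finally show ?case .
  qed
  also have "(\<lambda>x. if x \<in> S then indicator {a..b} x *\<^sub>R g x else indicator {a..b} x *\<^sub>R f x) = (\<lambda>x. indicator {a..b} x *\<^sub>R g x)"
    using eq by (auto simp: indicator_def fun_eq_iff)
  finally show "g \<in> borel_measurable (lb a b)" by (simp add: borel_measurable_restrict_space_iff)
  have "AE x in lborel. x \<notin> S"
    using fS by (intro AE_not_in) (simp add: finite_imp_null_set_lborel)
  then show "AE x in lb a b. g x = f x"
    unfolding AE_lb_iff by eventually_elim (use eq in auto)
qed

lemma integral_add_adjacent:
  assumes "sq_int (lb a b) q" "a \<le> x" "x \<le> y" "y \<le> z" "z \<le> b"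
  shows "integral {x..y} q + integral {y..z} q = integral {x..z} q"
  by (rule Henstock_Kurzweil_Integration.integral_combine[OF assms(3,4)])
     (rule sq_int_integrable_on[OF assms(1,2,5)])

lemma integral_reflect_interval:
  fixes f :: "real \<Rightarrow> complex"
  shows "integral {a..b} (\<lambda>x. f (- x)) = integral {- b..- a} f"
  using Henstock_Kurzweil_Integration.integral_reflect_real[where f=f and a="-b" and b="-a"] by simp

lemma sin_neq_0_AE: "AE x in lb (-pi) pi. sin x \<noteq> 0"
  using AE_lb_not_eq[of 0 "-pi" pi] AE_lb_not_eq[of pi "-pi" pi] AE_lb_not_eq[of "-pi" "-pi" pi]
  unfolding AE_lb_iff
proof eventually_elim
  case (elim x)
  show ?case
  proof
    assume x: "x \<in> {-pi..pi}"
    show "sin x \<noteq> 0"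
    proof (cases "0 < x")
      case True
      moreover have "x < pi" using x elim by force
      ultimately show ?thesis using sin_gt_zero[of x] by simp
    next
      case False
      have "x \<noteq> 0 \<and> x \<noteq> - pi" using x elim by blast
      then have "0 < - x" "- x < pi" using False x by auto
      then show ?thesis using sin_gt_zero[of "- x"] by simp
    qed
  qed
qed

text \<open>Hardy's inequality is used on each half period separately, on the left one after the
  reflection \<open>x -> - x\<close>; squared norms add, so the constant stays 4. The equation for
  \<open>sin * w\<close> determines \<open>w\<close> away from the zeros of \<open>sin\<close>,
  which form a null set in the interval.\<close>

lemma hardy_full:
  assumes q: "sq_int (lb (-pi) pi) q" and q0: "integral {-pi..0} q = 0" "integral {0..pi} q = 0"
    and w: "w \<in> borel_measurable (lb (-pi) pi)"
      "AE x in lb (-pi) pi. complex_of_real (sin x) * w x = integral {-pi..x} q"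
  shows "sq_int (lb (-pi) pi) w" "sqn (lb (-pi) pi) w \<le> 4 * sqn (lb (-pi) pi) q"
proof -
  define W where "W = (\<lambda>x. integral {-pi..x} q / complex_of_real (sin x))"
  have qR: "sq_int (lb 0 pi) q" and qL: "sq_int (lb (-pi) 0) q"
    using sq_int_lb_mono[OF q, of 0 pi] sq_int_lb_mono[OF q, of "-pi" 0] by simp_all
  have qL': "sq_int (lb 0 pi) (\<lambda>x. q (- x))" using sq_int_reflect[OF qL, of 0] by simp
  have q0': "integral {0..pi} (\<lambda>x. q (- x)) = 0" using q0(1) by (simp add: integral_reflect_interval)
  have WR: "W x = integral {0..x} q / complex_of_real (sin x)" if "x \<in> {0..pi}" for x
    using integral_add_adjacent[OF q, of "-pi" 0 x] q0(1) that by (simp add: W_def)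
  have WL: "W (- x) = integral {0..x} (\<lambda>x. q (- x)) / complex_of_real (sin x)" if "x \<in> {0..pi}" for x
  proof -
    have "integral {-pi..-x} q = - integral {-x..0} q"
      using integral_add_adjacent[OF q, of "-pi" "-x" 0] q0(1) that by (simp add: eq_neg_iff_add_eq_0)
    then show ?thesis using integral_reflect_interval[of 0 x q] by (simp add: W_def)
  qed
  have R: "sq_int (lb 0 pi) W" "sqn (lb 0 pi) W \<le> 4 * sqn (lb 0 pi) q"
    using sq_int_cong[OF hardy(1)[OF qR q0(2)] WR] hardy(2)[OF qR q0(2)] sqn_lb_cong[OF WR] by simp_all
  have L': "sq_int (lb 0 pi) (\<lambda>x. W (- x))" "sqn (lb 0 pi) (\<lambda>x. W (- x)) \<le> 4 * sqn (lb 0 pi) (\<lambda>x. q (- x))"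
    using sq_int_cong[OF hardy(1)[OF qL' q0'] WL] hardy(2)[OF qL' q0'] sqn_lb_cong[OF WL] by simp_all
  have L: "sq_int (lb (-pi) 0) W" "sqn (lb (-pi) 0) W \<le> 4 * sqn (lb (-pi) 0) q"
    using sq_int_reflect[OF L'(1), of 0] L'(2) sqn_reflect[of 0 pi 0 "\<lambda>x. W (- x)"] sqn_reflect[of 0 pi 0 "\<lambda>x. q (- x)"]
    by simp_all
  have W: "sq_int (lb (-pi) pi) W" by (rule sq_int_glue[OF L(1) R(1)]) auto
  have "(sqn (lb (-pi) pi) W)\<^sup>2 = (sqn (lb (-pi) 0) W)\<^sup>2 + (sqn (lb 0 pi) W)\<^sup>2"
    by (rule sqn_split[OF W]) auto
  also have "\<dots> \<le> (4 * sqn (lb (-pi) 0) q)\<^sup>2 + (4 * sqn (lb 0 pi) q)\<^sup>2"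
    by (intro add_mono power_mono L R) auto
  also have "\<dots> = (4 * sqn (lb (-pi) pi) q)\<^sup>2"
    using sqn_split[OF q, of 0] by (simp add: power_mult_distrib)
  finally have WN: "sqn (lb (-pi) pi) W \<le> 4 * sqn (lb (-pi) pi) q" by (rule power2_le_imp_le) simp
  have ae: "AE x in lb (-pi) pi. w x = W x"
    using w(2) sin_neq_0_AE by eventually_elim (simp add: W_def field_simps)
  show "sq_int (lb (-pi) pi) w" by (rule sq_int_cong_AE[OF W w(1) ae])
  show "sqn (lb (-pi) pi) w \<le> 4 * sqn (lb (-pi) pi) q"
    using WN sqn_cong_AE[OF w(1) sq_int_meas[OF W] ae] by simp
qed

text \<open>The pair \<open>(q, w)\<close> encodes a domain element \<open>y\<close> through \<open>w = y'\<close> and \<open>q = (sin * y')'\<close>; the two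
  vanishing integrals say that \<open>sin * y'\<close> is zero at \<open>- pi\<close>, \<open>0\<close> and \<open>pi\<close>.\<close>

definition profile :: "(real \<Rightarrow> complex) \<Rightarrow> (real \<Rightarrow> complex) \<Rightarrow> bool" where
  "profile q w \<longleftrightarrow> sq_int (lb (-pi) pi) q \<and> sq_int (lb (-pi) pi) w \<and>
     integral {-pi..0} q = 0 \<and> integral {0..pi} q = 0 \<and>
     (AE x in lb (-pi) pi. complex_of_real (sin x) * w x = integral {-pi..x} q)"

text \<open>If \<open>p\<close> solves the equation on the left half period, then
  \<open>r x = p (- x)\<close> solves it on the right one with datum \<open>- f (- x)\<close>,
  because reflection reverses both the derivative and \<open>sin\<close>. For the same reason
  \<open>w\<close> and \<open>q\<close> are glued with a minus sign on the left.\<close>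

lemma profile_from_halves:
  assumes e: "0 < e" "e < 2" and f: "sq_int (lb (-pi) pi) f"
    and p: "half_sol e f p" "p 0 = 0" "p pi = 0"
    and r: "half_sol e (\<lambda>x. - f (- x)) r" "r 0 = 0" "r pi = 0"
  obtains q w where "profile q w" "\<And>x. f x = complex_of_real e * q x + w x"
    "\<And>x. 0 < x \<Longrightarrow> w x = p x / complex_of_real (sin x)"
    "\<And>x. x < 0 \<Longrightarrow> w x = r (- x) / complex_of_real (sin x)"
proof -
  have fR: "sq_int (lb 0 pi) f" and fL: "sq_int (lb (-pi) 0) f"
    using sq_int_lb_mono[OF f, of 0 pi] sq_int_lb_mono[OF f, of "-pi" 0] by simp_all
  have fL': "sq_int (lb 0 pi) (\<lambda>x. - f (- x))" using sq_int_uminus[OF sq_int_reflect[OF fL, of 0]] by simp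
  define w1 where "w1 = (\<lambda>x. p x / complex_of_real (sin x))"
  define q1 where "q1 = (\<lambda>x. (f x - p x / complex_of_real (sin x)) / complex_of_real e)"
  define w2 where "w2 = (\<lambda>x. r x / complex_of_real (sin x))"
  define q2 where "q2 = (\<lambda>x. (- f (- x) - r x / complex_of_real (sin x)) / complex_of_real e)"
  have R: "sq_int (lb 0 pi) w1" "sq_int (lb 0 pi) q1" "\<And>x. 0 \<le> x \<Longrightarrow> x \<le> pi \<Longrightarrow> p x = integral {0..x} q1"
    unfolding w1_def q1_def by (rule half_sol_regular[OF e p(1) fR p(2,3)], assumption?)+
  have L: "sq_int (lb 0 pi) w2" "sq_int (lb 0 pi) q2" "\<And>x. 0 \<le> x \<Longrightarrow> x \<le> pi \<Longrightarrow> r x = integral {0..x} q2"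
    unfolding w2_def q2_def by (rule half_sol_regular[OF e r(1) fL' r(2,3)], assumption?)+
  define w where "w = (\<lambda>x. if 0 \<le> x then w1 x else - w2 (- x))"
  define q where "q = (\<lambda>x. if 0 \<le> x then q1 x else - q2 (- x))"
  have sR: "sq_int (lb 0 pi) w" "sq_int (lb 0 pi) q"
    by (rule sq_int_cong[OF R(1)], simp add: w_def,
        rule sq_int_cong[OF R(2)], simp add: q_def)
  have m: "sq_int (lb (-pi) 0) (\<lambda>x. - w2 (- x))" "sq_int (lb (-pi) 0) (\<lambda>x. - q2 (- x))"
    using sq_int_uminus[OF sq_int_reflect[OF L(1), of 0]] sq_int_uminus[OF sq_int_reflect[OF L(2), of 0]] by simp_all
  have sL: "sq_int (lb (-pi) 0) w" "sq_int (lb (-pi) 0) q"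
    by (rule sq_int_spike[OF m(1), of "{0}"], simp, simp add: w_def,
        rule sq_int_spike[OF m(2), of "{0}"], simp, simp add: q_def)
  have s: "sq_int (lb (-pi) pi) w" "sq_int (lb (-pi) pi) q"
    by (rule sq_int_glue[OF sL(1) sR(1)], simp_all, rule sq_int_glue[OF sL(2) sR(2)], simp_all)
  have iL: "integral {a..b} q = - integral {-b..-a} q2" if "b \<le> 0" for a b
  proof -
    have "integral {a..b} q = integral {a..b} (\<lambda>x. - q2 (- x))"
      by (rule integral_spike[of "{0}"]) (use that in \<open>auto simp: q_def\<close>)
    then show ?thesis by (simp add: integral_reflect_interval)
  qed
  have iR: "integral {0..b} q = integral {0..b} q1" for b
    by (rule integral_cong) (simp add: q_def)
  have 0: "integral {-pi..0} q = 0" "integral {0..pi} q = 0"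
    using iL[of 0 "-pi"] iR[of pi] R(3)[of pi] L(3)[of pi] p r by simp_all
  have sw: "complex_of_real (sin x) * w x = integral {-pi..x} q" if x: "x \<in> {-pi..pi}" "sin x \<noteq> 0" for x
  proof (cases "0 \<le> x")
    case True
    have "integral {-pi..x} q = integral {0..x} q"
      using integral_add_adjacent[OF s(2), of "-pi" 0 x] True x 0 by simp
    also have "\<dots> = p x" using iR[of x] R(3)[of x] True x by simp
    finally show ?thesis using True x by (simp add: w_def w1_def)
  next
    case False
    have "integral {-pi..x} q = - integral {-x..pi} q2" using iL[of x "-pi"] False by simp
    also have "\<dots> = integral {0..-x} q2"
      using integral_add_adjacent[OF L(2), of 0 "-x" pi] False x L(3)[of pi] r by (simp add: add_eq_0_iff)
    also have "\<dots> = r (- x)" using L(3)[of "-x"] False x by simp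
    finally show ?thesis using False x by (simp add: w_def w2_def)
  qed
  have "AE x in lb (-pi) pi. complex_of_real (sin x) * w x = integral {-pi..x} q"
    using sin_neq_0_AE unfolding AE_lb_iff by eventually_elim (use sw in blast)
  then have "profile q w" using s 0 unfolding profile_def by blast
  moreover have "f x = complex_of_real e * q x + w x" for x
    using e by (simp add: q_def w_def q1_def q2_def w1_def w2_def field_simps)
  moreover have "w x = p x / complex_of_real (sin x)" if "0 < x" for x
    using that by (simp add: w_def w1_def)
  moreover have "w x = r (- x) / complex_of_real (sin x)" if "x < 0" for x
    using that by (simp add: w_def w2_def)
  ultimately show thesis by (rule that)
qed

text \<open>The indefinite integrals of \<open>w\<close> and \<open>q\<close> serve as
  \<open>u\<close> and \<open>p\<close>; vanishing of the integral of \<open>w\<close> is the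
  periodicity of \<open>u\<close>.\<close>

lemma Lgraph_from_profile:
  assumes qw: "profile q w" and w0: "integral {-pi..pi} w = 0"
    and L2: "L2 y" "L2 f"
    and ae: "AE x in lb (-pi) pi. y x = c + integral {-pi..x} w"
      "AE x in lb (-pi) pi. f x = complex_of_real e * q x + w x"
  shows "(y, f) \<in> Lgraph e"
proof -
  have q: "sq_int (lb (-pi) pi) q" and w: "sq_int (lb (-pi) pi) w"
    and sw: "AE x in lb (-pi) pi. complex_of_real (sin x) * w x = integral {-pi..x} q"
    using qw by (simp_all add: profile_def)
  let ?u = "\<lambda>x. c + integral {-pi..x} w" and ?p = "\<lambda>x. integral {-pi..x} q"
  have u: "abs_cont_on {-pi..pi} ?u"
  proof (rule abs_cont_indefinite_integral[OF w])
    show "?u y - ?u x = integral {x..y} w" if "-pi \<le> x" "x \<le> y" "y \<le> pi" for x y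
      using integral_add_adjacent[OF w, of "-pi" x y] that by (simp add: algebra_simps)
  qed
  have "abs_cont_on {-pi..pi} ?p"
  proof (rule abs_cont_indefinite_integral[OF q])
    show "?p y - ?p x = integral {x..y} q" if "-pi \<le> x" "x \<le> y" "y \<le> pi" for x y
      using integral_add_adjacent[OF q, of "-pi" x y] that by (simp add: algebra_simps)
  qed
  then have p: "loc_abs_cont ?p" unfolding loc_abs_cont_def
    by (intro allI impI) (erule abs_cont_on_subset, auto)
  have du: "AE x in lborel. x \<in> {-pi..pi} \<longrightarrow> ((\<lambda>x. integral {-pi..x} w) has_vector_derivative w x) (at x)"
    by (rule AE_indefinite_integral_deriv) (rule sq_int_integrable_on[OF w], auto)
  have dp: "AE x in lborel. x \<in> {-pi..pi} \<longrightarrow> (?p has_vector_derivative q x) (at x)"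
    by (rule AE_indefinite_integral_deriv) (rule sq_int_integrable_on[OF q], auto)
  have all: "AE x in lborel. x \<in> {-pi..pi} \<longrightarrow>
            y x = ?u x \<and> (?u has_vector_derivative w x) (at x) \<and>
            ?p x = complex_of_real (sin x) * w x \<and>
            (?p has_vector_derivative q x) (at x) \<and>
            f x = complex_of_real e * q x + w x"
    using du dp sw[unfolded AE_lb_iff] ae[unfolded AE_lb_iff]
  proof eventually_elim
    case (elim x)
    show ?case
    proof (intro impI conjI)
      assume x: "x \<in> {-pi..pi}"
      have "((\<lambda>x. c + integral {-pi..x} w) has_vector_derivative 0 + w x) (at x)"
        using elim x by (intro has_vector_derivative_add has_vector_derivative_const) auto
      then show "(?u has_vector_derivative w x) (at x)" by simp
    qed (use elim in auto)
  qed
  have "?u (-pi) = ?u pi" using w0 by simp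
  then show ?thesis unfolding Lgraph_def using L2 u p all by blast
qed

lemma abs_cont_on_cong:
  assumes "abs_cont_on {a..b} F" "\<And>x. x \<in> {a..b} \<Longrightarrow> G x = F x" shows "abs_cont_on {a..b} G"
proof (rule abs_cont_on_bound[OF assms(1) assms(1), of 1])
  fix x y :: real assume "x \<le> y" "{x..y} \<subseteq> {a..b}"
  then have "x \<in> {a..b}" "y \<in> {a..b}" by auto
  then show "cmod (G y - G x) \<le> 1 * (cmod (F y - F x) + cmod (F y - F x))" by (simp add: assms(2))
qed simp

lemma abs_cont_on_reflect:
  assumes "abs_cont_on {a..b} F" shows "abs_cont_on {-b..-a} (\<lambda>x. F (- x))"
  unfolding abs_cont_on_iff
proof (intro allI impI)
  fix e :: real assume "0 < e"
  then obtain d where d: "0 < d" "\<And>n u v. interval_family {a..b} d n u v \<Longrightarrow> (\<Sum>k<n. cmod (F (v k) - F (u k))) < e"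
    using assms unfolding abs_cont_on_iff by blast
  have "(\<Sum>k<n. cmod (F (- v k) - F (- u k))) < e" if "interval_family {-b..-a} d n u v" for n u v
  proof -
    have "interval_family {a..b} d n (\<lambda>k. - v k) (\<lambda>k. - u k)"
      unfolding interval_family_def
    proof (intro conjI allI impI)
      fix k assume "k < n"
      then have k: "u k \<le> v k" "{u k..v k} \<subseteq> {-b..-a}" using that by (auto simp: interval_family_def)
      then show "- v k \<le> - u k" by simp
      show "{- v k..- u k} \<subseteq> {a..b}" using k by (auto simp: atLeastatMost_subset_iff)
    next
      have D: "disjoint_family_on (\<lambda>k. {u k<..<v k}) {..<n}" using that by (simp add: interval_family_def)
      have eq: "{- v k<..<- u k} = uminus ` {u k<..<v k}" for k by simp
      show "disjoint_family_on (\<lambda>k. {- v k<..<- u k}) {..<n}"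
        unfolding eq disjoint_family_on_def
      proof (intro ballI impI)
        fix i j assume "i \<in> {..<n}" "j \<in> {..<n}" "i \<noteq> j"
        then have "{u i<..<v i} \<inter> {u j<..<v j} = {}" using D by (simp add: disjoint_family_on_def)
        then show "uminus ` {u i<..<v i} \<inter> uminus ` {u j<..<v j} = {}"
          by (subst image_Int[symmetric]) auto
      qed
    next
      show "(\<Sum>k<n. - u k - - v k) < d" using that by (simp add: interval_family_def)
    qed
    from d(2)[OF this] show ?thesis by (simp add: norm_minus_commute)
  qed
  then show "\<exists>d>0. \<forall>n u v. interval_family {-b..-a} d n u v \<longrightarrow> (\<Sum>k<n. cmod (F (- v k) - F (- u k))) < e"
    using d(1) by blast
qed

lemma has_vector_derivative_reflect:
  assumes "(F has_vector_derivative D) (at (- x))"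
  shows "((\<lambda>x. F (- x)) has_vector_derivative - D) (at x)"
proof -
  have "(uminus has_vector_derivative - 1) (at (x::real))"
    by (auto intro!: derivative_eq_intros)
  from vector_diff_chain_at[OF this, of F D] assms show ?thesis by (simp add: o_def)
qed

text \<open>\<open>Lgraph\<close> grants \<open>p\<close> local absolute continuity inside
  \<open>{-pi<..<pi}\<close> only. Since 0 is an interior point, this bounds \<open>p\<close> near
  0, which is the boundary information that \<open>half_sol\<close> requires on either half;
  vanishing at the zeros of \<open>sin\<close> and square integrability follow from there.\<close>

lemma Lgraph_profile:
  assumes e: "0 < e" "e < 2" and yf: "(y, f) \<in> Lgraph e"
  obtains c q w where "profile q w" "integral {-pi..pi} w = 0"
    "AE x in lb (-pi) pi. y x = c + integral {-pi..x} w"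
    "\<And>x. f x = complex_of_real e * q x + w x"
proof -
  obtain u u' p p' where L2: "L2 y" "L2 f"
    and u: "abs_cont_on {-pi..pi} u" "u (-pi) = u pi" and p: "loc_abs_cont p"
    and ae: "AE x in lborel. x \<in> {-pi..pi} \<longrightarrow>
            y x = u x \<and> (u has_vector_derivative u' x) (at x) \<and>
            p x = complex_of_real (sin x) * u' x \<and>
            (p has_vector_derivative p' x) (at x) \<and>
            f x = complex_of_real e * p' x + u' x"
    using yf unfolding Lgraph_def by blast
  have f: "sq_int (lb (-pi) pi) f" using L2 by (simp add: L2_iff_sq_int)
  \<comment> \<open>The value 0 outside the open half period provides the endpoint values that
    \<open>half_sol_regular\<close> expects and leaves the equation inside untouched.\<close>
  define p1 where "p1 = (\<lambda>x. if x \<in> {0<..<pi} then p x else 0)"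
  define p2 where "p2 = (\<lambda>x. if x \<in> {0<..<pi} then p (- x) else 0)"
  have pac: "abs_cont_on {a..b} p" if "-pi < a" "b < pi" for a b
    using p that by (simp add: loc_abs_cont_def)
  obtain B where B: "\<And>x. x \<in> {-1..1} \<Longrightarrow> cmod (p x) \<le> B"
    using continuous_on_cbound[OF abs_cont_on_continuous[OF pac[of "-1" 1]]] pi_gt3 by auto
  have h1: "half_sol e f p1"
    unfolding half_sol_def
  proof (intro conjI allI impI)
    show "abs_cont_on {a..b} p1" if "0 < a" "b < pi" for a b
      by (rule abs_cont_on_cong[OF pac[of a b]]) (use that pi_gt3 in \<open>auto simp: p1_def\<close>)
    show "AE x in lborel. x \<in> {0<..<pi} \<longrightarrow>
        (p1 has_vector_derivative (f x - p1 x / complex_of_real (sin x)) / complex_of_real e) (at x)"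
      using ae
    proof eventually_elim
      case (elim x)
      show ?case
      proof
        assume x: "x \<in> {0<..<pi}"
        have s: "sin x > 0" using x by (intro sin_gt_zero) auto
        have E: "p x = complex_of_real (sin x) * u' x" "(p has_vector_derivative p' x) (at x)"
          "f x = complex_of_real e * p' x + u' x" using elim x by auto
        have "(p1 has_vector_derivative p' x) (at x)"
          by (rule has_vector_derivative_transform_within_open[OF E(2), of "{0<..<pi}"]) (use x in \<open>auto simp: p1_def\<close>)
        moreover have "p' x = (f x - p1 x / complex_of_real (sin x)) / complex_of_real e"
          using E s x e by (simp add: p1_def)
        ultimately show "(p1 has_vector_derivative (f x - p1 x / complex_of_real (sin x)) / complex_of_real e) (at x)"
          by simp
      qed
    qed
    have "cmod (p1 x) \<le> B" if "x \<in> {0<..<1}" for x using B[of x] that pi_gt3 by (simp add: p1_def)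
    then show "\<exists>B. \<forall>x\<in>{0<..<1}. cmod (p1 x) \<le> B" by blast
  qed
  have h2: "half_sol e (\<lambda>x. - f (- x)) p2"
    unfolding half_sol_def
  proof (intro conjI allI impI)
    show "abs_cont_on {a..b} p2" if ab: "0 < a" "b < pi" for a b
    proof (rule abs_cont_on_cong)
      show "abs_cont_on {a..b} (\<lambda>x. p (- x))"
        using abs_cont_on_reflect[OF pac[of "-b" "-a"]] ab pi_gt3 by simp
    qed (use ab in \<open>auto simp: p2_def\<close>)
    show "AE x in lborel. x \<in> {0<..<pi} \<longrightarrow>
        (p2 has_vector_derivative (- f (- x) - p2 x / complex_of_real (sin x)) / complex_of_real e) (at x)"
      using AE_lborel_reflect[OF ae, of 0]
    proof eventually_elim
      case (elim x)
      show ?case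
      proof
        assume x: "x \<in> {0<..<pi}"
        have s: "sin x > 0" using x by (intro sin_gt_zero) auto
        have E: "p (- x) = complex_of_real (sin (- x)) * u' (- x)" "(p has_vector_derivative p' (- x)) (at (- x))"
          "f (- x) = complex_of_real e * p' (- x) + u' (- x)" using elim x by auto
        have "(p2 has_vector_derivative - p' (- x)) (at x)"
          by (rule has_vector_derivative_transform_within_open[OF has_vector_derivative_reflect[OF E(2)], of "{0<..<pi}"])
             (use x in \<open>auto simp: p2_def\<close>)
        moreover have "- p' (- x) = (- f (- x) - p2 x / complex_of_real (sin x)) / complex_of_real e"
          using E s x e by (simp add: p2_def field_simps)
        ultimately show "(p2 has_vector_derivative (- f (- x) - p2 x / complex_of_real (sin x)) / complex_of_real e) (at x)"
          by simp
      qed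
    qed
    have "cmod (p2 x) \<le> B" if "x \<in> {0<..<1}" for x using B[of "-x"] that pi_gt3 by (simp add: p2_def)
    then show "\<exists>B. \<forall>x\<in>{0<..<1}. cmod (p2 x) \<le> B" by blast
  qed
  have b: "p1 0 = 0" "p1 pi = 0" "p2 0 = 0" "p2 pi = 0" by (simp_all add: p1_def p2_def)
  obtain q w where qw: "profile q w" and fq: "\<And>x. f x = complex_of_real e * q x + w x"
    and wp: "\<And>x. 0 < x \<Longrightarrow> w x = p1 x / complex_of_real (sin x)"
    and wn: "\<And>x. x < 0 \<Longrightarrow> w x = p2 (- x) / complex_of_real (sin x)"
    by (rule profile_from_halves[OF e f h1 b(1,2) h2 b(3,4)]) (rule that)
  have du: "AE x in lborel. x \<in> {-pi..pi} \<longrightarrow> (u has_vector_derivative w x) (at x)"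
    using ae sin_neq_0_AE[unfolded AE_lb_iff]
  proof eventually_elim
    case (elim x)
    show ?case
    proof
      assume x: "x \<in> {-pi..pi}"
      then have s: "sin x \<noteq> 0" and d: "(u has_vector_derivative u' x) (at x)" and px: "p x = complex_of_real (sin x) * u' x"
        using elim by auto
      have "x \<noteq> 0" "x \<noteq> pi" "x \<noteq> -pi" using s by auto
      then have "w x = p x / complex_of_real (sin x)"
        using x wp[of x] wn[of x] by (cases "0 < x") (auto simp: p1_def p2_def)
      then show "(u has_vector_derivative w x) (at x)" using d px s by simp
    qed
  qed
  have iu: "integral {-pi..x} w = u x - u (-pi)" if x: "x \<in> {-pi..pi}" for x
  proof -
    have "AE t in lborel. t \<in> {-pi..x} \<longrightarrow> (u has_vector_derivative w t) (at t)"
      using du by eventually_elim (use x in auto)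
    then have "(w has_integral u x - u (-pi)) {-pi..x}"
      using x by (intro abs_cont_has_integral abs_cont_on_subset[OF u(1)]) auto
    then show ?thesis by (rule integral_unique)
  qed
  show thesis
  proof (rule that[OF qw _ _ fq])
    show "integral {-pi..pi} w = 0" using iu[of pi] u(2) by simp
    show "AE x in lb (-pi) pi. y x = u (-pi) + integral {-pi..x} w"
      unfolding AE_lb_iff using ae by eventually_elim (use iu in auto)
  qed
qed

text \<open>\<open>q\<close> has integral 0, so integrating \<open>f = e * q + w\<close> shows that
  \<open>f\<close> and \<open>w\<close> have the same integral. Mean zero of \<open>f\<close> is
  thus exactly the periodicity of the antiderivative of \<open>w\<close>.\<close>

lemma Lgraph_solve:
  assumes e: "0 < e" "e < 2" and f: "L2 f" and f0: "(LINT x|lb (-pi) pi. f x) = 0"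
  obtains y where "(y, f) \<in> Lgraph e"
proof -
  have f': "sq_int (lb (-pi) pi) f" using f by (simp add: L2_iff_sq_int)
  have fR: "sq_int (lb 0 pi) f" and fL: "sq_int (lb (-pi) 0) f"
    using sq_int_lb_mono[OF f', of 0 pi] sq_int_lb_mono[OF f', of "-pi" 0] by simp_all
  have fL': "sq_int (lb 0 pi) (\<lambda>x. - f (- x))" using sq_int_uminus[OF sq_int_reflect[OF fL, of 0]] by simp
  obtain p where p: "half_sol e f p" "p 0 = 0" "p pi = 0" using half_sol_exists[OF e(1) fR] by blast
  obtain r where r: "half_sol e (\<lambda>x. - f (- x)) r" "r 0 = 0" "r pi = 0" using half_sol_exists[OF e(1) fL'] by blast
  obtain q w where qw: "profile q w" and fq: "\<And>x. f x = complex_of_real e * q x + w x"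
    by (rule profile_from_halves[OF e f' p r]) (rule that)
  have q: "sq_int (lb (-pi) pi) q" and w: "sq_int (lb (-pi) pi) w" using qw by (simp_all add: profile_def)
  have "integral {-pi..pi} q = 0"
    using integral_add_adjacent[OF q, of "-pi" 0 pi] qw by (simp add: profile_def)
  then have "(LINT x|lb (-pi) pi. q x) = 0" using integral_lb[OF sq_int_lb_integrable[OF q]] by simp
  moreover have "(LINT x|lb (-pi) pi. f x) = complex_of_real e * (LINT x|lb (-pi) pi. q x) + (LINT x|lb (-pi) pi. w x)"
    using sq_int_lb_integrable[OF q] sq_int_lb_integrable[OF w] by (simp add: fq)
  ultimately have "(LINT x|lb (-pi) pi. w x) = 0" using f0 by simp
  then have w0: "integral {-pi..pi} w = 0" using integral_lb[OF sq_int_lb_integrable[OF w]] by simp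
  define y where "y = (\<lambda>x. integral {-pi..x} w)"
  have "abs_cont_on {-pi..pi} y"
  proof (rule abs_cont_indefinite_integral[OF w])
    show "y b - y a = integral {a..b} w" if "-pi \<le> a" "a \<le> b" "b \<le> pi" for a b
      using integral_add_adjacent[OF w, of "-pi" a b] that by (simp add: y_def algebra_simps)
  qed
  then have "L2 y" unfolding L2_iff_sq_int by (intro sq_int_continuous abs_cont_on_continuous)
  then have "(y, f) \<in> Lgraph e"
    by (rule Lgraph_from_profile[OF qw w0 _ f, where c=0]) (auto simp: y_def fq)
  then show thesis by (rule that)
qed

subsection \<open>Trigonometric polynomials\<close>

definition expi :: "int \<Rightarrow> real \<Rightarrow> complex" where
  "expi k x = cis (of_int k * x)"

text \<open>Generated linearly by the exponentials, so that linear facts such as antiderivatives and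
  decompositions reduce to a single frequency; closure under products is derived.\<close>

inductive trig_poly :: "(real \<Rightarrow> complex) \<Rightarrow> bool" where
  trig_expi: "trig_poly (expi k)"
| trig_add: "trig_poly f \<Longrightarrow> trig_poly g \<Longrightarrow> trig_poly (\<lambda>x. f x + g x)"
| trig_cmult: "trig_poly f \<Longrightarrow> trig_poly (\<lambda>x. c * f x)"

lemma expi_0: "expi 0 x = 1"
  by (simp add: expi_def)

lemma expi_mult: "expi k x * expi l x = expi (k + l) x"
  by (simp add: expi_def cis_mult algebra_simps)

lemma expi_1: "expi 1 x = cis x" "expi (-1) x = cis (- x)"
  by (simp_all add: expi_def)

lemma cos_expi: "complex_of_real (cos x) = 1 / 2 * expi 1 x + 1 / 2 * expi (-1) x"
  by (simp add: expi_1 complex_eq_iff)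

lemma sin_expi: "complex_of_real (sin x) = - \<i> / 2 * expi 1 x + \<i> / 2 * expi (-1) x"
  by (simp add: expi_1 complex_eq_iff)

lemma trig_const: "trig_poly (\<lambda>x. c)"
  using trig_cmult[OF trig_expi[of 0], of c] by (simp add: expi_0)

lemma trig_cos: "trig_poly (\<lambda>x. complex_of_real (cos x))"
  unfolding cos_expi by (intro trig_add trig_cmult trig_expi)

lemma trig_sin: "trig_poly (\<lambda>x. complex_of_real (sin x))"
  unfolding sin_expi by (intro trig_add trig_cmult trig_expi)

lemma trig_diff: "trig_poly f \<Longrightarrow> trig_poly g \<Longrightarrow> trig_poly (\<lambda>x. f x - g x)"
  using trig_add[of f "\<lambda>x. (-1) * g x"] trig_cmult[of g "-1"] by simp

lemma trig_expi_mult: "trig_poly f \<Longrightarrow> trig_poly (\<lambda>x. expi k x * f x)"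
proof (induction rule: trig_poly.induct)
  case (trig_expi l)
  show ?case unfolding expi_mult using trig_poly.trig_expi[of "k + l"] .
next
  case (trig_add f g)
  then show ?case unfolding distrib_left by (intro trig_poly.trig_add)
next
  case (trig_cmult f c)
  have "trig_poly (\<lambda>x. c * (expi k x * f x))" by (rule trig_poly.trig_cmult) (rule trig_cmult)
  then show ?case by (simp add: algebra_simps)
qed

lemma trig_mult: "trig_poly f \<Longrightarrow> trig_poly g \<Longrightarrow> trig_poly (\<lambda>x. f x * g x)"
proof (induction rule: trig_poly.induct)
  case (trig_expi l)
  then show ?case by (rule trig_expi_mult)
next
  case (trig_add f f')
  have "trig_poly (\<lambda>x. f x * g x + f' x * g x)" by (rule trig_poly.trig_add) (use trig_add in blast)+
  then show ?case by (simp add: algebra_simps)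
next
  case (trig_cmult f c)
  have "trig_poly (\<lambda>x. c * (f x * g x))" by (rule trig_poly.trig_cmult) (use trig_cmult in blast)
  then show ?case by (simp add: algebra_simps)
qed

lemma expi_has_derivative: "(expi k has_vector_derivative \<i> * of_int k * expi k x) (at x)"
proof -
  have eq: "expi k = (\<lambda>x. complex_of_real (cos (of_int k * x)) + \<i> * complex_of_real (sin (of_int k * x)))"
    by (auto simp: expi_def fun_eq_iff complex_eq_iff)
  have "((\<lambda>x. complex_of_real (cos (of_int k * x)) + \<i> * complex_of_real (sin (of_int k * x))) has_vector_derivative
     complex_of_real (- sin (of_int k * x) * of_int k) + \<i> * complex_of_real (cos (of_int k * x) * of_int k)) (at x)"
    by (intro has_vector_derivative_add has_vector_derivative_mult_right has_vector_derivative_of_real)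
       (auto intro!: derivative_eq_intros)
  moreover have "complex_of_real (- sin (of_int k * x) * of_int k) + \<i> * complex_of_real (cos (of_int k * x) * of_int k)
     = \<i> * of_int k * expi k x"
    by (simp add: expi_def complex_eq_iff)
  ultimately show ?thesis unfolding eq by simp
qed

lemma trig_deriv:
  assumes "trig_poly f"
  shows "\<exists>f'. trig_poly f' \<and> (\<forall>x. (f has_vector_derivative f' x) (at x))"
  using assms
proof (induction rule: trig_poly.induct)
  case (trig_expi k)
  show ?case
    by (intro exI[of _ "\<lambda>x. \<i> * of_int k * expi k x"] conjI allI expi_has_derivative trig_cmult trig_poly.trig_expi)
next
  case (trig_add f g)
  then obtain f' g' where "trig_poly f'" "\<And>x. (f has_vector_derivative f' x) (at x)"
    "trig_poly g'" "\<And>x. (g has_vector_derivative g' x) (at x)" by blast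
  then show ?case
    by (intro exI[of _ "\<lambda>x. f' x + g' x"] conjI allI has_vector_derivative_add trig_poly.trig_add)
next
  case (trig_cmult f c)
  then obtain f' where "trig_poly f'" "\<And>x. (f has_vector_derivative f' x) (at x)" by blast
  then show ?case
    by (intro exI[of _ "\<lambda>x. c * f' x"] conjI allI has_vector_derivative_mult_right trig_poly.trig_cmult)
qed

lemma trig_continuous: assumes "trig_poly f" shows "continuous_on S f"
proof -
  obtain f' where "\<And>x. (f has_vector_derivative f' x) (at x)" using trig_deriv[OF assms] by blast
  then have "isCont f x" for x by (blast intro: has_vector_derivative_continuous)
  then show ?thesis by (intro continuous_at_imp_continuous_on) blast
qed

lemma trig_sq_int: "trig_poly f \<Longrightarrow> sq_int (lb a b) f"
  by (intro sq_int_continuous trig_continuous)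

lemma trig_smooth: assumes "trig_poly f" shows "smooth_fun f"
proof -
  obtain d where d: "\<And>f. trig_poly f \<Longrightarrow> trig_poly (d f) \<and> (\<forall>x. (f has_vector_derivative d f x) (at x))"
    using trig_deriv by metis
  have t: "trig_poly ((d ^^ n) f)" for n by (induction n) (use assms d in auto)
  show ?thesis unfolding smooth_fun_def
    by (intro exI[of _ "\<lambda>n. (d ^^ n) f"]) (use t d in auto)
qed

lemma trig_periodic: assumes "trig_poly f" shows "f (x + 2 * pi) = f x"
  using assms
proof (induction rule: trig_poly.induct)
  case (trig_expi k)
  have "cis (of_int k * (x + 2 * pi)) = cis (of_int k * x) * cis (2 * pi * of_int k)"
    unfolding cis_mult by (rule arg_cong[where f=cis]) (simp add: algebra_simps)
  also have "cis (2 * pi * of_int k) = 1" by (rule cis_multiple_2pi) simp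
  finally show ?case by (simp add: expi_def)
qed auto

subsection \<open>Density of trigonometric polynomials\<close>

lemma real_poly_trig:
  fixes p :: "complex \<Rightarrow> real"
  assumes "real_polynomial_function p"
  shows "trig_poly (\<lambda>x. complex_of_real (p (cis x)))"
  using assms
proof (induction rule: real_polynomial_function.induct)
  case (linear f)
  have "f (cis x) = cos x * f 1 + sin x * f \<i>" for x
  proof -
    have "cis x = cos x *\<^sub>R 1 + sin x *\<^sub>R \<i>" by (simp add: complex_eq_iff)
    moreover have "f (cos x *\<^sub>R 1 + sin x *\<^sub>R \<i>) = cos x *\<^sub>R f 1 + sin x *\<^sub>R f \<i>"
      using bounded_linear.linear[OF linear] by (simp only: linear_add linear_scale)
    ultimately show ?thesis by (simp only: real_scaleR_def)
  qed
  then have eq: "complex_of_real (f (cis x)) = complex_of_real (f 1) * complex_of_real (cos x) + complex_of_real (f \<i>) * complex_of_real (sin x)" for x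
    by simp
  show ?case unfolding eq by (intro trig_add trig_cmult trig_cos trig_sin)
next
  case (const c)
  show ?case by (rule trig_const)
next
  case (add f g)
  then show ?case using trig_add by simp
next
  case (mult f g)
  then show ?case using trig_mult by simp
qed

lemma poly_trig:
  fixes P :: "complex \<Rightarrow> complex"
  assumes "polynomial_function P"
  shows "trig_poly (\<lambda>x. P (cis x))"
proof -
  have "real_polynomial_function (Re \<circ> P)" "real_polynomial_function (Im \<circ> P)"
    using assms bounded_linear_Re bounded_linear_Im unfolding polynomial_function_def by blast+
  then have "trig_poly (\<lambda>x. complex_of_real ((Re \<circ> P) (cis x)) + \<i> * complex_of_real ((Im \<circ> P) (cis x)))"
    by (intro trig_add trig_cmult real_poly_trig)
  moreover have "complex_of_real ((Re \<circ> P) (cis x)) + \<i> * complex_of_real ((Im \<circ> P) (cis x)) = P (cis x)" for x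
    using complex_eq[of "P (cis x)"] by simp
  ultimately show ?thesis by simp
qed

lemma Im_Ln_cis: "- pi < x \<Longrightarrow> x \<le> pi \<Longrightarrow> Im (Ln (cis x)) = x"
  by (simp add: cis_conv_exp)

text \<open>Stone-Weierstrass on the unit circle, where polynomials restrict to trigonometric
  polynomials. The angle \<open>Im (Ln z)\<close> jumps at \<open>-1\<close>, so the circle is
  covered by a closed arc \<open>?A\<close> avoiding \<open>-1\<close>, on which \<open>Ln\<close>
  is continuous, and a closed arc \<open>?B\<close> around \<open>-1\<close>, on which the
  transported function is 0.\<close>

lemma trig_uniform_approx:
  fixes h :: "real \<Rightarrow> complex"
  assumes h: "continuous_on UNIV h" and s: "0 < s" "s < pi"
    and h0: "\<And>x. pi - s \<le> \<bar>x\<bar> \<Longrightarrow> h x = 0" and e: "0 < e"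
  obtains T where "trig_poly T" "\<And>x. x \<in> {-pi..pi} \<Longrightarrow> cmod (h x - T x) < e"
proof -
  define F where "F = (\<lambda>z. h (Im (Ln z)))"
  \<comment> \<open>\<open>pi - s\<close> is the angle from which on \<open>h\<close> vanishes; its
    cosine separates the two arcs.\<close>
  define kk where "kk = cos (pi - s)"
  have kk: "- 1 < kk"
    using cos_monotone_0_pi[of "pi - s" pi] s by (simp add: kk_def)
  let ?A = "sphere 0 1 \<inter> {z. kk \<le> Re z}" and ?B = "sphere 0 1 \<inter> {z. Re z \<le> kk}"
  have clA: "closed ?A" "closed ?B"
    by (intro closed_Int closed_halfspace_Re_ge closed_halfspace_Re_le closed_sphere)+
  have "continuous_on ?A (\<lambda>z. Im (Ln z))"
  proof (intro continuous_intros continuous_on_Ln)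
    fix z :: complex assume z: "z \<in> ?A"
    show "z \<notin> \<real>\<^sub>\<le>\<^sub>0"
    proof
      assume "z \<in> \<real>\<^sub>\<le>\<^sub>0"
      then have "z = complex_of_real (Re z)" "Re z \<le> 0" by (auto simp: complex_nonpos_Reals_iff complex_eq_iff)
      moreover have "cmod z = 1" using z by simp
      ultimately have "Re z = - 1" by (metis abs_of_nonpos minus_minus norm_of_real)
      then show False using z kk by simp
    qed
  qed
  then have "continuous_on ?A F"
    unfolding F_def using continuous_on_compose2[OF h, of ?A "\<lambda>z. Im (Ln z)"] by simp
  moreover have "continuous_on ?B F"
  proof -
    have "F z = 0" if z: "z \<in> ?B" for z
    proof -
      have z1: "cmod z = 1" "z \<noteq> 0" using z by auto
      let ?t = "Im (Ln z)"
      have t: "- pi < ?t" "?t \<le> pi" using z1 by (simp_all add: mpi_less_Im_Ln Im_Ln_le_pi)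
      have ex: "exp (Ln z) = z" using z1 by simp
      have 1: "exp (Re (Ln z)) = 1" using norm_exp_eq_Re[of "Ln z"] ex z1(1) by (simp only:)
      have 2: "Re z = exp (Re (Ln z)) * cos ?t" using Re_exp[of "Ln z"] ex by (simp only:)
      have "cos ?t = Re z" using 2[unfolded 1] by (simp only: mult_1)
      then have "cos \<bar>?t\<bar> \<le> cos (pi - s)" using z by (simp add: kk_def)
      then have "pi - s \<le> \<bar>?t\<bar>"
        using cos_monotone_0_pi[of "\<bar>?t\<bar>" "pi - s"] s by fastforce
      then show ?thesis by (simp add: F_def h0)
    qed
    then show ?thesis by (subst continuous_on_cong[OF refl, of _ _ "\<lambda>_. 0"]) auto
  qed
  ultimately have "continuous_on (?A \<union> ?B) F" by (intro continuous_on_closed_Un clA)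
  moreover have "?A \<union> ?B = sphere 0 1" by auto
  ultimately have cF: "continuous_on (sphere 0 1) F" by (simp only:)
  from Stone_Weierstrass_polynomial_function[OF compact_sphere cF e]
  obtain P where P: "polynomial_function P" "\<And>z. z \<in> sphere 0 1 \<Longrightarrow> cmod (F z - P z) < e" by blast
  have "cmod (h x - P (cis x)) < e" if x: "x \<in> {-pi..pi}" for x
  proof -
    have "F (cis x) = h x"
    \<comment> \<open>\<open>cis (- pi)\<close> has angle pi, so \<open>F\<close> sees
      \<open>h pi\<close> there; both \<open>h pi\<close> and \<open>h (- pi)\<close> are 0.\<close>
    proof (cases "x = - pi")
      case True
      then have "cis x = cis pi" by (simp add: complex_eq_iff)
      then have "F (cis x) = h pi" using Im_Ln_cis[of pi] by (simp add: F_def)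
      then show ?thesis using h0[of pi] h0[of "-pi"] s True by simp
    next
      case False
      then show ?thesis using Im_Ln_cis[of x] x by (simp add: F_def)
    qed
    then show ?thesis using P(2)[of "cis x"] by simp
  qed
  then show thesis by (rule that[OF poly_trig[OF P(1)]])
qed

section \<open>Truncation and density in the norm of square-integrable functions\<close>

lemma sqn_dominated_tendsto:
  assumes F: "\<And>n. F n \<in> borel_measurable M" and f: "f \<in> borel_measurable M"
    and G: "integrable M (\<lambda>x. (G x)\<^sup>2)"
    and lim: "AE x in M. (\<lambda>n. F n x) \<longlonglongrightarrow> f x"
    and dom: "\<And>n. AE x in M. cmod (F n x - f x) \<le> G x"
  shows "(\<lambda>n. sqn M (\<lambda>x. F n x - f x)) \<longlonglongrightarrow> 0"
proof -
  note [measurable] = F f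
  have "(\<lambda>n. LINT x|M. (cmod (F n x - f x))\<^sup>2) \<longlonglongrightarrow> (LINT x|M. 0)"
  proof (rule integral_dominated_convergence[where w="\<lambda>x. (G x)\<^sup>2"])
    show "(\<lambda>x. 0) \<in> borel_measurable M" by simp
    show "(\<lambda>x. (cmod (F n x - f x))\<^sup>2) \<in> borel_measurable M" for n
      by measurable
    show "AE x in M. (\<lambda>n. (cmod (F n x - f x))\<^sup>2) \<longlonglongrightarrow> 0"
      using lim
    proof eventually_elim
      case (elim x)
      have "(\<lambda>n. (cmod (F n x - f x))\<^sup>2) \<longlonglongrightarrow> (cmod (f x - f x))\<^sup>2" by (intro tendsto_intros elim)
      then show ?case by simp
    qed
    show "AE x in M. norm ((cmod (F n x - f x))\<^sup>2) \<le> (G x)\<^sup>2" for n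
      using dom[of n] by eventually_elim (simp add: power_mono)
  qed (rule G)
  then have "(\<lambda>n. sqrt (LINT x|M. (cmod (F n x - f x))\<^sup>2)) \<longlonglongrightarrow> sqrt 0" by (intro tendsto_real_sqrt) simp
  then show ?thesis by (simp add: sqn_def)
qed

text \<open>Radial retraction onto the closed disc of radius \<open>B > 0\<close>. Its continuity
  makes it compatible with measurability and with pointwise limits.\<close>

definition truncate :: "real \<Rightarrow> complex \<Rightarrow> complex" where
  "truncate B z = (B / max B (cmod z)) *\<^sub>R z"

lemma truncate_id: "0 < B \<Longrightarrow> cmod z \<le> B \<Longrightarrow> truncate B z = z"
  by (simp add: truncate_def max_absorb1)

lemma truncate_le: "0 < B \<Longrightarrow> cmod (truncate B z) \<le> B"
  by (simp add: truncate_def field_simps max_def)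

lemma truncate_diff_le: assumes "0 < B" shows "cmod (truncate B z - z) \<le> cmod z"
proof -
  have c: "0 \<le> B / max B (cmod z)" "B / max B (cmod z) \<le> 1" using assms by (auto simp: divide_simps)
  have "truncate B z - z = (B / max B (cmod z) - 1) *\<^sub>R z" by (simp add: truncate_def algebra_simps)
  then have "cmod (truncate B z - z) = \<bar>B / max B (cmod z) - 1\<bar> * cmod z" by simp
  also have "\<dots> \<le> 1 * cmod z" using c by (intro mult_right_mono) auto
  finally show ?thesis by simp
qed

lemma truncate_continuous: assumes "0 < B" shows "continuous_on UNIV (truncate B)"
proof -
  have "continuous_on UNIV (\<lambda>z::complex. (B / max B (cmod z)) *\<^sub>R z)"
    by (intro continuous_intros) (use assms in \<open>auto simp: max_def\<close>)
  then show ?thesis unfolding truncate_def by (simp add: fun_eq_iff)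
qed

lemma truncate_measurable: "0 < B \<Longrightarrow> f \<in> borel_measurable M \<Longrightarrow> (\<lambda>x. truncate B (f x)) \<in> borel_measurable M"
  by (rule borel_measurable_continuous_on[OF truncate_continuous])

text \<open>Three errors of size \<open>e / 3\<close>: truncation to a bounded function,
  approximation of the latter by continuous functions vanishing near both ends (differences
  dominated by \<open>2 * B\<close>), and uniform approximation by a trigonometric
  polynomial.\<close>

lemma trig_dense:
  assumes q: "sq_int (lb (-pi) pi) q" and e: "0 < e"
  obtains T where "trig_poly T" "sqn (lb (-pi) pi) (\<lambda>x. T x - q x) < e"
proof -
  let ?M = "lb (-pi) pi"
  note qm = sq_int_meas[OF q]
  have e3: "0 < e / 3" using e by simp
  have "(\<lambda>n. sqn ?M (\<lambda>x. truncate (real n + 1) (q x) - q x)) \<longlonglongrightarrow> 0"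
  proof (rule sqn_dominated_tendsto[OF _ qm, where G="\<lambda>x. cmod (q x)"])
    show "(\<lambda>x. truncate (real n + 1) (q x)) \<in> borel_measurable ?M" for n
      by (rule truncate_measurable[OF _ qm]) simp
    show "integrable ?M (\<lambda>x. (cmod (q x))\<^sup>2)" using q by (simp add: sq_int_def)
    have "(\<lambda>n. truncate (real n + 1) z) \<longlonglongrightarrow> z" for z
    proof (rule tendsto_eventually)
      show "\<forall>\<^sub>F n in sequentially. truncate (real n + 1) z = z"
      proof (rule eventually_sequentiallyI)
        fix n assume "nat \<lceil>cmod z\<rceil> \<le> n"
        then have "cmod z \<le> real n + 1" by linarith
        then show "truncate (real n + 1) z = z" by (intro truncate_id) simp_all
      qed
    qed
    then show "AE x in ?M. (\<lambda>n. truncate (real n + 1) (q x)) \<longlonglongrightarrow> q x" by simp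
    show "AE x in ?M. cmod (truncate (real n + 1) (q x) - q x) \<le> cmod (q x)" for n
      by (simp add: truncate_diff_le)
  qed
  from order_tendstoD(2)[OF this e3]
  obtain N where N: "sqn ?M (\<lambda>x. truncate (real N + 1) (q x) - q x) < e / 3"
    using eventually_happens'[OF sequentially_bot] by blast
  define B where "B = real N + 1"
  have B: "0 < B" by (simp add: B_def)
  define q1 where "q1 = (\<lambda>x. truncate B (q x))"
  have q1m: "q1 \<in> borel_measurable ?M" unfolding q1_def by (rule truncate_measurable[OF B qm])
  have q1: "sq_int ?M q1"
    by (rule finite_measure.sq_int_bounded[OF finite_measure_lb q1m, of B]) (simp add: q1_def truncate_le B)
  have "(\<lambda>x. indicator {-pi..pi} x *\<^sub>R q x) \<in> borel_measurable borel"
    using qm by (simp add: borel_measurable_restrict_space_iff)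
  then have "(\<lambda>x. indicator {-pi..pi} x *\<^sub>R q x) \<in> borel_measurable lebesgue"
    by (intro measurable_completion) simp
  \<comment> \<open>This notion of measurability directly supplies continuous functions converging
    off a negligible set.\<close>
  then have "(\<lambda>x. indicator {-pi..pi} x *\<^sub>R q x) measurable_on UNIV"
    by (subst measurable_on_iff_borel_measurable) (simp_all add: lebesgue_on_UNIV_eq)
  then obtain Z g where Z: "negligible Z" and g: "\<And>n. continuous_on UNIV (g n)"
    and gl: "\<And>x. x \<notin> Z \<Longrightarrow> (\<lambda>n. g n x) \<longlonglongrightarrow> indicator {-pi..pi} x *\<^sub>R q x"
    unfolding measurable_on_def by auto
  \<comment> \<open>Cutoff equal to 0 within distance \<open>1 / n\<close> of the ends and to 1
    beyond distance \<open>2 / n\<close>.\<close>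
  define ch where "ch = (\<lambda>n x. max 0 (min 1 (real n * (pi - \<bar>x\<bar>) - 1)))"
  have ch: "0 \<le> ch n x" "ch n x \<le> 1" for n x by (simp_all add: ch_def)
  define h where "h = (\<lambda>n x. ch n x *\<^sub>R truncate B (g n x))"
  have hc: "continuous_on UNIV (h n)" for n
    unfolding h_def ch_def
    by (intro continuous_intros continuous_on_compose2[OF truncate_continuous[OF B] g]) auto
  have hm: "h n \<in> borel_measurable ?M" for n
    by (rule sq_int_meas[OF sq_int_continuous[OF continuous_on_subset[OF hc]]]) simp
  have hB: "cmod (h n x) \<le> B" for n x
    using mult_mono[OF ch(2)[of n x] truncate_le[OF B, of "g n x"]] ch(1)[of n x] B by (simp add: h_def)
  have hl: "(\<lambda>n. h n x) \<longlonglongrightarrow> q1 x" if x: "x \<notin> Z" "- pi < x" "x < pi" for x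
  proof -
    have "(\<lambda>n. g n x) \<longlonglongrightarrow> q x" using gl[OF x(1)] x by simp
    moreover have "isCont (truncate B) (q x)"
      using truncate_continuous[OF B] by (simp add: continuous_on_eq_continuous_at)
    ultimately have 1: "(\<lambda>n. truncate B (g n x)) \<longlonglongrightarrow> q1 x" unfolding q1_def by (rule isCont_tendsto_compose[rotated])
    have "(\<lambda>n. ch n x) \<longlonglongrightarrow> 1"
    proof (rule tendsto_eventually)
      have p: "0 < pi - \<bar>x\<bar>" using x by auto
      show "\<forall>\<^sub>F n in sequentially. ch n x = 1"
      proof (rule eventually_sequentiallyI)
        fix n assume "nat \<lceil>2 / (pi - \<bar>x\<bar>)\<rceil> \<le> n"
        then have "2 / (pi - \<bar>x\<bar>) \<le> real n" by linarith
        then have "2 \<le> real n * (pi - \<bar>x\<bar>)" using p by (simp add: field_simps)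
        then show "ch n x = 1" by (simp add: ch_def)
      qed
    qed
    from tendsto_scaleR[OF this 1] show ?thesis by (simp add: h_def)
  qed
  have "(\<lambda>n. sqn ?M (\<lambda>x. h n x - q1 x)) \<longlonglongrightarrow> 0"
  proof (rule sqn_dominated_tendsto[OF hm q1m, where G="\<lambda>x. 2 * B"])
    show "integrable ?M (\<lambda>x. (2 * B)\<^sup>2)"
      by (rule finite_measure.integrable_const[OF finite_measure_lb])
    have "AE x in lborel. x \<notin> Z" using Z by (simp add: AE_lborel_iff_negligible)
    then show "AE x in ?M. (\<lambda>n. h n x) \<longlonglongrightarrow> q1 x"
      using AE_lb_not_eq[of pi "-pi" pi] AE_lb_not_eq[of "-pi" "-pi" pi] unfolding AE_lb_iff
      by eventually_elim (use hl in force)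
    show "AE x in ?M. cmod (h n x - q1 x) \<le> 2 * B" for n
    proof (rule AE_I2)
      fix x
      have "cmod (h n x - q1 x) \<le> cmod (h n x) + cmod (q1 x)" by (rule norm_triangle_ineq4)
      also have "\<dots> \<le> B + B" using hB truncate_le[OF B] by (intro add_mono) (auto simp: q1_def)
      finally show "cmod (h n x - q1 x) \<le> 2 * B" by simp
    qed
  qed
  from order_tendstoD(2)[OF this e3]
  have "\<forall>\<^sub>F n in sequentially. sqn ?M (\<lambda>x. h n x - q1 x) < e / 3 \<and> 1 \<le> n"
    by (rule eventually_conj) (rule eventually_ge_at_top)
  then obtain n where n: "sqn ?M (\<lambda>x. h n x - q1 x) < e / 3" "1 \<le> n"
    using eventually_happens'[OF sequentially_bot] by blast
  have s: "0 < 1 / real n" "1 / real n < pi" using n pi_gt3 by (auto simp: field_simps intro: less_le_trans[of _ "3 * real n"])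
  have h0: "h n x = 0" if "pi - 1 / real n \<le> \<bar>x\<bar>" for x
  proof -
    have "pi - \<bar>x\<bar> \<le> 1 / real n" using that by simp
    then have "real n * (pi - \<bar>x\<bar>) \<le> real n * (1 / real n)" by (intro mult_left_mono) auto
    then have "ch n x = 0" using n by (simp add: ch_def)
    then show ?thesis by (simp add: h_def)
  qed
  \<comment> \<open>The interval has length \<open>2 * pi < 9\<close>, so a uniform error
    \<open>e / 9\<close> costs at most \<open>e / 3\<close> in norm.\<close>
  have e9: "0 < e / 9" using e by simp
  obtain T where T: "trig_poly T" "\<And>x. x \<in> {-pi..pi} \<Longrightarrow> cmod (h n x - T x) < e / 9"
    using trig_uniform_approx[OF hc s h0 e9] by blast
  have hs: "sq_int ?M (h n)" by (rule sq_int_continuous[OF continuous_on_subset[OF hc]]) simp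
  have Ts: "sq_int ?M T" by (rule trig_sq_int[OF T(1)])
  have sq: "sqrt (pi - - pi) \<le> 3" using pi_less_4 by (intro real_le_lsqrt) auto
  have "sqn ?M (\<lambda>x. T x - h n x) \<le> e / 9 * sqrt (measure ?M (space ?M))"
  proof (rule finite_measure.sqn_le_bound[OF finite_measure_lb])
    show "(\<lambda>x. T x - h n x) \<in> borel_measurable ?M" by (rule sq_int_meas[OF sq_int_diff[OF Ts hs]])
    show "AE x in ?M. cmod (T x - h n x) \<le> e / 9"
      unfolding AE_lb_iff using T(2) by (intro AE_I2) (auto simp: norm_minus_commute intro: less_imp_le)
  qed (use e in simp)
  also have "\<dots> \<le> e / 9 * 3"
    by (rule mult_left_mono) (use sq e in \<open>simp_all add: measure_lb\<close>)
  finally have 1: "sqn ?M (\<lambda>x. T x - h n x) \<le> e / 3" by simp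
  have "sqn ?M (\<lambda>x. (T x - h n x) + ((h n x - q1 x) + (q1 x - q x)))
      \<le> sqn ?M (\<lambda>x. T x - h n x) + (sqn ?M (\<lambda>x. h n x - q1 x) + sqn ?M (\<lambda>x. q1 x - q x))"
    by (intro order.trans[OF sqn_add] add_mono order_refl sqn_add sq_int_add sq_int_diff Ts hs q1 q)
  also have "\<dots> < e" using 1 n(1) N by (simp add: q1_def B_def)
  finally have "sqn ?M (\<lambda>x. T x - q x) < e" by simp
  then show thesis by (rule that[OF T(1)])
qed

subsection \<open>Approximation of the domain by trigonometric polynomials\<close>

text \<open>Functions of the form \<open>(sin * v)' + a + b * sin\<close>. The corrections \<open>1\<close> and \<open>sin\<close> are exactly what the
  integrals over the two half periods detect.\<close>

definition reducible :: "(real \<Rightarrow> complex) \<Rightarrow> bool" where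
  "reducible T \<longleftrightarrow> (\<exists>v v' a b. trig_poly v \<and> trig_poly v' \<and> (\<forall>x. (v has_vector_derivative v' x) (at x)) \<and>
     (\<forall>x. T x = (complex_of_real (cos x) * v x + complex_of_real (sin x) * v' x) + (a + b * complex_of_real (sin x))))"

lemma reducible_add: assumes "reducible S" "reducible T" shows "reducible (\<lambda>x. S x + T x)"
proof -
  obtain v v' a b where 1: "trig_poly v" "trig_poly v'" "\<And>x. (v has_vector_derivative v' x) (at x)"
    "\<And>x. S x = (complex_of_real (cos x) * v x + complex_of_real (sin x) * v' x) + (a + b * complex_of_real (sin x))"
    using assms(1) unfolding reducible_def by blast
  obtain w w' c d where 2: "trig_poly w" "trig_poly w'" "\<And>x. (w has_vector_derivative w' x) (at x)"
    "\<And>x. T x = (complex_of_real (cos x) * w x + complex_of_real (sin x) * w' x) + (c + d * complex_of_real (sin x))"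
    using assms(2) unfolding reducible_def by blast
  show ?thesis unfolding reducible_def
    by (rule exI[of _ "\<lambda>x. v x + w x"], rule exI[of _ "\<lambda>x. v' x + w' x"], rule exI[of _ "a + c"], rule exI[of _ "b + d"])
       (auto intro!: trig_add 1(1-3) 2(1-3) has_vector_derivative_add simp: 1(4) 2(4) algebra_simps)
qed

lemma reducible_cmult: assumes "reducible S" shows "reducible (\<lambda>x. c * S x)"
proof -
  obtain v v' a b where 1: "trig_poly v" "trig_poly v'" "\<And>x. (v has_vector_derivative v' x) (at x)"
    "\<And>x. S x = (complex_of_real (cos x) * v x + complex_of_real (sin x) * v' x) + (a + b * complex_of_real (sin x))"
    using assms(1) unfolding reducible_def by blast
  show ?thesis unfolding reducible_def
    by (rule exI[of _ "\<lambda>x. c * v x"], rule exI[of _ "\<lambda>x. c * v' x"], rule exI[of _ "c * a"], rule exI[of _ "c * b"])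
       (auto intro!: trig_cmult 1(1-3) has_vector_derivative_mult_right simp: 1(4) algebra_simps)
qed

text \<open>This is \<open>(sin * v)'\<close> for \<open>v = 2 * expi k\<close>: it links the
  frequencies \<open>k - 1\<close> and \<open>k + 1\<close> with no correction term.\<close>

lemma reducible_step: "reducible (\<lambda>x. of_int (k + 1) * expi (k + 1) x + of_int (1 - k) * expi (k - 1) x)"
proof -
  have eq: "of_int (k + 1) * expi (k + 1) x + of_int (1 - k) * expi (k - 1) x =
     (complex_of_real (cos x) * (2 * expi k x) + complex_of_real (sin x) * (2 * (\<i> * of_int k * expi k x)))
       + (0 + 0 * complex_of_real (sin x))" for x
  proof -
    have m: "expi (k + 1) x = expi 1 x * expi k x" "expi (k - 1) x = expi (-1) x * expi k x"
      by (simp_all add: expi_mult add.commute)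
    show ?thesis unfolding m cos_expi sin_expi by (simp add: algebra_simps)
  qed
  show ?thesis unfolding reducible_def eq
    by (rule exI[of _ "\<lambda>x. 2 * expi k x"], rule exI[of _ "\<lambda>x. 2 * (\<i> * of_int k * expi k x)"], rule exI[of _ 0], rule exI[of _ 0])
       (intro conjI allI refl trig_cmult trig_expi has_vector_derivative_mult_right expi_has_derivative)
qed

lemma reducible_sin: "reducible (\<lambda>x. complex_of_real (sin x))"
  unfolding reducible_def
  by (rule exI[of _ "\<lambda>x. 0"], rule exI[of _ "\<lambda>x. 0"], rule exI[of _ 0], rule exI[of _ 1])
     (auto intro: trig_const)

lemma reducible_const: "reducible (\<lambda>x. c)"
  unfolding reducible_def
  by (rule exI[of _ "\<lambda>x. 0"], rule exI[of _ "\<lambda>x. 0"], rule exI[of _ c], rule exI[of _ 0])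
     (auto intro: trig_const)

text \<open>The recursion from \<open>reducible_step\<close> moves by two, so it starts from
  frequencies 0 and 1. Frequency 0 is the constant correction. For frequency 1 the step at
  \<open>k = 0\<close> yields only \<open>expi 1 + expi (-1)\<close>, and \<open>sin\<close>
  separates the two. For \<open>n = m + 2\<close> the leading coefficient \<open>m + 2\<close> is
  nonzero, and frequency \<open>m\<close> is covered by induction.\<close>

lemma reducible_expi_nat: "reducible (expi (int n)) \<and> reducible (expi (- int n))"
proof (induction n rule: less_induct)
  case (less n)
  consider "n = 0" | "n = 1" | "2 \<le> n" by linarith
  then show ?case
  proof cases
    case 1
    moreover have "expi 0 = (\<lambda>x. 1)" by (simp add: expi_0 fun_eq_iff)
    ultimately show ?thesis using reducible_const[of 1] by simp
  next
    case 2
    have s: "reducible (\<lambda>x. expi 1 x + expi (-1) x)" using reducible_step[of 0] by simp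
    have "reducible (\<lambda>x. 1 / 2 * (expi 1 x + expi (-1) x) + \<i> * complex_of_real (sin x))"
      by (intro reducible_add reducible_cmult s reducible_sin)
    moreover have "1 / 2 * (expi 1 x + expi (-1) x) + \<i> * complex_of_real (sin x) = expi 1 x" for x
      by (simp add: sin_expi algebra_simps)
    moreover have "reducible (\<lambda>x. 1 / 2 * (expi 1 x + expi (-1) x) + (- \<i>) * complex_of_real (sin x))"
      by (intro reducible_add reducible_cmult s reducible_sin)
    moreover have "1 / 2 * (expi 1 x + expi (-1) x) + (- \<i>) * complex_of_real (sin x) = expi (-1) x" for x
      by (simp add: sin_expi algebra_simps)
    ultimately show ?thesis using 2 by (simp add: eta_contract_eq)
  next
    case 3
    define m where "m = n - 2"
    have n: "int n = int m + 2" "m < n" using 3 by (auto simp: m_def)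
    note IH = less.IH[OF n(2)]
    have nz: "(of_int (int m + 2) :: complex) \<noteq> 0" by (simp flip: of_nat_Suc add: of_nat_eq_0_iff) (metis add_2_eq_Suc' of_nat_Suc of_nat_add of_nat_eq_0_iff of_nat_numeral old.nat.distinct(2))
    have A: "reducible (\<lambda>x. inverse (of_int (int m + 2)) * ((of_int (int m + 2) * expi (int m + 2) x + of_int (- int m) * expi (int m) x)
        + of_int (int m) * expi (int m) x))"
    proof (rule reducible_cmult, rule reducible_add)
      show "reducible (\<lambda>x. of_int (int m + 2) * expi (int m + 2) x + of_int (- int m) * expi (int m) x)"
        using reducible_step[of "int m + 1"] by (simp add: algebra_simps)
    qed (rule reducible_cmult[OF conjunct1[OF IH]])
    have B: "reducible (\<lambda>x. inverse (of_int (int m + 2)) * ((of_int (- int m) * expi (- int m) x + of_int (int m + 2) * expi (- (int m + 2)) x)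
        + of_int (int m) * expi (- int m) x))"
    proof (rule reducible_cmult, rule reducible_add)
      show "reducible (\<lambda>x. of_int (- int m) * expi (- int m) x + of_int (int m + 2) * expi (- (int m + 2)) x)"
        using reducible_step[of "- int m - 1"] by (simp add: algebra_simps)
    qed (rule reducible_cmult[OF conjunct2[OF IH]])
    have "inverse (of_int (int m + 2)) * ((of_int (int m + 2) * expi (int m + 2) x + of_int (- int m) * expi (int m) x)
        + of_int (int m) * expi (int m) x) = expi (int n) x" for x
      using nz by (simp add: n(1) field_simps)
    moreover have "inverse (of_int (int m + 2)) * ((of_int (- int m) * expi (- int m) x + of_int (int m + 2) * expi (- (int m + 2)) x)
        + of_int (int m) * expi (- int m) x) = expi (- int n) x" for x
      using nz by (simp add: n(1) field_simps)
    ultimately show ?thesis using A B by (simp add: eta_contract_eq)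
  qed
qed

lemma reducible_trig: assumes "trig_poly T" shows "reducible T"
  using assms
proof (induction rule: trig_poly.induct)
  case (trig_expi k)
  show ?case using reducible_expi_nat[of "nat \<bar>k\<bar>"] by (cases "0 \<le> k") auto
qed (auto intro: reducible_add reducible_cmult)

text \<open>\<open>m\<close> is the coefficient of \<open>expi 0\<close>, the only exponential
  without a periodic antiderivative.\<close>

lemma trig_antideriv: assumes "trig_poly w"
  shows "\<exists>m f. trig_poly f \<and> (\<forall>x. (f has_vector_derivative w x - m) (at x))"
  using assms
proof (induction rule: trig_poly.induct)
  case (trig_expi k)
  show ?case
  proof (cases "k = 0")
    case True
    show ?thesis
      by (rule exI[of _ 1], rule exI[of _ "\<lambda>x. 0"]) (use trig_const True in \<open>auto simp: expi_0\<close>)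
  next
    case False
    show ?thesis
    proof (rule exI[of _ 0], rule exI[of _ "\<lambda>x. inverse (\<i> * of_int k) * expi k x"], intro conjI allI)
      show "trig_poly (\<lambda>x. inverse (\<i> * of_int k) * expi k x)" by (intro trig_cmult trig_poly.trig_expi)
      fix x
      have "((\<lambda>x. inverse (\<i> * of_int k) * expi k x) has_vector_derivative inverse (\<i> * of_int k) * (\<i> * of_int k * expi k x)) (at x)"
        by (intro has_vector_derivative_mult_right expi_has_derivative)
      moreover have "inverse (\<i> * of_int k) * (\<i> * of_int k * expi k x) = expi k x - 0"
        using False by (simp add: field_simps)
      ultimately show "((\<lambda>x. inverse (\<i> * of_int k) * expi k x) has_vector_derivative expi k x - 0) (at x)" by (simp only:)
    qed
  qed
next
  case (trig_add f g)
  then obtain m F n G where FG: "trig_poly F" "\<And>x. (F has_vector_derivative f x - m) (at x)"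
    "trig_poly G" "\<And>x. (G has_vector_derivative g x - n) (at x)" by blast
  show ?case
  proof (rule exI[of _ "m + n"], rule exI[of _ "\<lambda>x. F x + G x"], intro conjI allI)
    show "trig_poly (\<lambda>x. F x + G x)" by (intro trig_poly.trig_add FG)
    fix x show "((\<lambda>x. F x + G x) has_vector_derivative f x + g x - (m + n)) (at x)"
      using has_vector_derivative_add[OF FG(2)[of x] FG(4)[of x]] by (simp add: algebra_simps)
  qed
next
  case (trig_cmult f c)
  then obtain m F where F: "trig_poly F" "\<And>x. (F has_vector_derivative f x - m) (at x)" by blast
  show ?case
  proof (rule exI[of _ "c * m"], rule exI[of _ "\<lambda>x. c * F x"], intro conjI allI)
    show "trig_poly (\<lambda>x. c * F x)" by (intro trig_poly.trig_cmult F)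
    fix x show "((\<lambda>x. c * F x) has_vector_derivative c * f x - c * m) (at x)"
      using has_vector_derivative_mult_right[OF F(2)[of x], of c] by (simp add: algebra_simps)
  qed
qed

lemma sin_mult_has_integral:
  assumes "\<And>x. (v has_vector_derivative v' x) (at x)" "a \<le> b"
  shows "((\<lambda>x. complex_of_real (cos x) * v x + complex_of_real (sin x) * v' x) has_integral
     complex_of_real (sin b) * v b - complex_of_real (sin a) * v a) {a..b}"
proof (rule fundamental_theorem_of_calculus[OF assms(2)])
  fix x
  have "((\<lambda>x. complex_of_real (sin x) * v x) has_vector_derivative
     complex_of_real (sin x) * v' x + complex_of_real (cos x) * v x) (at x)"
    by (intro has_vector_derivative_mult has_vector_derivative_of_real assms) (auto intro!: derivative_eq_intros)
  then show "((\<lambda>x. complex_of_real (sin x) * v x) has_vector_derivative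
     complex_of_real (cos x) * v x + complex_of_real (sin x) * v' x) (at x within {a..b})"
    by (simp add: add.commute has_vector_derivative_at_within)
qed

lemma affine_sin_has_integral:
  assumes "s \<le> t"
  shows "((\<lambda>x. a + b * complex_of_real (sin x)) has_integral
     (complex_of_real t * a - b * complex_of_real (cos t)) - (complex_of_real s * a - b * complex_of_real (cos s))) {s..t}"
proof (rule fundamental_theorem_of_calculus[OF assms])
  fix x
  have "((\<lambda>x. complex_of_real x * a - b * complex_of_real (cos x)) has_vector_derivative
     complex_of_real 1 * a - b * complex_of_real (- sin x)) (at x)"
    by (intro has_vector_derivative_diff has_vector_derivative_mult_left has_vector_derivative_mult_right has_vector_derivative_of_real)
       (auto intro!: derivative_eq_intros)
  then show "((\<lambda>x. complex_of_real x * a - b * complex_of_real (cos x)) has_vector_derivative a + b * complex_of_real (sin x)) (at x within {s..t})"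
    by (simp add: has_vector_derivative_at_within)
qed

lemma sqrt_2pi_le: "sqrt (2 * pi) \<le> 3"
  using pi_less_4 by (intro real_le_lsqrt) auto

text \<open>3 is a crude majorant of \<open>sqrt (2 * pi)\<close>.\<close>

lemma sqn_le_3:
  assumes "f \<in> borel_measurable (lb (-pi) pi)" "\<And>x. x \<in> {-pi..pi} \<Longrightarrow> cmod (f x) \<le> B" "0 \<le> B"
  shows "sqn (lb (-pi) pi) f \<le> 3 * B"
proof -
  have "sqn (lb (-pi) pi) f \<le> B * sqrt (measure (lb (-pi) pi) (space (lb (-pi) pi)))"
    by (rule finite_measure.sqn_le_bound[OF finite_measure_lb assms(1) _ assms(3)]) (auto simp: AE_lb_iff assms(2))
  also have "measure (lb (-pi) pi) (space (lb (-pi) pi)) = 2 * pi" by (subst measure_lb_space) auto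
  also have "B * sqrt (2 * pi) \<le> B * 3" using sqrt_2pi_le assms(3) by (rule mult_left_mono)
  finally show ?thesis by simp
qed

lemma range_approx:
  assumes q: "sq_int (lb (-pi) pi) q" "integral {-pi..0} q = 0" "integral {0..pi} q = 0" and d: "0 < d"
  obtains v v' where "trig_poly v" "trig_poly v'" "\<And>x. (v has_vector_derivative v' x) (at x)"
    "sqn (lb (-pi) pi) (\<lambda>x. (complex_of_real (cos x) * v x + complex_of_real (sin x) * v' x) - q x) \<le> d"
proof -
  let ?M = "lb (-pi) pi"
  \<comment> \<open>\<open>\<delta>\<close> from approximating \<open>q\<close> by \<open>T\<close>
    and \<open>3 * (2 * \<delta>)\<close> from dropping \<open>a + b * sin\<close> add up to
    \<open>7 * \<delta>\<close>.\<close>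
  define \<delta> where "\<delta> = d / 7"
  have \<delta>: "0 < \<delta>" using d by (simp add: \<delta>_def)
  obtain T where T: "trig_poly T" "sqn ?M (\<lambda>x. T x - q x) < \<delta>" using trig_dense[OF q(1) \<delta>] by blast
  obtain v v' a b where v: "trig_poly v" "trig_poly v'" "\<And>x. (v has_vector_derivative v' x) (at x)"
    and Tx: "\<And>x. T x = (complex_of_real (cos x) * v x + complex_of_real (sin x) * v' x) + (a + b * complex_of_real (sin x))"
    using reducible_trig[OF T(1)] unfolding reducible_def by blast
  let ?r = "\<lambda>x. complex_of_real (cos x) * v x + complex_of_real (sin x) * v' x"
  have Tq: "sq_int ?M (\<lambda>x. T x - q x)" by (intro sq_int_diff trig_sq_int T q)
  have bnd: "cmod (integral {s..t} T) \<le> 2 * \<delta>" if st: "- pi \<le> s" "s \<le> t" "t \<le> pi" "t - s = pi" "integral {s..t} q = 0" for s t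
  proof -
    have "integral {s..t} (\<lambda>x. T x - q x) = integral {s..t} T - integral {s..t} q"
      by (rule Henstock_Kurzweil_Integration.integral_diff)
         (rule sq_int_integrable_on[OF trig_sq_int[OF T(1)] st(1,3)], rule sq_int_integrable_on[OF q(1) st(1,3)])
    then have "cmod (integral {s..t} T) \<le> sqrt (t - s) * sqn ?M (\<lambda>x. T x - q x)"
      using norm_integral_sq_le[OF Tq st(1-3)] st(5) by simp
    also have "\<dots> \<le> 2 * \<delta>"
    proof (rule mult_mono)
      show "sqrt (t - s) \<le> 2" using pi_less_4 st(4) by (intro real_le_lsqrt) auto
    qed (use T \<delta> in auto)
    finally show ?thesis .
  qed
  have iT: "integral {s..t} T = (complex_of_real (sin t) * v t - complex_of_real (sin s) * v s) +
     ((complex_of_real t * a - b * complex_of_real (cos t)) - (complex_of_real s * a - b * complex_of_real (cos s)))" if "s \<le> t" for s t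
    unfolding Tx[abs_def]
    by (rule integral_unique, rule has_integral_add[OF sin_mult_has_integral[OF v(3) that] affine_sin_has_integral[OF that]])
  \<comment> \<open>The part \<open>(sin * v)'\<close> integrates to 0 over each half period, so
    only \<open>pi * a + 2 * b\<close> and, on the left, \<open>pi * a - 2 * b\<close> remain. Their
    sum and difference isolate \<open>a\<close> and \<open>b\<close>.\<close>
  have 1: "cmod (complex_of_real pi * a + 2 * b) \<le> 2 * \<delta>"
    using bnd[of 0 pi] q(3) iT[of 0 pi] by (simp add: algebra_simps)
  have 2: "cmod (complex_of_real pi * a - 2 * b) \<le> 2 * \<delta>"
    using bnd[of "-pi" 0] q(2) iT[of "-pi" 0] by (simp add: algebra_simps)
  have a2: "2 * (complex_of_real pi * a) = (complex_of_real pi * a + 2 * b) + (complex_of_real pi * a - 2 * b)" by simp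
  have "cmod (2 * (complex_of_real pi * a)) \<le> 2 * \<delta> + 2 * \<delta>"
    unfolding a2 by (rule order.trans[OF norm_triangle_ineq add_mono[OF 1 2]])
  then have "pi * cmod a \<le> 2 * \<delta>" by (simp add: norm_mult)
  moreover have "3 * cmod a \<le> pi * cmod a" using pi_gt3 by (intro mult_right_mono) auto
  ultimately have a: "cmod a \<le> \<delta>" using \<delta> by simp
  have b4: "4 * b = (complex_of_real pi * a + 2 * b) - (complex_of_real pi * a - 2 * b)" by simp
  have "cmod (4 * b) \<le> 2 * \<delta> + 2 * \<delta>"
    unfolding b4 by (rule order.trans[OF norm_triangle_ineq4 add_mono[OF 1 2]])
  then have b: "cmod b \<le> \<delta>" by (simp add: norm_mult)
  have tab: "trig_poly (\<lambda>x. a + b * complex_of_real (sin x))"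
    by (intro trig_add trig_const trig_cmult trig_sin)
  have "sqn ?M (\<lambda>x. a + b * complex_of_real (sin x)) \<le> 3 * (2 * \<delta>)"
  proof (rule sqn_le_3[OF sq_int_meas[OF trig_sq_int[OF tab]]])
    fix x :: real
    have "cmod (a + b * complex_of_real (sin x)) \<le> cmod a + cmod b * \<bar>sin x\<bar>"
      by (rule order.trans[OF norm_triangle_ineq]) (simp add: norm_mult)
    also have "\<dots> \<le> \<delta> + \<delta> * 1" using a b \<delta> by (intro add_mono mult_mono) auto
    finally show "cmod (a + b * complex_of_real (sin x)) \<le> 2 * \<delta>" by simp
  qed (use \<delta> in simp)
  then have 3: "sqn ?M (\<lambda>x. (- 1) * (a + b * complex_of_real (sin x))) \<le> 6 * \<delta>"
    by (subst sqn_cmult) simp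
  have "sqn ?M (\<lambda>x. (T x - q x) + (- 1) * (a + b * complex_of_real (sin x))) \<le> \<delta> + 6 * \<delta>"
    by (rule order.trans[OF sqn_add[OF Tq sq_int_cmult[OF trig_sq_int[OF tab]]] add_mono[OF less_imp_le[OF T(2)] 3]])
  also have "\<delta> + 6 * \<delta> = d" by (simp add: \<delta>_def)
  also have "(\<lambda>x. (T x - q x) + (- 1) * (a + b * complex_of_real (sin x))) = (\<lambda>x. ?r x - q x)"
    by (simp add: Tx fun_eq_iff)
  finally show thesis by (rule that[OF v])
qed

text \<open>The polynomial \<open>v\<close> approximates \<open>w\<close> for free:
  \<open>(sin * v)'\<close> is close to \<open>q\<close>, and the antiderivatives of both vanish at
  all zeros of \<open>sin\<close>, so Hardy's inequality bounds \<open>v - w\<close>. Subtracting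
  the mean of \<open>v\<close> allows integration to a trigonometric polynomial
  \<open>g\<close>.\<close>

lemma core_approx:
  assumes e: "0 < e" "e < 2" and qw: "profile q w" and w0: "integral {-pi..pi} w = 0" and d: "0 < d"
  obtains g g1 g2 where "trig_poly g" "trig_poly g1" "trig_poly g2"
    "\<And>x. (g has_vector_derivative g1 x) (at x)" "\<And>x. (g1 has_vector_derivative g2 x) (at x)"
    "sqn (lb (-pi) pi) (\<lambda>x. g x - (c + integral {-pi..x} w)) < d"
    "sqn (lb (-pi) pi) (\<lambda>x. (complex_of_real e * (complex_of_real (cos x) * g1 x + complex_of_real (sin x) * g2 x) + g1 x)
        - (complex_of_real e * q x + w x)) < d"
proof -
  let ?M = "lb (-pi) pi"
  have q: "sq_int ?M q" "integral {-pi..0} q = 0" "integral {0..pi} q = 0" and w: "sq_int ?M w"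
    and sw: "AE x in ?M. complex_of_real (sin x) * w x = integral {-pi..x} q"
    using qw by (simp_all add: profile_def)
  \<comment> \<open>The errors add up to \<open>144 * \<delta>\<close> for the function and to
    \<open>42 * \<delta>\<close> for its image, both below \<open>200 * \<delta>\<close>.\<close>
  define \<delta> where "\<delta> = d / 200"
  have \<delta>: "0 < \<delta>" using d by (simp add: \<delta>_def)
  obtain v v' where v: "trig_poly v" "trig_poly v'" "\<And>x. (v has_vector_derivative v' x) (at x)"
    "sqn ?M (\<lambda>x. (complex_of_real (cos x) * v x + complex_of_real (sin x) * v' x) - q x) \<le> \<delta>"
    using range_approx[OF q \<delta>] by blast
  let ?r = "\<lambda>x. complex_of_real (cos x) * v x + complex_of_real (sin x) * v' x"
  have rt: "trig_poly ?r" by (intro trig_add trig_mult trig_cos trig_sin v)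
  have rq: "sq_int ?M (\<lambda>x. ?r x - q x)" by (intro sq_int_diff trig_sq_int rt q)
  have vw: "sq_int ?M (\<lambda>x. v x - w x)" by (intro sq_int_diff trig_sq_int v w)
  have ir: "integral {s..t} (\<lambda>x. ?r x - q x) = (complex_of_real (sin t) * v t - complex_of_real (sin s) * v s) - integral {s..t} q"
    if "- pi \<le> s" "s \<le> t" "t \<le> pi" for s t
    using Henstock_Kurzweil_Integration.integral_diff[OF has_integral_integrable[OF sin_mult_has_integral[OF v(3) that(2)]] sq_int_integrable_on[OF q(1) that(1,3)]]
      integral_unique[OF sin_mult_has_integral[OF v(3) that(2)]] by simp
  have vwd: "sqn ?M (\<lambda>x. v x - w x) \<le> 4 * \<delta>"
  proof -
    have "sqn ?M (\<lambda>x. v x - w x) \<le> 4 * sqn ?M (\<lambda>x. ?r x - q x)"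
    proof (rule hardy_full(2)[OF rq _ _ sq_int_meas[OF vw]])
      show "integral {-pi..0} (\<lambda>x. ?r x - q x) = 0" using ir[of "-pi" 0] q(2) by simp
      show "integral {0..pi} (\<lambda>x. ?r x - q x) = 0" using ir[of 0 pi] q(3) by simp
      show "AE x in ?M. complex_of_real (sin x) * (v x - w x) = integral {-pi..x} (\<lambda>x. ?r x - q x)"
        using sw unfolding AE_lb_iff
      proof eventually_elim
        case (elim x)
        show ?case
        proof
          assume x: "x \<in> {-pi..pi}"
          then show "complex_of_real (sin x) * (v x - w x) = integral {-pi..x} (\<lambda>x. ?r x - q x)"
            using elim ir[of "-pi" x] by (simp add: right_diff_distrib)
        qed
      qed
    qed
    then show ?thesis using v(4) by linarith
  qed
  \<comment> \<open>An antiderivative of \<open>v\<close> is periodic only after the mean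
    \<open>m\<close> is subtracted; \<open>m\<close> is small because \<open>v\<close> is close to
    \<open>w\<close>, which has mean 0.\<close>
  obtain m g0 where g0: "trig_poly g0" "\<And>x. (g0 has_vector_derivative v x - m) (at x)"
    using trig_antideriv[OF v(1)] by blast
  have ig0: "((\<lambda>x. v x - m) has_integral g0 t - g0 s) {s..t}" if "s \<le> t" for s t
    by (rule fundamental_theorem_of_calculus[OF that]) (rule has_vector_derivative_at_within, rule g0(2))
  have m: "cmod m \<le> 4 * \<delta>"
  proof -
    have "g0 pi = g0 (- pi)" using trig_periodic[OF g0(1), of "-pi"] by simp
    then have 0: "((\<lambda>x. v x - m) has_integral 0) {-pi..pi}" using ig0[of "-pi" pi] by simp
    have iw: "(w has_integral 0) {-pi..pi}"
      using sq_int_integrable_on[OF w, of "-pi" pi] w0 by (simp add: has_integral_iff)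
    have im: "((\<lambda>x. m) has_integral (2 * pi) *\<^sub>R m) {-pi..pi}"
      using has_integral_const_real[of m "-pi" pi] by simp
    have "((\<lambda>x. (v x - m) - w x + m) has_integral 0 - 0 + (2 * pi) *\<^sub>R m) {-pi..pi}"
      by (intro has_integral_add has_integral_diff 0 iw im)
    then have "integral {-pi..pi} (\<lambda>x. v x - w x) = (2 * pi) *\<^sub>R m" by (simp add: integral_unique algebra_simps)
    then have "2 * pi * cmod m = cmod (integral {-pi..pi} (\<lambda>x. v x - w x))" by simp
    also have "\<dots> \<le> sqrt (pi - - pi) * sqn ?M (\<lambda>x. v x - w x)"
      by (rule norm_integral_sq_le[OF vw]) auto
    also have "\<dots> \<le> 3 * (4 * \<delta>)" using sqrt_2pi_le vwd \<delta> by (intro mult_mono) auto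
    finally have "2 * pi * cmod m \<le> 12 * \<delta>" by simp
    moreover have "3 * cmod m \<le> 2 * pi * cmod m" using pi_gt3 by (intro mult_right_mono) auto
    ultimately show ?thesis by simp
  qed
  \<comment> \<open>The constant makes \<open>g (- pi) = c\<close>, so that the error in the
    function is the indefinite integral of the error \<open>g1 - w\<close>.\<close>
  define g where "g = (\<lambda>x. g0 x + (c - g0 (- pi)))"
  define g1 where "g1 = (\<lambda>x. v x - m)"
  have gt: "trig_poly g" "trig_poly g1" unfolding g_def g1_def by (intro trig_add trig_diff trig_const g0 v)+
  have gd: "(g has_vector_derivative g1 x) (at x)" for x
    using has_vector_derivative_add[OF g0(2)[of x] has_vector_derivative_const[of "c - g0 (- pi)"]]
    by (simp add: g_def g1_def)
  have g1d: "(g1 has_vector_derivative v' x) (at x)" for x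
    using has_vector_derivative_diff[OF v(3)[of x] has_vector_derivative_const[of m]] by (simp add: g1_def)
  have g1w: "sq_int ?M (\<lambda>x. g1 x - w x)" by (intro sq_int_diff trig_sq_int gt w)
  have g1wd: "sqn ?M (\<lambda>x. g1 x - w x) \<le> 16 * \<delta>"
  proof -
    have "sqn ?M (\<lambda>x. (v x - w x) + (- m)) \<le> sqn ?M (\<lambda>x. v x - w x) + sqn ?M (\<lambda>x. - m)"
      by (rule sqn_add[OF vw trig_sq_int[OF trig_const]])
    also have "sqn ?M (\<lambda>x. - m) \<le> 3 * (4 * \<delta>)"
      by (rule sqn_le_3) (use m \<delta> in auto)
    finally have "sqn ?M (\<lambda>x. (v x - w x) + (- m)) \<le> 16 * \<delta>" using vwd by simp
    moreover have "(\<lambda>x. (v x - w x) + (- m)) = (\<lambda>x. g1 x - w x)" by (simp add: g1_def fun_eq_iff)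
    ultimately show ?thesis by simp
  qed
  show thesis
  proof (rule that[OF gt(1) gt(2) v(2) gd g1d])
    let ?D = "\<lambda>x. g x - (c + integral {-pi..x} w)"
    have D: "?D x = integral {-pi..x} (\<lambda>x. g1 x - w x)" if "x \<in> {-pi..pi}" for x
    proof -
      have x: "- pi \<le> x" "x \<le> pi" using that by auto
      have "integral {-pi..x} (\<lambda>x. g1 x - w x) = (g0 x - g0 (-pi)) - integral {-pi..x} w"
        using Henstock_Kurzweil_Integration.integral_diff[OF has_integral_integrable[OF ig0[OF x(1)]] sq_int_integrable_on[OF w order_refl x(2)]]
          integral_unique[OF ig0[OF x(1)]] by (simp add: g1_def)
      then show ?thesis by (simp add: g_def)
    qed
    have Db: "cmod (?D x) \<le> 48 * \<delta>" if x: "x \<in> {-pi..pi}" for x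
    proof -
      have "cmod (?D x) \<le> sqrt (x - - pi) * sqn ?M (\<lambda>x. g1 x - w x)"
        unfolding D[OF x] by (rule norm_integral_sq_le[OF g1w]) (use x in auto)
      also have "\<dots> \<le> 3 * (16 * \<delta>)"
      proof (rule mult_mono)
        have "sqrt (x - - pi) \<le> sqrt (2 * pi)" using x by simp
        then show "sqrt (x - - pi) \<le> 3" using sqrt_2pi_le by linarith
      qed (use g1wd \<delta> in auto)
      finally show ?thesis by simp
    qed
    have Dm: "?D \<in> borel_measurable ?M"
    proof (rule sq_int_meas)
      have ci: "continuous_on {-pi..pi} (\<lambda>x. integral {-pi..x} w)"
        by (rule indefinite_integral_continuous_1) (rule sq_int_integrable_on[OF w], auto)
      show "sq_int ?M ?D"
        by (intro sq_int_continuous continuous_on_diff continuous_on_add continuous_on_const ci trig_continuous[OF gt(1)])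
    qed
    have "sqn ?M ?D \<le> 3 * (48 * \<delta>)" by (rule sqn_le_3[OF Dm Db]) (use \<delta> in auto)
    then show "sqn ?M ?D < d" using \<delta> by (simp add: \<delta>_def)
    let ?E = "\<lambda>x. (complex_of_real e * (complex_of_real (cos x) * g1 x + complex_of_real (sin x) * v' x) + g1 x)
        - (complex_of_real e * q x + w x)"
    let ?c = "\<lambda>x. complex_of_real (cos x)"
    have E: "?E = (\<lambda>x. complex_of_real e * (?r x - q x) + ((- complex_of_real e * m) * ?c x + (g1 x - w x)))"
      by (auto simp: g1_def fun_eq_iff algebra_simps)
    have s1: "sqn ?M (\<lambda>x. complex_of_real e * (?r x - q x)) \<le> 2 * \<delta>"
      unfolding sqn_cmult using e v(4) \<delta> by (intro mult_mono) auto
    have s2: "sqn ?M (\<lambda>x. (- complex_of_real e * m) * ?c x) \<le> (2 * (4 * \<delta>)) * 3"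
    proof -
      have "sqn ?M ?c \<le> 3 * 1" by (rule sqn_le_3[OF sq_int_meas[OF trig_sq_int[OF trig_cos]]]) auto
      moreover have "cmod (- complex_of_real e * m) \<le> 2 * (4 * \<delta>)"
        unfolding norm_mult norm_minus_cancel using e m \<delta> by (intro mult_mono) auto
      ultimately show ?thesis unfolding sqn_cmult using \<delta> by (intro mult_mono) auto
    qed
    have "sqn ?M ?E \<le> sqn ?M (\<lambda>x. complex_of_real e * (?r x - q x)) + (sqn ?M (\<lambda>x. (- complex_of_real e * m) * ?c x) + sqn ?M (\<lambda>x. g1 x - w x))"
      unfolding E by (intro order.trans[OF sqn_add] add_mono order_refl sqn_add sq_int_add sq_int_cmult rq g1w trig_sq_int trig_cos)
    also have "\<dots> \<le> 2 * \<delta> + ((2 * (4 * \<delta>)) * 3 + 16 * \<delta>)" by (intro add_mono s1 s2 g1wd)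
    also have "\<dots> < d" using d by (simp add: \<delta>_def)
    finally show "sqn ?M ?E < d" .
  qed
qed

subsection \<open>The symmetry J and the proof of the theorem\<close>

text \<open>\<open>per_ext\<close> takes representatives in \<open>{-pi..<pi}\<close>, so
  \<open>x = 0\<close> belongs to the second branch and gives \<open>f (- pi)\<close>.\<close>

lemma Jop_eq:
  assumes "x \<in> {-pi..pi}"
  shows "Jop f x = (if 0 < x then f (pi - x) else f (- pi - x))"
proof (cases "0 < x")
  case True
  have "\<lfloor>(pi - x + pi) / (2 * pi)\<rfloor> = 0"
    using assms True by (intro floor_unique) (auto simp: field_simps)
  then show ?thesis using True by (simp add: Jop_def per_ext_def)
next
  case False
  have "\<lfloor>(pi - x + pi) / (2 * pi)\<rfloor> = 1"
  proof (rule floor_unique)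
    have "- pi \<le> x" "x \<le> 0" using assms False by auto
    then have "2 * pi \<le> pi - x + pi" "pi - x + pi < 2 * (2 * pi)" using pi_gt3 by linarith+
    then show "of_int 1 \<le> (pi - x + pi) / (2 * pi)" "(pi - x + pi) / (2 * pi) < of_int 1 + 1"
      by (simp_all add: divide_simps)
  qed
  then show ?thesis using False by (simp add: Jop_def per_ext_def)
qed

lemma Jop_diff: "Jop (\<lambda>x. f x - g x) = (\<lambda>x. Jop f x - Jop g x)"
  by (simp add: Jop_def per_ext_def fun_eq_iff)

text \<open>At pi the left-hand side would be \<open>f (- pi)\<close>, hence the half-open
  interval.\<close>

lemma Jop_Jop: "x \<in> {-pi..<pi} \<Longrightarrow> Jop (Jop f) x = f x"
  using Jop_eq[of x "Jop f"] Jop_eq[of "pi - x" f] Jop_eq[of "- pi - x" f] by (cases "0 < x") auto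

text \<open>\<open>J\<close> maps each half period to itself, by \<open>x -> pi - x\<close> on the
  right and \<open>x -> - pi - x\<close> on the left, so the reflection lemmas apply on each; on the
  right the point 0 takes the other branch.\<close>

lemma sq_int_Jop_halves:
  assumes "sq_int (lb (-pi) pi) f"
  shows "sq_int (lb 0 pi) (Jop f)" "sq_int (lb (-pi) 0) (Jop f)"
    "sqn (lb 0 pi) (Jop f) = sqn (lb 0 pi) f" "sqn (lb (-pi) 0) (Jop f) = sqn (lb (-pi) 0) f"
    "(LINT x|lb 0 pi. Jop f x) = (LINT x|lb 0 pi. f x)" "(LINT x|lb (-pi) 0. Jop f x) = (LINT x|lb (-pi) 0. f x)"
proof -
  have R: "sq_int (lb 0 pi) (\<lambda>x. f (pi - x))"
    using sq_int_reflect[OF sq_int_lb_mono[OF assms, of 0 pi], of pi] by simp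
  have L: "sq_int (lb (-pi) 0) (\<lambda>x. f (- pi - x))"
    using sq_int_reflect[OF sq_int_lb_mono[OF assms, of "-pi" 0], of "-pi"] by simp
  show JR: "sq_int (lb 0 pi) (Jop f)"
    by (rule sq_int_spike[OF R, of "{0}"]) (auto simp: Jop_eq)
  show JL: "sq_int (lb (-pi) 0) (Jop f)"
    by (rule sq_int_spike[OF L, of "{}"]) (auto simp: Jop_eq)
  have aR: "AE x in lb 0 pi. Jop f x = f (pi - x)"
    using AE_lb_not_eq[of 0 0 pi] unfolding AE_lb_iff by eventually_elim (auto simp: Jop_eq)
  have aL: "AE x in lb (-pi) 0. Jop f x = f (- pi - x)"
    unfolding AE_lb_iff by (auto simp: Jop_eq)
  show "sqn (lb 0 pi) (Jop f) = sqn (lb 0 pi) f"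
    using sqn_cong_AE[OF sq_int_meas[OF JR] sq_int_meas[OF R] aR] sqn_reflect[of pi pi 0 f] by simp
  show "sqn (lb (-pi) 0) (Jop f) = sqn (lb (-pi) 0) f"
    using sqn_cong_AE[OF sq_int_meas[OF JL] sq_int_meas[OF L] aL] sqn_reflect[of "-pi" 0 "-pi" f] by simp
  show "(LINT x|lb 0 pi. Jop f x) = (LINT x|lb 0 pi. f x)"
    using integral_cong_AE[OF sq_int_meas[OF JR] sq_int_meas[OF R] aR] integral_lb_reflect[of pi pi 0 f] by simp
  show "(LINT x|lb (-pi) 0. Jop f x) = (LINT x|lb (-pi) 0. f x)"
    using integral_cong_AE[OF sq_int_meas[OF JL] sq_int_meas[OF L] aL] integral_lb_reflect[of "-pi" 0 "-pi" f] by simp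
qed

lemma sq_int_Jop:
  assumes "sq_int (lb (-pi) pi) f" shows "sq_int (lb (-pi) pi) (Jop f)"
  using sq_int_glue[OF sq_int_Jop_halves(2,1)[OF assms]] by simp

lemma sqn_Jop:
  assumes "sq_int (lb (-pi) pi) f" shows "sqn (lb (-pi) pi) (Jop f) = sqn (lb (-pi) pi) f"
proof -
  have "(sqn (lb (-pi) pi) (Jop f))\<^sup>2 = (sqn (lb (-pi) pi) f)\<^sup>2"
    using sqn_split[OF sq_int_Jop[OF assms], of 0] sqn_split[OF assms, of 0] sq_int_Jop_halves(3,4)[OF assms] by simp
  then show ?thesis by (rule power2_eq_imp_eq) simp_all
qed

lemma integral_Jop:
  assumes "sq_int (lb (-pi) pi) f" shows "(LINT x|lb (-pi) pi. Jop f x) = (LINT x|lb (-pi) pi. f x)"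
  using integral_lb_split[OF sq_int_lb_integrable[OF sq_int_Jop[OF assms]], of 0]
    integral_lb_split[OF sq_int_lb_integrable[OF assms], of 0] sq_int_Jop_halves(5,6)[OF assms] by simp

lemma sq_int_Jop_iff: "sq_int (lb (-pi) pi) (Jop f) \<longleftrightarrow> sq_int (lb (-pi) pi) f"
proof
  assume "sq_int (lb (-pi) pi) (Jop f)"
  from sq_int_spike[OF sq_int_Jop[OF this], of "{pi}" f]
  show "sq_int (lb (-pi) pi) f" using Jop_Jop[of _ f] by auto
qed (rule sq_int_Jop)

lemma Jop_trig: assumes "trig_poly g" "x \<in> {-pi..pi}" shows "Jop g x = g (pi - x)"
  using Jop_eq[OF assms(2), of g] trig_periodic[OF assms(1), of "- pi - x"] by (auto simp: algebra_simps)

section \<open>The trigonometric core and symmetry with respect to J\<close>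

definition core_op :: "real \<Rightarrow> (real \<Rightarrow> complex) \<Rightarrow> (real \<Rightarrow> complex) \<Rightarrow> real \<Rightarrow> complex" where
  "core_op e g1 g2 x = complex_of_real e * (complex_of_real (cos x) * g1 x + complex_of_real (sin x) * g2 x) + g1 x"

lemma trig_core_op: "trig_poly g1 \<Longrightarrow> trig_poly g2 \<Longrightarrow> trig_poly (core_op e g1 g2)"
  unfolding core_op_def[abs_def] by (intro trig_add trig_cmult trig_mult trig_cos trig_sin)

definition core :: "(real \<Rightarrow> complex) \<Rightarrow> (real \<Rightarrow> complex) \<Rightarrow> (real \<Rightarrow> complex) \<Rightarrow> bool" where
  "core g g1 g2 \<longleftrightarrow> trig_poly g \<and> trig_poly g1 \<and> trig_poly g2 \<and>
     (\<forall>x. (g has_vector_derivative g1 x) (at x)) \<and> (\<forall>x. (g1 has_vector_derivative g2 x) (at x))"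

lemma sin_mult_deriv:
  assumes "(v has_vector_derivative v') (at x)"
  shows "((\<lambda>x. complex_of_real (sin x) * v x) has_vector_derivative
     complex_of_real (sin x) * v' + complex_of_real (cos x) * v x) (at x)"
  by (intro has_vector_derivative_mult has_vector_derivative_of_real assms) (auto intro!: derivative_eq_intros)

lemma LgraphI:
  assumes "L2 y" "L2 f" "abs_cont_on {-pi..pi} u" "u (-pi) = u pi" "loc_abs_cont p"
    "AE x in lborel. x \<in> {-pi..pi} \<longrightarrow>
            y x = u x \<and> (u has_vector_derivative u' x) (at x) \<and>
            p x = complex_of_real (sin x) * u' x \<and>
            (p has_vector_derivative p' x) (at x) \<and>
            f x = complex_of_real e * p' x + u' x"
  shows "(y, f) \<in> Lgraph e"
  unfolding Lgraph_def using assms by blast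

lemma core_in_L0:
  assumes "core g g1 g2" shows "(g, core_op e g1 g2) \<in> L0graph e"
proof -
  have t: "trig_poly g" "trig_poly g1" "trig_poly g2"
    and d: "\<And>x. (g has_vector_derivative g1 x) (at x)" "\<And>x. (g1 has_vector_derivative g2 x) (at x)"
    using assms by (simp_all add: core_def)
  let ?p = "\<lambda>x. complex_of_real (sin x) * g1 x"
  let ?p' = "\<lambda>x. complex_of_real (sin x) * g2 x + complex_of_real (cos x) * g1 x"
  have dp: "(?p has_vector_derivative ?p' x) (at x)" for x by (rule sin_mult_deriv[OF d(2)])
  have "abs_cont_on {-pi..pi} g"
    by (rule abs_cont_on_C1[OF d(1)]) (rule trig_continuous[OF t(2)])
  moreover have "g (- pi) = g pi" using trig_periodic[OF t(1), of "-pi"] by simp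
  moreover have "loc_abs_cont ?p"
    unfolding loc_abs_cont_def
    by (intro allI impI abs_cont_on_C1[OF dp] trig_continuous trig_add trig_mult trig_sin trig_cos t)
  moreover have "L2 g" "L2 (core_op e g1 g2)"
    unfolding L2_iff_sq_int by (intro trig_sq_int trig_core_op t)+
  moreover have AE: "AE x in lborel. x \<in> {-pi..pi} \<longrightarrow>
            g x = g x \<and> (g has_vector_derivative g1 x) (at x) \<and>
            ?p x = complex_of_real (sin x) * g1 x \<and>
            (?p has_vector_derivative ?p' x) (at x) \<and>
            core_op e g1 g2 x = complex_of_real e * ?p' x + g1 x"
    using d dp by (simp add: core_op_def add.commute)
  ultimately have "abs_cont_on {-pi..pi} g \<and> g (- pi) = g pi \<and> loc_abs_cont ?p \<and> L2 g \<and> L2 (core_op e g1 g2)"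
    by (intro conjI)
  then have "(g, core_op e g1 g2) \<in> Lgraph e"
    by (elim conjE) (rule LgraphI[OF _ _ _ _ _ AE])
  moreover have "smooth_fun g" "periodic_2pi g"
    using trig_smooth[OF t(1)] trig_periodic[OF t(1)] by (simp_all add: periodic_2pi_def)
  ultimately show ?thesis unfolding L0graph_def by auto
qed

lemma Lgraph_core_approx:
  assumes e: "0 < e" "e < 2" and yf: "(y, f) \<in> Lgraph e" and d: "0 < d"
  obtains g g1 g2 where "core g g1 g2"
    "sqn (lb (-pi) pi) (\<lambda>x. g x - y x) < d" "sqn (lb (-pi) pi) (\<lambda>x. core_op e g1 g2 x - f x) < d"
proof -
  obtain c q w where qw: "profile q w" "integral {-pi..pi} w = 0"
    and y: "AE x in lb (-pi) pi. y x = c + integral {-pi..x} w"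
    and f: "\<And>x. f x = complex_of_real e * q x + w x"
    by (rule Lgraph_profile[OF e yf]) (rule that)
  have y2: "sq_int (lb (-pi) pi) y" using yf by (simp add: Lgraph_def L2_iff_sq_int)
  have w: "sq_int (lb (-pi) pi) w" using qw by (simp add: profile_def)
  obtain g g1 g2 where g: "trig_poly g" "trig_poly g1" "trig_poly g2"
    "\<And>x. (g has_vector_derivative g1 x) (at x)" "\<And>x. (g1 has_vector_derivative g2 x) (at x)"
    "sqn (lb (-pi) pi) (\<lambda>x. g x - (c + integral {-pi..x} w)) < d"
    "sqn (lb (-pi) pi) (\<lambda>x. (complex_of_real e * (complex_of_real (cos x) * g1 x + complex_of_real (sin x) * g2 x) + g1 x)
        - (complex_of_real e * q x + w x)) < d"
    by (rule core_approx[OF e qw d, of c]) (rule that)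
  have ci: "continuous_on {-pi..pi} (\<lambda>x. integral {-pi..x} w)"
    by (rule indefinite_integral_continuous_1) (rule sq_int_integrable_on[OF w], auto)
  have "sq_int (lb (-pi) pi) (\<lambda>x. g x - (c + integral {-pi..x} w))"
    by (intro sq_int_continuous continuous_on_diff continuous_on_add continuous_on_const ci trig_continuous[OF g(1)])
  from sqn_cong_AE[OF sq_int_meas[OF sq_int_diff[OF trig_sq_int[OF g(1)] y2]] sq_int_meas[OF this]]
  have "sqn (lb (-pi) pi) (\<lambda>x. g x - y x) = sqn (lb (-pi) pi) (\<lambda>x. g x - (c + integral {-pi..x} w))"
    using y by (simp add: AE_lb_iff eventually_mono)
  moreover have "core g g1 g2" using g by (simp add: core_def)
  ultimately show thesis using that g(6,7) by (simp add: core_op_def f)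
qed

lemma Lgraph_core_sequence:
  assumes e: "0 < e" "e < 2" and yf: "(y, f) \<in> Lgraph e"
  obtains g g1 g2 where "\<And>n::nat. core (g n) (g1 n) (g2 n)"
    "(\<lambda>n. sqn (lb (-pi) pi) (\<lambda>x. g n x - y x)) \<longlonglongrightarrow> 0"
    "(\<lambda>n. sqn (lb (-pi) pi) (\<lambda>x. core_op e (g1 n) (g2 n) x - f x)) \<longlonglongrightarrow> 0"
proof -
  let ?M = "lb (-pi) pi"
  have "\<exists>z. core (fst z) (fst (snd z)) (snd (snd z)) \<and> sqn ?M (\<lambda>x. fst z x - y x) < inverse (real (Suc n)) \<and>
     sqn ?M (\<lambda>x. core_op e (fst (snd z)) (snd (snd z)) x - f x) < inverse (real (Suc n))" for n
  proof -
    have pos: "0 < inverse (real (Suc n))" by simp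
    obtain g g1 g2 where "core g g1 g2" "sqn ?M (\<lambda>x. g x - y x) < inverse (real (Suc n))"
      "sqn ?M (\<lambda>x. core_op e g1 g2 x - f x) < inverse (real (Suc n))"
      by (rule Lgraph_core_approx[OF e yf pos]) (rule that)
    then show ?thesis by (intro exI[of _ "(g, g1, g2)"]) simp
  qed
  then have "\<forall>n. \<exists>z. core (fst z) (fst (snd z)) (snd (snd z)) \<and> sqn ?M (\<lambda>x. fst z x - y x) < inverse (real (Suc n)) \<and>
     sqn ?M (\<lambda>x. core_op e (fst (snd z)) (snd (snd z)) x - f x) < inverse (real (Suc n))" by (rule allI)
  from choice[OF this] obtain z where z: "\<And>n. core (fst (z n)) (fst (snd (z n))) (snd (snd (z n)))"
    "\<And>n. sqn ?M (\<lambda>x. fst (z n) x - y x) < inverse (real (Suc n))"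
    "\<And>n. sqn ?M (\<lambda>x. core_op e (fst (snd (z n))) (snd (snd (z n))) x - f x) < inverse (real (Suc n))" by blast
  show thesis
  proof (rule that[OF z(1)])
    show "(\<lambda>n. sqn (lb (-pi) pi) (\<lambda>x. fst (z n) x - y x)) \<longlonglongrightarrow> 0"
      by (rule tendsto_sandwich[OF _ _ tendsto_const LIMSEQ_inverse_real_of_nat])
         (use z(2) in \<open>auto intro!: always_eventually less_imp_le\<close>)
    show "(\<lambda>n. sqn (lb (-pi) pi) (\<lambda>x. core_op e (fst (snd (z n))) (snd (snd (z n))) x - f x)) \<longlonglongrightarrow> 0"
      by (rule tendsto_sandwich[OF _ _ tendsto_const LIMSEQ_inverse_real_of_nat])
         (use z(3) in \<open>auto intro!: always_eventually less_imp_le\<close>)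
  qed
qed

text \<open>Integration by parts moves \<open>e * (sin * g')' + g'\<close> to the other factor as
  \<open>e * (sin * k')' - k'\<close>; the reflection contained in \<open>k\<close> keeps
  \<open>sin\<close>, reverses the derivative and so restores the sign of the first-order
  term.\<close>

lemma core_symmetric:
  assumes G: "core g g1 g2" and H: "core h h1 h2"
  shows "(LINT x|lb (-pi) pi. core_op e g1 g2 x * cnj (Jop h x)) = (LINT x|lb (-pi) pi. g x * cnj (Jop (core_op e h1 h2) x))"
proof -
  let ?M = "lb (-pi) pi"
  have tg: "trig_poly g" "trig_poly g1" "trig_poly g2"
    and dg: "\<And>x. (g has_vector_derivative g1 x) (at x)" "\<And>x. (g1 has_vector_derivative g2 x) (at x)"
    using G by (simp_all add: core_def)
  have th: "trig_poly h" "trig_poly h1" "trig_poly h2"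
    and dh: "\<And>x. (h has_vector_derivative h1 x) (at x)" "\<And>x. (h1 has_vector_derivative h2 x) (at x)"
    using H by (simp_all add: core_def)
  define k where "k = (\<lambda>x. cnj (h (pi - x)))"
  define k1 where "k1 = (\<lambda>x. cnj (h1 (pi - x)))"
  define k2 where "k2 = (\<lambda>x. cnj (h2 (pi - x)))"
  have refl: "((\<lambda>x. cnj (F (pi - x))) has_vector_derivative - cnj (F' (pi - x))) (at x)"
    if "\<And>x. (F has_vector_derivative F' x) (at x)" for F F' :: "real \<Rightarrow> complex" and x
  proof -
    have "((\<lambda>x. pi - x) has_vector_derivative - 1) (at x)" by (auto intro!: derivative_eq_intros)
    from vector_diff_chain_at[OF this that[of "pi - x"]]
    have "((\<lambda>x. F (pi - x)) has_vector_derivative - F' (pi - x)) (at x)" by (simp add: o_def)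
    from has_vector_derivative_cnj[OF this] show ?thesis by simp
  qed
  have dk: "(k has_vector_derivative - k1 x) (at x)" "(k1 has_vector_derivative - k2 x) (at x)" for x
    unfolding k_def k1_def k2_def by (rule refl[OF dh(1)], rule refl[OF dh(2)])
  let ?s = "\<lambda>x. complex_of_real (sin x)" and ?c = "\<lambda>x. complex_of_real (cos x)"
  \<comment> \<open>Boundary form of Lagrange's identity: as \<open>k' = - k1\<close>, its
    derivative \<open>D\<close> is the difference of the two integrands, and by periodicity
    \<open>P\<close> has the same value at both ends.\<close>
  define P where "P = (\<lambda>x. complex_of_real e * (?s x * (g1 x * k x + g x * k1 x)) + g x * k x)"
  define D where "D = (\<lambda>x. core_op e g1 g2 x * k x - g x * (complex_of_real e * (- ?c x * k1 x + ?s x * k2 x) + k1 x))"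
  have dP: "(P has_vector_derivative D x) (at x)" for x
  proof -
    have "(P has_vector_derivative complex_of_real e * (?s x * ((g1 x * (- k1 x) + g2 x * k x) + (g x * (- k2 x) + g1 x * k1 x))
        + ?c x * (g1 x * k x + g x * k1 x)) + (g x * (- k1 x) + g1 x * k x)) (at x)"
      unfolding P_def
      by (intro has_vector_derivative_add has_vector_derivative_mult has_vector_derivative_mult_right sin_mult_deriv dg dk)
    moreover have "complex_of_real e * (?s x * ((g1 x * (- k1 x) + g2 x * k x) + (g x * (- k2 x) + g1 x * k1 x))
        + ?c x * (g1 x * k x + g x * k1 x)) + (g x * (- k1 x) + g1 x * k x) = D x"
      by (simp add: D_def core_op_def algebra_simps)
    ultimately show ?thesis by simp
  qed
  have "g pi = g (- pi)" using trig_periodic[OF tg(1), of "-pi"] by simp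
  moreover have "k pi = k (- pi)" using trig_periodic[OF th(1), of 0] by (simp add: k_def)
  ultimately have "P pi = P (- pi)" by (simp add: P_def)
  moreover have "(D has_integral P pi - P (- pi)) {-pi..pi}"
    by (rule fundamental_theorem_of_calculus) (use dP in \<open>auto intro: has_vector_derivative_at_within\<close>)
  ultimately have D0: "integral {-pi..pi} D = 0" by (simp add: integral_unique)
  have J1: "cnj (Jop h x) = k x" if "x \<in> {-pi..pi}" for x
    using Jop_trig[OF th(1) that] by (simp add: k_def)
  have J2: "cnj (Jop (core_op e h1 h2) x) = complex_of_real e * (- ?c x * k1 x + ?s x * k2 x) + k1 x" if "x \<in> {-pi..pi}" for x
    using Jop_trig[OF trig_core_op[OF th(2,3)] that, of e] by (simp add: core_op_def k1_def k2_def)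
  have s: "sq_int ?M (\<lambda>x. cnj (Jop h x))" "sq_int ?M (\<lambda>x. cnj (Jop (core_op e h1 h2) x))"
    by (intro sq_int_cnj sq_int_Jop trig_sq_int trig_core_op th)+
  have i: "integrable ?M (\<lambda>x. core_op e g1 g2 x * cnj (Jop h x))" "integrable ?M (\<lambda>x. g x * cnj (Jop (core_op e h1 h2) x))"
    by (intro integrable_sq_mult trig_sq_int trig_core_op tg s)+
  have "(LINT x|?M. core_op e g1 g2 x * cnj (Jop h x)) - (LINT x|?M. g x * cnj (Jop (core_op e h1 h2) x))
      = (LINT x|?M. core_op e g1 g2 x * cnj (Jop h x) - g x * cnj (Jop (core_op e h1 h2) x))"
    by (rule Bochner_Integration.integral_diff[OF i, symmetric])
  also have "\<dots> = integral {-pi..pi} (\<lambda>x. core_op e g1 g2 x * cnj (Jop h x) - g x * cnj (Jop (core_op e h1 h2) x))"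
    by (rule integral_lb[OF Bochner_Integration.integrable_diff[OF i], symmetric])
  also have "\<dots> = integral {-pi..pi} D"
    by (rule integral_cong) (simp only: J1 J2 D_def)
  finally show ?thesis using D0 by simp
qed

lemma Lgraph_L2: "(y, f) \<in> Lgraph e \<Longrightarrow> sq_int (lb (-pi) pi) y \<and> sq_int (lb (-pi) pi) f"
  by (simp add: Lgraph_def L2_iff_sq_int)

lemma Jop_tendsto:
  assumes "\<And>n. sq_int (lb (-pi) pi) (F n)" "sq_int (lb (-pi) pi) f"
    "(\<lambda>n. sqn (lb (-pi) pi) (\<lambda>x. F n x - f x)) \<longlonglongrightarrow> 0"
  shows "(\<lambda>n. sqn (lb (-pi) pi) (\<lambda>x. Jop (F n) x - Jop f x)) \<longlonglongrightarrow> 0"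
  using assms(3) sqn_Jop[OF sq_int_diff[OF assms(1,2)]] by (simp add: Jop_diff)

text \<open>Both pairs are approximated from the core, where \<open>core_symmetric\<close> applies;
  since \<open>J\<close> preserves the norm, the reflected sequences converge as well.\<close>

lemma Lgraph_J_symmetric:
  assumes e: "0 < e" "e < 2" and yf: "(y, f) \<in> Lgraph e" and uv: "(u, v) \<in> Lgraph e"
  shows "L2_inner f (Jop u) = L2_inner y (Jop v)"
proof -
  let ?M = "lb (-pi) pi"
  have s: "sq_int ?M y" "sq_int ?M f" "sq_int ?M u" "sq_int ?M v" using Lgraph_L2[OF yf] Lgraph_L2[OF uv] by auto
  obtain g g1 g2 where g: "\<And>n::nat. core (g n) (g1 n) (g2 n)"
    "(\<lambda>n. sqn ?M (\<lambda>x. g n x - y x)) \<longlonglongrightarrow> 0" "(\<lambda>n. sqn ?M (\<lambda>x. core_op e (g1 n) (g2 n) x - f x)) \<longlonglongrightarrow> 0"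
    by (rule Lgraph_core_sequence[OF e yf]) (rule that)
  obtain h h1 h2 where h: "\<And>n::nat. core (h n) (h1 n) (h2 n)"
    "(\<lambda>n. sqn ?M (\<lambda>x. h n x - u x)) \<longlonglongrightarrow> 0" "(\<lambda>n. sqn ?M (\<lambda>x. core_op e (h1 n) (h2 n) x - v x)) \<longlonglongrightarrow> 0"
    by (rule Lgraph_core_sequence[OF e uv]) (rule that)
  have tg: "sq_int ?M (g n)" "sq_int ?M (core_op e (g1 n) (g2 n))" for n
    using g(1)[of n] trig_sq_int trig_core_op unfolding core_def by blast+
  have th: "sq_int ?M (h n)" "sq_int ?M (core_op e (h1 n) (h2 n))" for n
    using h(1)[of n] trig_sq_int trig_core_op unfolding core_def by blast+
  have 1: "(\<lambda>n. LINT x|?M. core_op e (g1 n) (g2 n) x * cnj (Jop (h n) x)) \<longlonglongrightarrow> (LINT x|?M. f x * cnj (Jop u x))"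
    by (rule tendsto_inner_sq[OF tg(2) sq_int_Jop[OF th(1)] s(2) sq_int_Jop[OF s(3)] g(3) Jop_tendsto[OF th(1) s(3) h(2)]])
  have 2: "(\<lambda>n. LINT x|?M. g n x * cnj (Jop (core_op e (h1 n) (h2 n)) x)) \<longlonglongrightarrow> (LINT x|?M. y x * cnj (Jop v x))"
    by (rule tendsto_inner_sq[OF tg(1) sq_int_Jop[OF th(2)] s(1) sq_int_Jop[OF s(4)] g(2) Jop_tendsto[OF th(2) s(4) h(3)]])
  show ?thesis unfolding L2_inner_eq
    by (rule LIMSEQ_unique[OF 1]) (use 2 core_symmetric[OF g(1) h(1)] in simp)
qed

lemma Lgraph_subset_closure:
  assumes e: "0 < e" "e < 2" shows "Lgraph e \<subseteq> graph_closure (L0graph e)"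
proof (rule subrelI)
  fix y f assume yf: "(y, f) \<in> Lgraph e"
  obtain g g1 g2 where g: "\<And>n::nat. core (g n) (g1 n) (g2 n)"
    "(\<lambda>n. sqn (lb (-pi) pi) (\<lambda>x. g n x - y x)) \<longlonglongrightarrow> 0"
    "(\<lambda>n. sqn (lb (-pi) pi) (\<lambda>x. core_op e (g1 n) (g2 n) x - f x)) \<longlonglongrightarrow> 0"
    by (rule Lgraph_core_sequence[OF e yf]) (rule that)
  have "\<exists>s. (\<forall>n. s n \<in> L0graph e) \<and>
        (\<lambda>n. L2_norm (\<lambda>x. fst (s n) x - y x)) \<longlonglongrightarrow> 0 \<and> (\<lambda>n. L2_norm (\<lambda>x. snd (s n) x - f x)) \<longlonglongrightarrow> 0"
    unfolding L2_norm_eq_sqn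
    by (rule exI[of _ "\<lambda>n. (g n, core_op e (g1 n) (g2 n))"]) (use core_in_L0[OF g(1)] g(2,3) in simp)
  then show "(y, f) \<in> graph_closure (L0graph e)"
    using Lgraph_L2[OF yf] by (simp add: graph_closure_def L2_iff_sq_int)
qed

lemma J_conj_adjoint_iff:
  "(u, v) \<in> J_conj_graph (adjoint_graph (Lgraph e)) \<longleftrightarrow>
     sq_int (lb (-pi) pi) u \<and> sq_int (lb (-pi) pi) v \<and>
     (\<forall>y f. (y, f) \<in> Lgraph e \<longrightarrow> L2_inner f (Jop u) = L2_inner y (Jop v))"
  by (auto simp: J_conj_graph_def adjoint_graph_def L2_iff_sq_int sq_int_Jop_iff)

text \<open>Tested against a fixed pair of \<open>Lgraph e\<close>, the adjoint relation is
  continuous in \<open>(u, v)\<close>, and on \<open>L0graph e\<close> it holds by symmetry. Landing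
  in the adjoint rather than in \<open>Lgraph e\<close> avoids a direct proof that \<open>L\<close>
  is closed.\<close>

lemma closure_subset_J_conj:
  assumes e: "0 < e" "e < 2" shows "graph_closure (L0graph e) \<subseteq> J_conj_graph (adjoint_graph (Lgraph e))"
proof (rule subrelI)
  let ?M = "lb (-pi) pi"
  fix u v assume uv: "(u, v) \<in> graph_closure (L0graph e)"
  then have s: "sq_int ?M u" "sq_int ?M v" by (simp_all add: graph_closure_def L2_iff_sq_int)
  obtain S where S: "\<And>n. S n \<in> L0graph e" "(\<lambda>n. sqn ?M (\<lambda>x. fst (S n) x - u x)) \<longlonglongrightarrow> 0"
    "(\<lambda>n. sqn ?M (\<lambda>x. snd (S n) x - v x)) \<longlonglongrightarrow> 0"
    using uv unfolding graph_closure_def L2_norm_eq_sqn by blast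
  have SL: "(fst (S n), snd (S n)) \<in> Lgraph e" for n using S(1)[of n] by (auto simp: L0graph_def)
  have Ss: "sq_int ?M (fst (S n))" "sq_int ?M (snd (S n))" for n using Lgraph_L2[OF SL] by auto
  have "L2_inner f (Jop u) = L2_inner y (Jop v)" if yf: "(y, f) \<in> Lgraph e" for y f
  proof -
    have yfs: "sq_int ?M y" "sq_int ?M f" using Lgraph_L2[OF yf] by auto
    have z: "(\<lambda>n::nat. sqn ?M (\<lambda>x. a x - a x)) \<longlonglongrightarrow> 0" for a by (simp add: sqn_def)
    have 1: "(\<lambda>n. LINT x|?M. f x * cnj (Jop (fst (S n)) x)) \<longlonglongrightarrow> (LINT x|?M. f x * cnj (Jop u x))"
      by (rule tendsto_inner_sq[OF yfs(2) sq_int_Jop[OF Ss(1)] yfs(2) sq_int_Jop[OF s(1)] z Jop_tendsto[OF Ss(1) s(1) S(2)]])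
    have 2: "(\<lambda>n. LINT x|?M. y x * cnj (Jop (snd (S n)) x)) \<longlonglongrightarrow> (LINT x|?M. y x * cnj (Jop v x))"
      by (rule tendsto_inner_sq[OF yfs(1) sq_int_Jop[OF Ss(2)] yfs(1) sq_int_Jop[OF s(2)] z Jop_tendsto[OF Ss(2) s(2) S(3)]])
    show ?thesis unfolding L2_inner_eq
      by (rule LIMSEQ_unique[OF 1]) (use 2 Lgraph_J_symmetric[OF e yf SL] in \<open>simp add: L2_inner_eq\<close>)
  qed
  then show "(u, v) \<in> J_conj_graph (adjoint_graph (Lgraph e))" using s by (simp add: J_conj_adjoint_iff)
qed

lemma J_conj_subset_Lgraph:
  assumes e: "0 < e" "e < 2" shows "J_conj_graph (adjoint_graph (Lgraph e)) \<subseteq> Lgraph e"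
proof (rule subrelI)
  let ?M = "lb (-pi) pi"
  fix u v assume "(u, v) \<in> J_conj_graph (adjoint_graph (Lgraph e))"
  then have u: "sq_int ?M u" and v: "sq_int ?M v"
    and adj: "\<And>y f. (y, f) \<in> Lgraph e \<Longrightarrow> (LINT x|?M. f x * cnj (Jop u x)) = (LINT x|?M. y x * cnj (Jop v x))"
    by (auto simp: J_conj_adjoint_iff L2_inner_eq)
  \<comment> \<open>Testing the adjoint relation against the constant 1, on which \<open>L\<close>
    vanishes, shows that \<open>Jop v\<close>, hence \<open>v\<close>, has mean zero.\<close>
  have "core (\<lambda>x. 1) (\<lambda>x. 0) (\<lambda>x. 0)" by (simp add: core_def trig_const)
  then have "((\<lambda>x. 1), core_op e (\<lambda>x. 0) (\<lambda>x. 0)) \<in> Lgraph e"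
    using core_in_L0 by (fastforce simp: L0graph_def)
  from adj[OF this] have "(LINT x|?M. cnj (Jop v x)) = 0" by (simp add: core_op_def)
  then have "(LINT x|?M. Jop v x) = 0" by simp
  then have v0: "(LINT x|?M. v x) = 0" using integral_Jop[OF v] by simp
  have "L2 v" using v by (simp add: L2_iff_sq_int)
  from Lgraph_solve[OF e this v0] obtain z where zv: "(z, v) \<in> Lgraph e" by blast
  have z: "sq_int ?M z" using Lgraph_L2[OF zv] by simp
  define d where "d = (\<lambda>x. Jop u x - Jop z x)"
  have d: "sq_int ?M d" unfolding d_def by (intro sq_int_diff sq_int_Jop u z)
  \<comment> \<open>Subtracting the mean places \<open>F\<close> in the range of \<open>L\<close>,
    so it may be tested against itself: \<open>d\<close> is orthogonal to that range and constants
    are orthogonal to \<open>F\<close>, whence \<open>F\<close> vanishes in norm.\<close>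
  define m where "m = (LINT x|?M. d x) / complex_of_real (2 * pi)"
  define F where "F = (\<lambda>x. d x - m)"
  have cs: "sq_int ?M (\<lambda>x. a)" for a by (rule sq_int_continuous) simp
  have F: "sq_int ?M F" unfolding F_def by (rule sq_int_diff[OF d cs])
  have mM: "measure ?M (space ?M) = 2 * pi" by (subst measure_lb_space) auto
  have "(LINT x|?M. F x) = (LINT x|?M. d x) - (LINT x|?M. m)"
    unfolding F_def by (rule Bochner_Integration.integral_diff[OF sq_int_lb_integrable[OF d] sq_int_lb_integrable[OF cs]])
  also have "(LINT x|?M. m) = (2 * pi) *\<^sub>R m" unfolding lebesgue_integral_const mM ..
  finally have F0: "(LINT x|?M. F x) = 0" by (simp add: m_def scaleR_conv_of_real)
  have "L2 F" using F by (simp add: L2_iff_sq_int)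
  from Lgraph_solve[OF e this F0] obtain y where yF: "(y, F) \<in> Lgraph e" by blast
  have eq: "(LINT x|?M. F x * cnj (Jop u x)) = (LINT x|?M. F x * cnj (Jop z x))"
    using adj[OF yF] Lgraph_J_symmetric[OF e yF zv] by (simp add: L2_inner_eq)
  have i: "integrable ?M (\<lambda>x. F x * cnj (Jop u x))" "integrable ?M (\<lambda>x. F x * cnj (Jop z x))" "integrable ?M (\<lambda>x. F x * cnj m)"
    by (intro integrable_sq_mult F sq_int_cnj sq_int_Jop u z cs)+
  have "(LINT x|?M. F x * cnj (F x)) = (LINT x|?M. (F x * cnj (Jop u x) - F x * cnj (Jop z x)) - F x * cnj m)"
    by (intro Bochner_Integration.integral_cong refl) (simp add: F_def d_def algebra_simps)
  also have "\<dots> = ((LINT x|?M. F x * cnj (Jop u x)) - (LINT x|?M. F x * cnj (Jop z x))) - (LINT x|?M. F x * cnj m)"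
    using i by simp
  also have "\<dots> = 0" using eq F0 by simp
  finally have "(LINT x|?M. complex_of_real ((cmod (F x))\<^sup>2)) = 0"
    unfolding complex_norm_square .
  then have "complex_of_real (LINT x|?M. (cmod (F x))\<^sup>2) = 0" by (simp only: integral_complex_of_real)
  then have sF: "sqn ?M F = 0" by (simp add: sqn_def)
  define G where "G = (\<lambda>x. (u x - z x) - m)"
  have G: "sq_int ?M G" unfolding G_def by (intro sq_int_diff u z cs)
  \<comment> \<open>\<open>J\<close> fixes constants and preserves norms, so
    \<open>u - z - m\<close> vanishes in norm as well.\<close>
  have "Jop G = F" by (simp add: G_def F_def d_def Jop_def per_ext_def fun_eq_iff)
  then have "sqn ?M G = 0" using sqn_Jop[OF G] sF by simp
  from sqn_eq_0_AE[OF G this] have ae: "AE x in ?M. u x = z x + m"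
    by eventually_elim (simp add: G_def algebra_simps)
  obtain c q w where qw: "profile q w" "integral {-pi..pi} w = 0"
    and zc: "AE x in ?M. z x = c + integral {-pi..x} w"
    and vq: "\<And>x. v x = complex_of_real e * q x + w x"
    by (rule Lgraph_profile[OF e zv]) (rule that)
  have uc: "AE x in ?M. u x = (c + m) + integral {-pi..x} w"
    using ae zc by eventually_elim simp
  show "(u, v) \<in> Lgraph e"
    by (rule Lgraph_from_profile[OF qw _ _ uc]) (use u v vq in \<open>auto simp: L2_iff_sq_int\<close>)
qed

text \<open>The three inclusions close up in a cycle through the closure, which gives both
  equalities at once; closedness of \<open>Lgraph eps\<close> is a by-product.\<close>

theorem theorem2:
  fixes eps :: real
  assumes "0 < eps" and "eps < 2"
  shows "Lgraph eps = graph_closure (L0graph eps) \<and>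
         Lgraph eps = J_conj_graph (adjoint_graph (Lgraph eps))"
  using Lgraph_subset_closure[OF assms] closure_subset_J_conj[OF assms] J_conj_subset_Lgraph[OF assms]
  by blast

end
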